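(* Let $G=(V,E)$ be a simple undirected data graph, where each vertex has a degree at most $\lambda$. Let $P=(V_P,E_P)$ be a simple connected undirected pattern graph with a constant number of vertices. Then one can build in $O(|E|)$ expected time a data structure that supports each subgraph sampling operation in $$O\left(\frac{\mathit{polymat}_{\mathit{undir}}(|E|,\lambda,P)}{\max\{1,\mathrm{OUT}\}}\right)$$ expected time, where $\mathrm{OUT}$ is the number of occurrences of $P$ in $G$ and $\mathit{polymat}_{\mathit{undir}}(|E|,\lambda,P)$ is the undirected polymatroid bound given by the closed form $$\mathit{polymat}_{\mathit{undir}}(m,\lambda,P)=\begin{cases} m\cdot\lambda^{k-2} & \text{if }\lambda\le\sqrt{m},\\[1mm] m^{\frac{k_{\mathit{cycle}}}{2}+\beta}\cdot\lambda^{k_{\mathit{star}}-2\beta} & \text{if }\lambda>\sqrt{m},\end{cases}$$ where $k=|V_P|$ and $k_{\mathit{cycle}},k_{\mathit{star}},\beta$ come from a fractional edge-cover decomposition of $P$.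
   Context: **Occurrences.** A subgraph of $G=(V,E)$ is a simple undirected graph $G_{\mathit{sub}}=(V_{\mathit{sub}},E_{\mathit{sub}})$ with $V_{\mathit{sub}}\subseteq V$, $E_{\mathit{sub}}\subseteq E$. It is an occurrence of $P$ if there is a bijection $f:V_{\mathit{sub}}\to V_P$ such that for all distinct $u_1,u_2\in V_{\mathit{sub}}$, $\{u_1,u_2\}\in E_{\mathit{sub}}$ iff $\{f(u_1),f(u_2)\}\in E_P$. Occurrences are counted as subgraphs. **Subgraph sampling operation.** Such an operation returns an occurrence of $P$ in $G$ uniformly at random, or declares that there is no occurrence (when this is the case). The outcomes of all operations must be mutually independent. **Fractional edge-cover decomposition.** For an undirected graph $H$ without isolated vertices, $\rho^*(H)$ is the minimum of $\sum_F w(F)$ over functions $w$ from the edges of $H$ to $[0,1]$ such that for each vertex the total weight of incident edges is at least $1$. A star is an undirected graph with at least two vertices in which one vertex, the center, has an edge to every other vertex, and each non-center vertex has degree 1. A fractional edge-cover decomposition of $P$ is a tuple $(C_1,\dots,C_\alpha,S_1,\dots,S_\beta)$, $\alpha,\beta\ge0$, of pairwise vertex-disjoint subgraphs of $P$ together containing all vertices of $P$, such that each $C_i$ is an odd-length cycle, each $S_j$ is a star, and $\sum_i\rho^*(C_i)+\sum_j\rho^*(S_j)=\rho^*(P)$. It is known that such a decomposition always exists. $k_{\mathit{cycle}}$ and $k_{\mathit{star}}$ are the total numbers of vertices in the cycles and in the stars, respectively. **Conventions.** $|E|\ge1$, $\lambda$ is an integer in $[1,|E|]$, and $|V_P|\ge2$;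 the pattern $P$ is fixed, so constants hidden in $O(\cdot)$ may depend on $P$. The model is the standard RAM model with randomization, where vertices fit in a machine word, and arithmetic on numbers, random choices and (expected, randomized) hashing operations take constant time. *)

theory Defs
  imports "HOL-Probability.Probability"
begin


record 'a ugraph =
  verts :: "'a set"
  edges :: "'a set set"

definition simple_graph :: "'a ugraph \<Rightarrow> bool" where
  "simple_graph H \<longleftrightarrow> finite (verts H) \<and>
     (\<forall>e\<in>edges H. \<exists>u\<in>verts H. \<exists>v\<in>verts H. u \<noteq> v \<and> e = {u, v})"

definition vdegree :: "'a ugraph \<Rightarrow> 'a \<Rightarrow> nat" where
  "vdegree H v = card {e \<in> edges H. v \<in> e}"

definition connected_graph :: "'a ugraph \<Rightarrow> bool" where
  "connected_graph H \<longleftrightarrow>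
     (\<forall>u\<in>verts H. \<forall>v\<in>verts H. (u, v) \<in> {(x, y). {x, y} \<in> edges H}\<^sup>*)"

definition subgraph :: "'a ugraph \<Rightarrow> 'a ugraph \<Rightarrow> bool" where
  "subgraph H G \<longleftrightarrow> simple_graph H \<and> verts H \<subseteq> verts G \<and> edges H \<subseteq> edges G"

definition occurrences :: "'p ugraph \<Rightarrow> 'a ugraph \<Rightarrow> 'a ugraph set" where
  "occurrences P G = {H. subgraph H G \<and>
     (\<exists>f. bij_betw f (verts H) (verts P) \<and>
       (\<forall>u1\<in>verts H. \<forall>u2\<in>verts H. u1 \<noteq> u2 \<longrightarrow>
          ({u1, u2} \<in> edges H \<longleftrightarrow> {f u1, f u2} \<in> edges P)))}"

abbreviation OUT :: "'p ugraph \<Rightarrow> 'a ugraph \<Rightarrow> nat" where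
  "OUT P G \<equiv> card (occurrences P G)"



definition fractional_edge_cover :: "'a ugraph \<Rightarrow> ('a set \<Rightarrow> real) \<Rightarrow> bool" where
  "fractional_edge_cover H w \<longleftrightarrow> (\<forall>e\<in>edges H. 0 \<le> w e \<and> w e \<le> 1) \<and>
     (\<forall>v\<in>verts H. 1 \<le> (\<Sum>e\<in>{e \<in> edges H. v \<in> e}. w e))"

definition rho_star :: "'a ugraph \<Rightarrow> real" where
  "rho_star H = (LEAST r. \<exists>w. fractional_edge_cover H w \<and> r = (\<Sum>e\<in>edges H. w e))"

definition odd_cycle_graph :: "'a ugraph \<Rightarrow> bool" where
  "odd_cycle_graph H \<longleftrightarrow>
     (\<exists>vs. distinct vs \<and> 3 \<le> length vs \<and> odd (length vs) \<and> verts H = set vs \<and>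
        edges H = {{vs ! i, vs ! (Suc i mod length vs)} | i. i < length vs})"

definition star_graph :: "'a ugraph \<Rightarrow> bool" where
  "star_graph H \<longleftrightarrow> simple_graph H \<and> 2 \<le> card (verts H) \<and>
     (\<exists>c\<in>verts H. \<forall>v\<in>verts H - {c}. {c, v} \<in> edges H \<and> vdegree H v = 1)"

definition fec_decomposition :: "'p ugraph \<Rightarrow> 'p ugraph list \<Rightarrow> 'p ugraph list \<Rightarrow> bool" where
  "fec_decomposition P Cs Ss \<longleftrightarrow>
     (\<forall>H\<in>set (Cs @ Ss). subgraph H P) \<and>
     (\<forall>i j. i < j \<longrightarrow> j < length (Cs @ Ss) \<longrightarrow>
        verts ((Cs @ Ss) ! i) \<inter> verts ((Cs @ Ss) ! j) = {}) \<and>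
     (\<Union>H\<in>set (Cs @ Ss). verts H) = verts P \<and>
     (\<forall>C\<in>set Cs. odd_cycle_graph C) \<and>
     (\<forall>S\<in>set Ss. star_graph S) \<and>
     (\<Sum>C\<leftarrow>Cs. rho_star C) + (\<Sum>S\<leftarrow>Ss. rho_star S) = rho_star P"

definition total_verts :: "'p ugraph list \<Rightarrow> nat" where
  "total_verts Hs = (\<Sum>H\<leftarrow>Hs. card (verts H))"

definition polymat_undir ::
  "nat \<Rightarrow> nat \<Rightarrow> 'p ugraph \<Rightarrow> 'p ugraph list \<Rightarrow> 'p ugraph list \<Rightarrow> real" where
  "polymat_undir m l P Cs Ss =
     (let k = card (verts P); k_cycle = real (total_verts Cs);
          k_star = real (total_verts Ss); \<beta> = real (length Ss)
      in if real l \<le> sqrt (real m) then real m * real l ^ (k - 2)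
         else real m powr (k_cycle / 2 + \<beta>) * real l powr (k_star - 2 * \<beta>))"



text \<open>
  Programs are finite syntactic objects over words of \<open>w\<close> bits: arithmetic is modulo
  \<open>2 ^ w\<close> (subtraction is truncated at 0).  A state has registers, a word-addressed memory,
  hash tables (selected by a number occurring in the program) that map pairs of words to words
  and in which an absent key reads as 0, and the words emitted so far.  Each executed instruction
  and each test costs one unit.  Expressions only involve registers and have a size fixed by the
  program, so that charging for each arithmetic operation separately would change the
  cost by at most a constant factor depending only on the program.
\<close>

datatype aexp = Const nat | Reg nat
  | Add aexp aexp | Sub aexp aexp | Mul aexp aexp | Div aexp aexp | Mod aexp aexp

datatype bexp = Less aexp aexp | Equal aexp aexp | Not bexp | And bexp bexp

datatype com =
    Skip
  | Assign nat aexp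
  | Load nat aexp                 \<comment> \<open>register \<open>:=\<close> memory cell\<close>
  | Store aexp aexp               \<comment> \<open>address, value\<close>
  | Lookup nat nat aexp aexp      \<comment> \<open>register, table, the two components of the key\<close>
  | Update nat aexp aexp aexp     \<comment> \<open>table, the two components of the key, value\<close>
  | Rand nat aexp                 \<comment> \<open>register, size of the range\<close>
  | Emit aexp
  | Seq com com
  | If bexp com com
  | While bexp com

record state =
  reg :: "nat \<Rightarrow> nat"
  mem :: "nat \<Rightarrow> nat"
  tab :: "nat \<Rightarrow> nat \<times> nat \<Rightarrow> nat"
  out :: "nat list"

primrec aval :: "nat \<Rightarrow> aexp \<Rightarrow> state \<Rightarrow> nat" where
  "aval w (Const n) s = n mod 2 ^ w"
| "aval w (Reg r) s = reg s r"
| "aval w (Add a b) s = (aval w a s + aval w b s) mod 2 ^ w"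
| "aval w (Sub a b) s = aval w a s - aval w b s"
| "aval w (Mul a b) s = (aval w a s * aval w b s) mod 2 ^ w"
| "aval w (Div a b) s = aval w a s div aval w b s"
| "aval w (Mod a b) s = aval w a s mod aval w b s"

primrec bval :: "nat \<Rightarrow> bexp \<Rightarrow> state \<Rightarrow> bool" where
  "bval w (Less a b) s = (aval w a s < aval w b s)"
| "bval w (Equal a b) s = (aval w a s = aval w b s)"
| "bval w (Not b) s = (\<not> bval w b s)"
| "bval w (And b c) s = (bval w b s \<and> bval w c s)"

text \<open>
  The result of an execution is a subprobability distribution over the final state and the
  running time; the missing mass is the probability of non-termination.
\<close>

partial_function (spmf) while_spmf ::
  "('s \<Rightarrow> bool) \<Rightarrow> ('s \<Rightarrow> ('s \<times> nat) spmf) \<Rightarrow> 's \<Rightarrow> ('s \<times> nat) spmf" where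
  "while_spmf b f s =
     (if b s then
        bind_spmf (f s) (\<lambda>(s1, t1).
        bind_spmf (while_spmf b f s1) (\<lambda>(s2, t2).
        return_spmf (s2, 1 + t1 + t2)))
      else return_spmf (s, 1))"

primrec exec :: "nat \<Rightarrow> com \<Rightarrow> state \<Rightarrow> (state \<times> nat) spmf" where
  "exec w Skip s = return_spmf (s, 1)"
| "exec w (Assign r a) s = return_spmf (s\<lparr>reg := (reg s)(r := aval w a s)\<rparr>, 1)"
| "exec w (Load r a) s = return_spmf (s\<lparr>reg := (reg s)(r := mem s (aval w a s))\<rparr>, 1)"
| "exec w (Store a b) s = return_spmf (s\<lparr>mem := (mem s)(aval w a s := aval w b s)\<rparr>, 1)"
| "exec w (Lookup r h a b) s =
     return_spmf (s\<lparr>reg := (reg s)(r := tab s h (aval w a s, aval w b s))\<rparr>, 1)"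
| "exec w (Update h a b c) s =
     return_spmf (s\<lparr>tab := (tab s)(h := (tab s h)((aval w a s, aval w b s) := aval w c s))\<rparr>, 1)"
| "exec w (Rand r a) s =
     (if aval w a s = 0 then return_spmf (s\<lparr>reg := (reg s)(r := 0)\<rparr>, 1)
      else map_spmf (\<lambda>x. (s\<lparr>reg := (reg s)(r := x)\<rparr>, 1)) (spmf_of_set {..<aval w a s}))"
| "exec w (Emit a) s = return_spmf (s\<lparr>out := out s @ [aval w a s]\<rparr>, 1)"
| "exec w (Seq c1 c2) s =
     bind_spmf (exec w c1 s) (\<lambda>(s1, t1).
     bind_spmf (exec w c2 s1) (\<lambda>(s2, t2).
     return_spmf (s2, t1 + t2)))"
| "exec w (If b c1 c2) s =
     bind_spmf (if bval w b s then exec w c1 s else exec w c2 s) (\<lambda>(s1, t1).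
     return_spmf (s1, 1 + t1))"
| "exec w (While b c) s = while_spmf (bval w b) (exec w c) s"



text \<open>
  The input is the edge list of the data graph, in an arbitrary order and with arbitrary
  orientations, stored in the first \<open>2 * |E|\<close> memory cells; register 0 holds \<open>|E|\<close> and
  register 1 holds the degree bound.  Isolated vertices do not appear in the input.
\<close>

definition edge_list :: "nat ugraph \<Rightarrow> (nat \<times> nat) list \<Rightarrow> bool" where
  "edge_list G es \<longleftrightarrow> distinct (map (\<lambda>(u, v). {u, v}) es) \<and>
     set (map (\<lambda>(u, v). {u, v}) es) = edges G"

definition input_state :: "(nat \<times> nat) list \<Rightarrow> nat \<Rightarrow> state" where
  "input_state es l = \<lparr>
     reg = (\<lambda>_. 0)(0 := length es, 1 := l),
     mem = (\<lambda>a. if a < 2 * length es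
                then (if even a then fst (es ! (a div 2)) else snd (es ! (a div 2))) else 0),
     tab = (\<lambda>_ _. 0),
     out = []\<rparr>"

text \<open>
  Vertices fit in a word, the cells of the input are addressable, and words have at least
  \<open>d * log 2 (|E| + 1)\<close> bits, so that numbers polynomial in \<open>|E|\<close> can be handled in
  constant time.
\<close>

definition word_fits :: "nat \<Rightarrow> nat \<Rightarrow> nat ugraph \<Rightarrow> bool" where
  "word_fits d w G \<longleftrightarrow> verts G \<subseteq> {..<2 ^ w} \<and> 2 * card (edges G) \<le> 2 ^ w \<and>
     (card (edges G) + 1) ^ d \<le> 2 ^ w"

text \<open>
  A sampling operation answers by emitting nothing (there is no occurrence) or by emitting the
  number \<open>n\<close> of vertices of a subgraph, these \<open>n\<close> vertices, and the endpoints of its edges.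
\<close>

type_synonym outcome = "nat ugraph option"

fun pairs_to_edges :: "nat list \<Rightarrow> nat set set" where
  "pairs_to_edges (u # v # xs) = insert {u, v} (pairs_to_edges xs)"
| "pairs_to_edges _ = {}"

fun decode :: "nat list \<Rightarrow> outcome" where
  "decode [] = None"
| "decode (n # xs) = Some \<lparr>verts = set (take n xs), edges = pairs_to_edges (drop n xs)\<rparr>"

text \<open>
  The operations are performed one after the other on the same, possibly changing, state; each
  yields an outcome and its running time.
\<close>

primrec operations :: "nat \<Rightarrow> com \<Rightarrow> nat \<Rightarrow> state \<Rightarrow> (outcome \<times> nat) list spmf" where
  "operations w query 0 s = return_spmf []"
| "operations w query (Suc q) s =
     bind_spmf (exec w query (s\<lparr>out := []\<rparr>)) (\<lambda>(s1, t).
     bind_spmf (operations w query q s1) (\<lambda>rs.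
     return_spmf ((decode (out s1), t) # rs)))"

definition session ::
  "nat \<Rightarrow> com \<Rightarrow> com \<Rightarrow> nat \<Rightarrow> state \<Rightarrow> (nat \<times> (outcome \<times> nat) list) spmf" where
  "session w build query q s =
     bind_spmf (exec w build s) (\<lambda>(s1, t).
     bind_spmf (operations w query q s1) (\<lambda>rs.
     return_spmf (t, rs)))"

definition sampling_outcome :: "'p ugraph \<Rightarrow> nat ugraph \<Rightarrow> outcome pmf" where
  "sampling_outcome P G =
     (if occurrences P G = {} then return_pmf None
      else map_pmf Some (pmf_of_set (occurrences P G)))"

text \<open>
  Whatever the number \<open>q\<close> of operations, the session terminates almost surely (it is given by a
  \<open>pmf\<close>), satisfies the two expected time bounds, each outcome has the required
  distribution, and the \<open>q\<close> outcomes are mutually independent.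
\<close>

definition sampling_structure ::
  "'p ugraph \<Rightarrow> nat ugraph \<Rightarrow> nat \<Rightarrow> com \<Rightarrow> com \<Rightarrow> state \<Rightarrow> real \<Rightarrow> real \<Rightarrow> bool" where
  "sampling_structure P G w build query s build_bound query_bound \<longleftrightarrow>
     (\<forall>q. \<exists>M. session w build query q s = spmf_of_pmf M \<and>
        (\<integral>\<^sup>+ \<omega>. of_nat (fst \<omega>) \<partial>measure_pmf M) \<le> ennreal build_bound \<and>
        (\<forall>i<q. (\<integral>\<^sup>+ \<omega>. of_nat (snd (snd \<omega> ! i)) \<partial>measure_pmf M) \<le> ennreal query_bound) \<and>
        (\<forall>i<q. map_pmf (\<lambda>\<omega>. fst (snd \<omega> ! i)) M = sampling_outcome P G) \<and>
        prob_space.indep_vars (measure_pmf M) (\<lambda>_. count_space UNIV)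
          (\<lambda>i \<omega>. fst (snd \<omega> ! i)) {..<q})"

end

theory Submission
  imports Defs
begin

text \<open>Occurrences are sampled by rejection.  A candidate is a number below \<open>N = O(polymat)\<close> that is
  decoded in constant time to an assignment of data vertices to the pattern vertices, in such a way
  that every embedding of the pattern is decoded from exactly one candidate.  As every occurrence is
  the image of the same number of embeddings, the first uniformly random candidate that decodes to an
  embedding yields a uniform occurrence, after \<open>O(N / OUT)\<close> trials on average; a scan of all candidates
  runs alongside and stops the search after \<open>N\<close> rounds if there is no occurrence.

  If the degree bound \<open>\<lambda>\<close> is at most \<open>\<surd>m\<close>, a candidate consists of an arc for the first edge of a
  spanning tree and an index below \<open>\<lambda>\<close> into an adjacency list for every other vertex.  Otherwise the
  components of the decomposition are decoded independently.  A star uses an arc and adjacency list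
  indices.  A cycle of length \<open>2 r + 1\<close> uses \<open>r\<close> arcs that cover all but one vertex; that vertex is a
  neighbour of a fixed cycle vertex \<open>z\<close> if the degree of \<open>z\<close> is at most \<open>\<surd>m\<close>, and otherwise it is
  \<open>z\<close> itself, chosen among the \<open>O(\<surd>m)\<close> vertices of larger degree.\<close>

section \<open>Rejection sampling and independent operations\<close>

text \<open>The bound is the size of the candidate space. A cycle of length 2 r + 1 has about m^r *
  sqrt m = m^((2 r + 1) / 2) candidates and a star with n vertices about m * \<lambda>^(n - 2);
  multiplied over the decomposition this is the second case of the bound, and m * \<lambda>^(k - 2)
  is the first. Heavy vertices number O(sqrt m) because the degrees sum to 2 m. Lists have different
  lengths, so an index is drawn below a bound common to all lists and rejected if it is too large.
  This keeps the number of candidates independent of earlier choices. Distinctness of the vertices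
  and the edges of the pattern are tested afterwards. Two obstacles shape the rest. Arithmetic wraps
  modulo 2^w, so the number of candidates, polynomial in m, has to fit in a word. And every
  operation leaves a random state behind; the outcomes are nevertheless independent because the law
  of the answer is the same from every state whose memory, tables and first four registers are
  intact.\<close>

lemma prob_bind_pmf_of_set:
  assumes "finite B" "B \<noteq> {}"
  shows "measure_pmf.prob (bind_pmf (pmf_of_set B) f) Y = (\<Sum>x\<in>B. measure_pmf.prob (f x) Y) / card B"
proof -
  have "ennreal (measure_pmf.prob (bind_pmf (pmf_of_set B) f) Y) = (\<Sum>x\<in>B. ennreal (measure_pmf.prob (f x) Y)) / card B"
    using assms by (simp add: measure_pmf.emeasure_eq_measure[symmetric] nn_integral_pmf_of_set)
  also have "\<dots> = ennreal ((\<Sum>x\<in>B. measure_pmf.prob (f x) Y) / card B)"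
    using assms by (simp add: ennreal_of_nat_eq_real_of_nat divide_ennreal[symmetric] card_gt_0_iff sum_nonneg)
  finally show ?thesis
    by (subst (asm) ennreal_inj) (auto intro!: divide_nonneg_nonneg sum_nonneg)
qed

text \<open>Truncating the running time at \<open>n\<close> makes its expectation finite and lets one bound it by
  induction on \<open>n\<close>, since every round costs at least one unit; monotone convergence removes
  the truncation.\<close>

definition fuel_cost :: "nat \<Rightarrow> ('s \<times> nat) option \<Rightarrow> ennreal" where
  "fuel_cost n r = (case r of None \<Rightarrow> 0 | Some (s, t) \<Rightarrow> of_nat (min t n))"

text \<open>Both analyses of the sampling loop, with and without accepted candidates, unfold a round
  in this form. The summand 1 pays for the guard.\<close>

lemma while_spmf_random:
  assumes "b s" "f s = map_spmf (\<lambda>x. (S x, T x)) (spmf_of_set {..<N})" "N > (0 :: nat)"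
  shows "while_spmf b f s = bind_pmf (pmf_of_set {..<N})
    (\<lambda>x. map_spmf (\<lambda>(s', t). (s', 1 + T x + t)) (while_spmf b f (S x)))"
proof -
  have "spmf_of_set {..<N} = spmf_of_pmf (pmf_of_set {..<N})"
    using assms(3) by (subst spmf_of_pmf_pmf_of_set) (auto simp: lessThan_empty_iff)
  then show ?thesis
    apply (subst while_spmf.simps)
    apply (simp only: assms(1,2) if_True bind_map_spmf)
    apply (simp add: bind_spmf_of_pmf map_spmf_conv_bind_spmf o_def case_prod_unfold add.assoc del: spmf_of_pmf_pmf_of_set)
    done
qed

text \<open>A rejected round may change the state, as the deterministic scan does, and the time
  \<open>T\<close> may depend on the state. Only the accepted set \<open>A\<close> and the answers
  \<open>g\<close> are the same in every round, and this suffices for the first accepted draw to be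
  uniform on \<open>A\<close>.\<close>

locale rejection_loop =
  fixes b :: "'s \<Rightarrow> bool" and f :: "'s \<Rightarrow> ('s \<times> nat) spmf"
    and next_state :: "'s \<Rightarrow> nat \<Rightarrow> 's" and Inv Post :: "'s \<Rightarrow> bool"
    and answer :: "'s \<Rightarrow> 'r" and N c :: nat and A :: "nat set" and g :: "nat \<Rightarrow> 'r"
  assumes A: "A \<subseteq> {..<N}" "A \<noteq> {}"
    and guard: "Inv s \<Longrightarrow> b s"
    and body: "Inv s \<Longrightarrow> \<exists>T. (\<forall>x. T x \<le> c) \<and>
      f s = map_spmf (\<lambda>x. (next_state s x, T x)) (spmf_of_set {..<N})"
    and accept: "\<lbrakk>Inv s; x \<in> A\<rbrakk> \<Longrightarrow> \<not> b (next_state s x) \<and> Post (next_state s x) \<and> answer (next_state s x) = g x"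
    and reject: "\<lbrakk>Inv s; x < N; x \<notin> A\<rbrakk> \<Longrightarrow> Inv (next_state s x)"
begin

abbreviation run where "run \<equiv> while_spmf b f"

lemma N_pos: "N > 0" using A by (cases N) auto

lemma finite_A: "finite A" using A finite_subset by blast

lemma card_A: "card A > 0" "card A \<le> N"
  using A finite_A card_mono[of "{..<N}" A] by (auto simp: card_gt_0_iff)

lemma card_reject: "card ({..<N} - A) = N - card A"
  using A finite_A by (simp add: card_Diff_subset)

lemma sum_split: 
  fixes h :: "nat \<Rightarrow> 'b :: comm_monoid_add"
  shows "(\<Sum>x<N. h x) = (\<Sum>x\<in>A. h x) + (\<Sum>x\<in>{..<N} - A. h x)"
  using sum.subset_diff[OF A(1), of h] by (simp add: add.commute)

lemma unfold:
  assumes "Inv s"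
  shows "\<exists>T. (\<forall>x. T x \<le> c) \<and> run s = bind_pmf (pmf_of_set {..<N})
    (\<lambda>x. map_spmf (\<lambda>(s', t). (s', 1 + T x + t)) (run (next_state s x)))"
proof -
  obtain T where T: "\<forall>x. T x \<le> c" "f s = map_spmf (\<lambda>x. (next_state s x, T x)) (spmf_of_set {..<N})"
    using body[OF assms] by blast
  show ?thesis using T(1) while_spmf_random[where b = b and f = f, OF guard[OF assms] T(2) N_pos] by blast
qed

lemma run_accept: "Inv s \<Longrightarrow> x \<in> A \<Longrightarrow> run (next_state s x) = return_spmf (next_state s x, 1)"
  using accept by (subst while_spmf.simps) auto

abbreviation "goal Z \<equiv> {Some (s, t) | s t. Post s \<and> answer s \<in> Z}"

text \<open>Some draw among the first n is accepted with probability 1 - (1 - card A / N)^n, and an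
  accepted draw is uniform on \<open>A\<close>. A lower bound can be proved by plain induction on n;
  the matching upper bound is later read off from the complement of \<open>Z\<close>.\<close>

lemma prob_lower_iterate:
  assumes "Inv s"
  shows "measure_pmf.prob (run s) (goal Z) \<ge>
    (1 - (1 - card A / N) ^ n) * (card {x \<in> A. g x \<in> Z} / card A)"
  using assms
proof (induction n arbitrary: s)
  case (Suc n)
  define a where "a = real (card {x \<in> A. g x \<in> Z})"
  define p where "p = real (card A) / N"
  define q where "q = (1 - (1 - p) ^ n) * (a / card A)"
  obtain T where T: "run s = bind_pmf (pmf_of_set {..<N})
    (\<lambda>x. map_spmf (\<lambda>(s', t). (s', 1 + T x + t)) (run (next_state s x)))"
    using unfold[OF Suc.prems] by blast
  have pr: "measure_pmf.prob (map_spmf (\<lambda>(s', t). (s', 1 + T x + t)) M) (goal Z) = measure_pmf.prob M (goal Z)" for x M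
  proof -
    have "map_option (\<lambda>(s', t). (s', 1 + T x + t)) -` goal Z = goal Z"
      by (auto simp: map_option_case split: option.splits)
    then show ?thesis by simp
  qed
  have acc: "measure_pmf.prob (run (next_state s x)) (goal Z) = of_bool (g x \<in> Z)" if "x \<in> A" for x
    using accept[OF Suc.prems that] by (simp add: run_accept[OF Suc.prems that] indicator_def)
  have rej: "measure_pmf.prob (run (next_state s x)) (goal Z) \<ge> q" if "x \<in> {..<N} - A" for x
    using Suc.IH[OF reject[OF Suc.prems]] that by (simp add: q_def p_def a_def)
  have "a + (N - card A) * q \<le> (\<Sum>x\<in>A. measure_pmf.prob (run (next_state s x)) (goal Z)) +
      (\<Sum>x\<in>{..<N} - A. measure_pmf.prob (run (next_state s x)) (goal Z))"
  proof (intro add_mono)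
    show "a \<le> (\<Sum>x\<in>A. measure_pmf.prob (run (next_state s x)) (goal Z))"
    proof -
      have "(\<Sum>x\<in>A. measure_pmf.prob (run (next_state s x)) (goal Z)) = (\<Sum>x\<in>A. of_bool (g x \<in> Z))"
        by (intro sum.cong refl acc)
      then show ?thesis using finite_A by (simp add: a_def of_bool_def sum.If_cases Int_def)
    qed
    show "(N - card A) * q \<le> (\<Sum>x\<in>{..<N} - A. measure_pmf.prob (run (next_state s x)) (goal Z))"
      using sum_bounded_below[of "{..<N} - A" q, OF rej] card_A by (simp add: card_reject of_nat_diff)
  qed
  also have "\<dots> = N * measure_pmf.prob (run s) (goal Z)"
    unfolding T using N_pos by (subst prob_bind_pmf_of_set) (auto simp: pr sum_split lessThan_empty_iff)
  finally have "measure_pmf.prob (run s) (goal Z) \<ge> (a + (N - card A) * q) / N"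
    using N_pos by (simp add: field_simps)
  also have "(a + (N - card A) * q) / N = p * (a / card A) + (1 - p) * q"
    using N_pos card_A by (simp add: p_def field_simps of_nat_diff)
  also have "\<dots> = (1 - (1 - p) ^ Suc n) * (a / card A)"
  proof -
    define r where "r = a / card A"
    show ?thesis unfolding q_def r_def[symmetric] by (simp add: algebra_simps)
  qed
  finally show ?case by (simp add: p_def a_def)
qed simp

lemma prob_lower:
  assumes "Inv s"
  shows "measure_pmf.prob (run s) (goal Z) \<ge> card {x \<in> A. g x \<in> Z} / card A"
proof -
  have "(\<lambda>n. (1 - (1 - card A / N) ^ n) * (card {x \<in> A. g x \<in> Z} / card A)) \<longlonglongrightarrow>
      (1 - 0) * (card {x \<in> A. g x \<in> Z} / card A)"
    using card_A N_pos by (intro tendsto_intros LIMSEQ_power_zero) (auto simp: field_simps)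
  then show ?thesis
    using prob_lower_iterate[OF assms] by (auto intro: LIMSEQ_le_const2)
qed

lemma fuel_cost_le:
  assumes "Inv s"
  shows "(\<integral>\<^sup>+r. fuel_cost n r \<partial>measure_pmf (run s)) \<le> ennreal ((c + 2) * N / card A)"
  using assms
proof (induction n arbitrary: s)
  case 0
  have "fuel_cost 0 = (\<lambda>_ :: ('s \<times> nat) option. 0)" by (auto simp: fuel_cost_def split: option.splits)
  then show ?case by simp
next
  case (Suc n)
  \<comment> \<open>\<open>C\<close> solves C = c + 2 + (1 - card A / N) * C. The charge c + 2
    covers the guard, the body and, after acceptance, the final failing guard.\<close>
  define C where "C = real ((c + 2) * N) / card A"
  have C: "C \<ge> 0" by (simp add: C_def)
  obtain T where T: "\<forall>x. T x \<le> c" "run s = bind_pmf (pmf_of_set {..<N})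
    (\<lambda>x. map_spmf (\<lambda>(s', t). (s', 1 + T x + t)) (run (next_state s x)))"
    using unfold[OF Suc.prems] by blast
  define E where "E x = (\<integral>\<^sup>+r. fuel_cost (Suc n) r
      \<partial>measure_pmf (map_spmf (\<lambda>(s', t). (s', 1 + T x + t)) (run (next_state s x))))" for x
  have "E x \<le> ennreal (c + 2)" if "x \<in> A" for x
  proof -
    have "E x \<le> ennreal (real (c + 2))"
      unfolding ennreal_of_nat_eq_real_of_nat[symmetric]
      using T(1)[rule_format, of x]
      by (simp add: E_def run_accept[OF Suc.prems that] fuel_cost_def del: of_nat_add of_nat_Suc of_nat_min)
    then show ?thesis by simp
  qed
  then have acc: "(\<Sum>x\<in>A. E x) \<le> of_nat (card A) * ennreal (c + 2)"
    by (rule sum_bounded_above)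
  have "E x \<le> ennreal (c + 2 + C)" if "x \<in> {..<N} - A" for x
  proof -
    have le: "fuel_cost (Suc n) (map_option (\<lambda>(s', t). (s', 1 + T x + t)) r) \<le> of_nat (c + 2) + fuel_cost n r" for r :: "('s \<times> nat) option"
    proof (cases r)
      case (Some y)
      obtain s' t where y: "y = (s', t)" by force
      have "min (1 + T x + t) (Suc n) \<le> (c + 2) + min t n"
        using T(1)[rule_format, of x] by (auto simp: min_def)
      then show ?thesis unfolding Some y fuel_cost_def
        by (simp del: of_nat_add of_nat_Suc of_nat_min add: of_nat_add[symmetric])
    qed (simp add: fuel_cost_def)
    have "E x \<le> (\<integral>\<^sup>+r. of_nat (c + 2) + fuel_cost n r \<partial>measure_pmf (run (next_state s x)))"
      unfolding E_def nn_integral_map_pmf by (intro nn_integral_mono le)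
    also have "\<dots> = of_nat (c + 2) + (\<integral>\<^sup>+r. fuel_cost n r \<partial>measure_pmf (run (next_state s x)))"
      by (subst nn_integral_add) auto
    also have "\<dots> \<le> of_nat (c + 2) + ennreal C"
      unfolding C_def using that by (intro add_left_mono Suc.IH reject[OF Suc.prems]) auto
    also have "\<dots> = ennreal (c + 2 + C)"
      using C by (subst ennreal_plus) (auto simp: ennreal_of_nat_eq_real_of_nat)
    finally show ?thesis .
  qed
  then have rej: "(\<Sum>x\<in>{..<N} - A. E x) \<le> of_nat (card ({..<N} - A)) * ennreal (c + 2 + C)"
    by (rule sum_bounded_above)
  have "(\<integral>\<^sup>+r. fuel_cost (Suc n) r \<partial>measure_pmf (run s)) = (\<Sum>x<N. E x) / N"
    unfolding T(2) nn_integral_bind_pmf E_def using N_pos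
    by (subst nn_integral_pmf_of_set) (auto simp: lessThan_empty_iff)
  also have "\<dots> \<le> (of_nat (card A) * ennreal (c + 2) + of_nat (N - card A) * ennreal (c + 2 + C)) / N"
    using acc rej by (intro divide_right_mono_ennreal) (simp add: sum_split card_reject add_mono)
  also have "\<dots> = ennreal ((card A * (c + 2) + (N - card A) * (c + 2 + C)) / N)"
    using C N_pos by (simp add: ennreal_of_nat_eq_real_of_nat ennreal_mult[symmetric] ennreal_plus[symmetric]
      divide_ennreal distrib_left del: ennreal_plus)
  also have "(card A * (c + 2) + (N - card A) * (c + 2 + C)) / N = C"
    using card_A N_pos by (simp add: C_def field_simps of_nat_diff)
  finally show ?case by (simp add: C_def)
qed

lemma rejection_loop:
  assumes "Inv s"
  shows "\<exists>M. run s = spmf_of_pmf M \<and> (\<forall>r\<in>set_pmf M. Post (fst r)) \<and>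
    map_pmf (\<lambda>r. answer (fst r)) M = map_pmf g (pmf_of_set A) \<and>
    (\<integral>\<^sup>+r. of_nat (snd r) \<partial>measure_pmf M) \<le> ennreal ((c + 2) * N / card A)"
proof -
  \<comment> \<open>For \<open>Z\<close> = \<open>UNIV\<close> the lower bound is 1, so no mass is
    lost to non-termination.\<close>
  have "1 \<le> measure_pmf.prob (run s) (goal UNIV)"
    using prob_lower[OF assms, of UNIV] card_A by simp
  then have "measure_pmf.prob (run s) (goal UNIV) = 1"
    by (intro antisym) auto
  then have "AE r in measure_pmf (run s). r \<in> goal UNIV"
    by (subst measure_pmf.prob_eq_1[symmetric]) auto
  then have sub: "set_pmf (run s) \<subseteq> goal UNIV" by (auto simp: AE_measure_pmf_iff)
  then have "None \<notin> set_pmf (run s)" by auto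
  then have "lossless_spmf (run s)" by (simp add: lossless_iff_set_pmf_None)
  then obtain M where M: "run s = spmf_of_pmf M" by (auto simp: lossless_spmf_conv_spmf_of_pmf)
  have Post: "\<forall>r\<in>set_pmf M. Post (fst r)"
    using sub unfolding M by (auto simp: spmf_of_pmf_def set_map_pmf)
  have vim: "measure_pmf.prob (run s) (goal Z) = measure_pmf.prob (map_pmf (\<lambda>r. answer (fst r)) M) Z" for Z
  proof -
    have "measure_pmf.prob (run s) (goal Z) = measure_pmf.prob M (Some -` goal Z)"
      unfolding M spmf_of_pmf_def by simp
    also have "\<dots> = measure_pmf.prob M ((\<lambda>r. answer (fst r)) -` Z)"
      using Post by (intro measure_pmf.finite_measure_eq_AE) (auto simp: AE_measure_pmf_iff)
    finally show ?thesis by simp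
  qed
  have lower: "measure_pmf.prob (map_pmf (\<lambda>r. answer (fst r)) M) Z \<ge> card {x \<in> A. g x \<in> Z} / card A" for Z
    using prob_lower[OF assms, of Z] by (simp only: vim)
  have g: "measure_pmf.prob (map_pmf g (pmf_of_set A)) Z = card {x \<in> A. g x \<in> Z} / card A" for Z
    using A finite_A by (simp add: measure_pmf_of_set vimage_def Int_def)
  \<comment> \<open>The lower bounds for \<open>Z\<close> and for its complement add up to 1, so
    both are equalities.\<close>
  have "measure_pmf.prob (map_pmf (\<lambda>r. answer (fst r)) M) Z = card {x \<in> A. g x \<in> Z} / card A" for Z
  proof (rule antisym[OF _ lower])
    have "measure_pmf.prob (map_pmf (\<lambda>r. answer (fst r)) M) Z = 1 - measure_pmf.prob (map_pmf (\<lambda>r. answer (fst r)) M) (- Z)"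
      by (subst measure_pmf.prob_compl[symmetric]) (auto simp: Compl_eq_Diff_UNIV double_diff)
    also have "\<dots> \<le> 1 - measure_pmf.prob (map_pmf g (pmf_of_set A)) (- Z)"
      unfolding g using lower[of "- Z"] by simp
    also have "\<dots> = measure_pmf.prob (map_pmf g (pmf_of_set A)) Z"
      by (subst measure_pmf.prob_compl[symmetric]) (auto simp: Compl_eq_Diff_UNIV double_diff)
    finally show "measure_pmf.prob (map_pmf (\<lambda>r. answer (fst r)) M) Z \<le> card {x \<in> A. g x \<in> Z} / card A"
      unfolding g .
  qed
  then have dist: "map_pmf (\<lambda>r. answer (fst r)) M = map_pmf g (pmf_of_set A)"
    by (intro pmf_eqI) (simp only: pmf.rep_eq g)
  have "(\<integral>\<^sup>+r. of_nat (snd r) \<partial>measure_pmf M) = (\<integral>\<^sup>+r. (SUP n. fuel_cost n (Some r)) \<partial>measure_pmf M)"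
  proof (intro nn_integral_cong)
    fix r :: "'s \<times> nat"
    have "of_nat (snd r) \<le> (SUP n. fuel_cost n (Some r))"
      by (rule SUP_upper2[of "snd r"]) (auto simp: fuel_cost_def split_beta)
    moreover have "(SUP n. fuel_cost n (Some r)) \<le> of_nat (snd r)"
      by (rule SUP_least) (auto simp: fuel_cost_def split_beta simp del: of_nat_min)
    ultimately show "of_nat (snd r) = (SUP n. fuel_cost n (Some r))" by (rule antisym)
  qed
  also have "\<dots> = (SUP n. \<integral>\<^sup>+r. fuel_cost n (Some r) \<partial>measure_pmf M)"
    by (intro nn_integral_monotone_convergence_SUP)
      (auto simp: fuel_cost_def incseq_def le_fun_def min_def simp del: of_nat_min)
  also have "\<dots> = (SUP n. \<integral>\<^sup>+r. fuel_cost n r \<partial>measure_pmf (run s))"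
    unfolding M spmf_of_pmf_def by simp
  also have "\<dots> \<le> ennreal ((c + 2) * N / card A)"
    by (intro SUP_least fuel_cost_le assms)
  finally show ?thesis using M Post dist by blast
qed

end

section \<open>Independence of successive outcomes\<close>

lemma prob_replicate_pmf:
  "measure_pmf.prob (replicate_pmf n p) {xs. \<forall>i<n. xs ! i \<in> A i} = (\<Prod>i<n. measure_pmf.prob p (A i))"
proof (induction n arbitrary: A)
  case (Suc n)
  let ?q = "measure_pmf.prob (replicate_pmf n p) {xs. \<forall>i<n. xs ! i \<in> A (Suc i)}"
  have "ennreal (measure_pmf.prob (replicate_pmf (Suc n) p) {xs. \<forall>i<Suc n. xs ! i \<in> A i}) =
      (\<integral>\<^sup>+x. emeasure (map_pmf ((#) x) (replicate_pmf n p)) {xs. \<forall>i<Suc n. xs ! i \<in> A i} \<partial>measure_pmf p)"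
    by (simp add: measure_pmf.emeasure_eq_measure[symmetric] map_pmf_def del: emeasure_map_pmf)
  also have "\<dots> = (\<integral>\<^sup>+x. ennreal ?q * indicator (A 0) x \<partial>measure_pmf p)"
    by (intro nn_integral_cong)
      (auto simp: All_less_Suc2 vimage_def indicator_def measure_pmf.emeasure_eq_measure)
  also have "\<dots> = ennreal (?q * measure_pmf.prob p (A 0))"
    by (simp add: nn_integral_cmult measure_pmf.emeasure_eq_measure ennreal_mult)
  finally have "measure_pmf.prob (replicate_pmf (Suc n) p) {xs. \<forall>i<Suc n. xs ! i \<in> A i} = ?q * measure_pmf.prob p (A 0)"
    by (subst (asm) ennreal_inj) auto
  then show ?case using Suc.IH by (simp add: prod.lessThan_Suc_shift mult.commute del: prod.lessThan_Suc)
qed simp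

lemma map_nth_replicate_pmf: "i < n \<Longrightarrow> map_pmf (\<lambda>xs. xs ! i) (replicate_pmf n p) = p"
proof (induction n arbitrary: i)
  case (Suc n)
  show ?case
  proof (cases i)
    case 0
    then show ?thesis by (simp add: map_bind_pmf bind_return_pmf')
  next
    case (Suc j)
    then have "map_pmf (\<lambda>xs. xs ! j) (replicate_pmf n p) = p" using Suc.IH Suc.prems by simp
    then show ?thesis using Suc by (simp add: map_bind_pmf map_pmf_def[symmetric] pmf.map_comp o_def)
  qed
qed simp

text \<open>\<open>Y\<close> has to agree with the coordinates of \<open>X\<close> only on the
  support of \<open>M\<close>: in the application \<open>nth\<close> commutes with
  \<open>map\<close> only within the length of a list.\<close>

lemma indep_vars_nth:
  fixes M :: "'b pmf" and p :: "'r pmf"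
  assumes X: "map_pmf X M = replicate_pmf n p"
    and Y: "\<And>\<omega> i. \<lbrakk>\<omega> \<in> set_pmf M; i < n\<rbrakk> \<Longrightarrow> Y i \<omega> = X \<omega> ! i"
  shows "prob_space.indep_vars (measure_pmf M) (\<lambda>_. count_space UNIV) Y {..<n}"
\<comment> \<open>The product criterion \<open>indep_vars_finite\<close> asks for a nonempty index
  set.\<close>
proof (cases "n = 0")
  case True
  show ?thesis
    by (subst prob_space.indep_vars_def [OF measure_pmf.prob_space_axioms],
        subst prob_space.indep_sets_def [OF measure_pmf.prob_space_axioms]) (simp_all add: True)
next
  case False
  have marginal: "measure_pmf.prob M (Y i -` B) = measure_pmf.prob p B" if "i < n" for i B
  proof -
    have "map_pmf (Y i) M = map_pmf (\<lambda>\<omega>. X \<omega> ! i) M"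
      using Y that by (intro map_pmf_cong refl) auto
    also have "\<dots> = p"
      using map_nth_replicate_pmf[OF that, of p] unfolding X[symmetric] by (simp add: pmf.map_comp o_def)
    finally show ?thesis by (metis measure_map_pmf)
  qed
  show ?thesis
  proof (subst prob_space.indep_vars_finite[OF measure_pmf.prob_space_axioms, where E = "\<lambda>_. UNIV"])
    show "\<forall>A\<in>{..<n} \<rightarrow> UNIV. measure_pmf.prob M (\<Inter>j\<in>{..<n}. Y j -` A j \<inter> space (measure_pmf M)) =
      (\<Prod>j<n. measure_pmf.prob M (Y j -` A j \<inter> space (measure_pmf M)))"
    proof
      fix A :: "nat \<Rightarrow> 'r set"
      have "measure_pmf.prob M (\<Inter>j\<in>{..<n}. Y j -` A j) = measure_pmf.prob M (X -` {xs. \<forall>i<n. xs ! i \<in> A i})"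
        using Y by (intro measure_pmf.finite_measure_eq_AE) (auto simp: AE_measure_pmf_iff)
      also have "\<dots> = (\<Prod>j<n. measure_pmf.prob p (A j))"
        using prob_replicate_pmf[of n p A] unfolding X[symmetric] by simp
      finally show "measure_pmf.prob M (\<Inter>j\<in>{..<n}. Y j -` A j \<inter> space (measure_pmf M)) =
        (\<Prod>j<n. measure_pmf.prob M (Y j -` A j \<inter> space (measure_pmf M)))"
        by (simp add: marginal)
    qed
  qed (use False in \<open>auto simp: Int_stable_def intro: sigma_sets.Basic\<close>)
qed

text \<open>From every state in \<open>D\<close> the answer has the same law \<open>p\<close>, and
  the operation leads back into \<open>D\<close>. This decouples the answers from the random states
  that link successive operations.\<close>

definition answers :: "nat \<Rightarrow> com \<Rightarrow> (state \<Rightarrow> bool) \<Rightarrow> outcome pmf \<Rightarrow> real \<Rightarrow> bool" where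
  "answers w query D p B \<longleftrightarrow> (\<forall>s. D s \<longrightarrow> (\<exists>M. exec w query (s\<lparr>out := []\<rparr>) = spmf_of_pmf M \<and>
     (\<forall>r\<in>set_pmf M. D (fst r)) \<and> map_pmf (\<lambda>r. decode (out (fst r))) M = p \<and>
     (\<integral>\<^sup>+r. of_nat (snd r) \<partial>measure_pmf M) \<le> ennreal B))"

lemma operations_answers:
  assumes "answers w query D p B" "D s"
  shows "\<exists>M. operations w query n s = spmf_of_pmf M \<and> map_pmf (map fst) M = replicate_pmf n p \<and>
    (\<forall>rs\<in>set_pmf M. length rs = n) \<and>
    (\<forall>i<n. (\<integral>\<^sup>+rs. of_nat (snd (rs ! i)) \<partial>measure_pmf M) \<le> ennreal B)"
  using assms(2)
proof (induction n arbitrary: s)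
  case 0
  have "operations w query 0 s = spmf_of_pmf (return_pmf [])" by simp
  moreover have "map_pmf (map fst) (return_pmf []) = replicate_pmf 0 p" by simp
  ultimately show ?case
    by (intro exI[of _ "return_pmf []"]) (simp del: spmf_of_pmf_return_pmf)
next
  case (Suc n)
  obtain M where M: "exec w query (s\<lparr>out := []\<rparr>) = spmf_of_pmf M" "\<forall>r\<in>set_pmf M. D (fst r)"
      "map_pmf (\<lambda>r. decode (out (fst r))) M = p"
      "(\<integral>\<^sup>+r. of_nat (snd r) \<partial>measure_pmf M) \<le> ennreal B"
    using assms(1) Suc.prems unfolding answers_def by blast
  have "\<forall>s. \<exists>M. D s \<longrightarrow> operations w query n s = spmf_of_pmf M \<and> map_pmf (map fst) M = replicate_pmf n p \<and>
    (\<forall>rs\<in>set_pmf M. length rs = n) \<and>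
    (\<forall>i<n. (\<integral>\<^sup>+rs. of_nat (snd (rs ! i)) \<partial>measure_pmf M) \<le> ennreal B)"
    using Suc.IH by blast
  then obtain L where L: "\<And>s. D s \<Longrightarrow> operations w query n s = spmf_of_pmf (L s)"
    "\<And>s. D s \<Longrightarrow> map_pmf (map fst) (L s) = replicate_pmf n p"
    "\<And>s rs. D s \<Longrightarrow> rs \<in> set_pmf (L s) \<Longrightarrow> length rs = n"
    "\<And>s i. D s \<Longrightarrow> i < n \<Longrightarrow> (\<integral>\<^sup>+rs. of_nat (snd (rs ! i)) \<partial>measure_pmf (L s)) \<le> ennreal B"
    by metis
  define R where "R = bind_pmf M (\<lambda>r. map_pmf (\<lambda>rs. (decode (out (fst r)), snd r) # rs) (L (fst r)))"
  have "operations w query (Suc n) s =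
      bind_pmf M (\<lambda>r. bind_spmf (operations w query n (fst r)) (\<lambda>rs. return_spmf ((decode (out (fst r)), snd r) # rs)))"
    using M(1) by (simp add: case_prod_unfold)
  also have "\<dots> = bind_pmf M (\<lambda>r. spmf_of_pmf (map_pmf (\<lambda>rs. (decode (out (fst r)), snd r) # rs) (L (fst r))))"
    using M(2) L(1) by (intro bind_pmf_cong refl) (auto simp: map_pmf_def spmf_of_pmf_bind)
  also have "\<dots> = spmf_of_pmf R"
    by (simp add: R_def spmf_of_pmf_bind)
  finally have eq: "operations w query (Suc n) s = spmf_of_pmf R" .
  have "map_pmf (map fst) R = bind_pmf M (\<lambda>r. map_pmf ((#) (decode (out (fst r)))) (map_pmf (map fst) (L (fst r))))"
    by (simp add: R_def map_bind_pmf pmf.map_comp o_def)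
  \<comment> \<open>The law of the later answers does not depend on the state \<open>fst r\<close>
    that the first operation leaves; this is where independence arises.\<close>
  also have "\<dots> = bind_pmf M (\<lambda>r. map_pmf ((#) (decode (out (fst r)))) (replicate_pmf n p))"
    using M(2) L(2) by (intro bind_pmf_cong refl) auto
  also have "\<dots> = bind_pmf (map_pmf (\<lambda>r. decode (out (fst r))) M) (\<lambda>x. map_pmf ((#) x) (replicate_pmf n p))"
    by (simp add: bind_map_pmf)
  also have "\<dots> = replicate_pmf (Suc n) p"
    unfolding M(3) by (simp add: map_pmf_def)
  finally have dist: "map_pmf (map fst) R = replicate_pmf (Suc n) p" .
  have len: "\<forall>rs\<in>set_pmf R. length rs = Suc n"
    using M(2) L(3) by (auto simp: R_def)
  have time: "(\<integral>\<^sup>+rs. of_nat (snd (rs ! i)) \<partial>measure_pmf R) \<le> ennreal B" if "i < Suc n" for i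
  proof (cases i)
    case 0
    then show ?thesis using M(4) by (simp add: R_def)
  next
    case (Suc j)
    have "(\<integral>\<^sup>+rs. of_nat (snd (rs ! i)) \<partial>measure_pmf R) =
        (\<integral>\<^sup>+r. (\<integral>\<^sup>+rs. of_nat (snd (rs ! j)) \<partial>measure_pmf (L (fst r))) \<partial>measure_pmf M)"
      by (simp add: R_def Suc)
    also have "\<dots> \<le> (\<integral>\<^sup>+r. ennreal B \<partial>measure_pmf M)"
      using M(2) L(4) that Suc by (intro nn_integral_mono_AE) (auto simp: AE_measure_pmf_iff)
    also have "\<dots> = ennreal B" by simp
    finally show ?thesis .
  qed
  show ?case using eq dist len time by blast
qed

lemma sampling_structureI:
  assumes "exec w build s = return_spmf (s', t)" "real t \<le> A" "D s'"
    and "answers w query D (sampling_outcome P G) B"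
  shows "sampling_structure P G w build query s A B"
  unfolding sampling_structure_def
proof
  fix q
  obtain M where M: "operations w query q s' = spmf_of_pmf M"
    "map_pmf (map fst) M = replicate_pmf q (sampling_outcome P G)"
    "\<forall>rs\<in>set_pmf M. length rs = q"
    "\<forall>i<q. (\<integral>\<^sup>+rs. of_nat (snd (rs ! i)) \<partial>measure_pmf M) \<le> ennreal B"
    using operations_answers[OF assms(4,3)] by blast
  define R where "R = map_pmf (Pair t) M"
  have "session w build query q s = spmf_of_pmf R"
    by (simp add: session_def assms(1) M(1) R_def map_pmf_def spmf_of_pmf_bind)
  moreover have "(\<integral>\<^sup>+\<omega>. of_nat (fst \<omega>) \<partial>measure_pmf R) \<le> ennreal A"
    using assms(2) by (simp add: R_def ennreal_of_nat_eq_real_of_nat ennreal_leI)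
  moreover have "\<forall>i<q. (\<integral>\<^sup>+\<omega>. of_nat (snd (snd \<omega> ! i)) \<partial>measure_pmf R) \<le> ennreal B"
    using M(4) by (simp add: R_def)
  moreover have X: "map_pmf (\<lambda>\<omega>. map fst (snd \<omega>)) R = replicate_pmf q (sampling_outcome P G)"
    using M(2) by (simp add: R_def pmf.map_comp o_def)
  moreover have nth: "map fst (snd \<omega>) ! i = fst (snd \<omega> ! i)" if "\<omega> \<in> set_pmf R" "i < q" for \<omega> i
    using that M(3) by (auto simp: R_def)
  have "map_pmf (\<lambda>\<omega>. fst (snd \<omega> ! i)) R = sampling_outcome P G" if "i < q" for i
  proof -
    have "map_pmf (\<lambda>\<omega>. fst (snd \<omega> ! i)) R = map_pmf (\<lambda>\<omega>. map fst (snd \<omega>) ! i) R"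
      using nth that by (intro map_pmf_cong refl) auto
    also have "\<dots> = map_pmf (\<lambda>xs. xs ! i) (map_pmf (\<lambda>\<omega>. map fst (snd \<omega>)) R)"
      by (simp add: pmf.map_comp o_def)
    finally show ?thesis using that by (simp add: X map_nth_replicate_pmf)
  qed
  moreover have "prob_space.indep_vars (measure_pmf R) (\<lambda>_. count_space UNIV) (\<lambda>i \<omega>. fst (snd \<omega> ! i)) {..<q}"
    by (rule indep_vars_nth[OF X]) (simp add: nth)
  ultimately show "\<exists>M. session w build query q s = spmf_of_pmf M \<and>
        (\<integral>\<^sup>+ \<omega>. of_nat (fst \<omega>) \<partial>measure_pmf M) \<le> ennreal A \<and>
        (\<forall>i<q. (\<integral>\<^sup>+ \<omega>. of_nat (snd (snd \<omega> ! i)) \<partial>measure_pmf M) \<le> ennreal B) \<and>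
        (\<forall>i<q. map_pmf (\<lambda>\<omega>. fst (snd \<omega> ! i)) M = sampling_outcome P G) \<and>
        prob_space.indep_vars (measure_pmf M) (\<lambda>_. count_space UNIV)
          (\<lambda>i \<omega>. fst (snd \<omega> ! i)) {..<q}" by blast
qed

section \<open>Straight-line programs and candidate decoding\<close>

text \<open>Without randomness and loops a program is deterministic and its running time is bounded
  by a constant of its text, so its execution reduces to the functions \<open>result\<close> and
  \<open>cost\<close>.\<close>

primrec straight :: "com \<Rightarrow> bool" where
  "straight Skip = True"
| "straight (Assign r a) = True"
| "straight (Load r a) = True"
| "straight (Store a b) = True"
| "straight (Lookup r h a b) = True"
| "straight (Update h a b c) = True"
| "straight (Rand r a) = False"
| "straight (Emit a) = True"
| "straight (Seq c1 c2) = (straight c1 \<and> straight c2)"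
| "straight (If b c1 c2) = (straight c1 \<and> straight c2)"
| "straight (While b c) = False"

primrec cost :: "com \<Rightarrow> nat" where
  "cost Skip = 1"
| "cost (Assign r a) = 1"
| "cost (Load r a) = 1"
| "cost (Store a b) = 1"
| "cost (Lookup r h a b) = 1"
| "cost (Update h a b c) = 1"
| "cost (Rand r a) = 1"
| "cost (Emit a) = 1"
| "cost (Seq c1 c2) = cost c1 + cost c2"
| "cost (If b c1 c2) = 1 + max (cost c1) (cost c2)"
| "cost (While b c) = 0"

primrec result :: "nat \<Rightarrow> com \<Rightarrow> state \<Rightarrow> state" where
  "result w Skip s = s"
| "result w (Assign r a) s = s\<lparr>reg := (reg s)(r := aval w a s)\<rparr>"
| "result w (Load r a) s = s\<lparr>reg := (reg s)(r := mem s (aval w a s))\<rparr>"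
| "result w (Store a b) s = s\<lparr>mem := (mem s)(aval w a s := aval w b s)\<rparr>"
| "result w (Lookup r h a b) s = s\<lparr>reg := (reg s)(r := tab s h (aval w a s, aval w b s))\<rparr>"
| "result w (Update h a b c) s =
     s\<lparr>tab := (tab s)(h := (tab s h)((aval w a s, aval w b s) := aval w c s))\<rparr>"
| "result w (Rand r a) s = s"
| "result w (Emit a) s = s\<lparr>out := out s @ [aval w a s]\<rparr>"
| "result w (Seq c1 c2) s = result w c2 (result w c1 s)"
| "result w (If b c1 c2) s = (if bval w b s then result w c1 s else result w c2 s)"
| "result w (While b c) s = s"

lemma exec_straight:
  "straight c \<Longrightarrow> \<exists>t\<le>cost c. exec w c s = return_spmf (result w c s, t)"
proof (induction c arbitrary: s)
  case (Seq c1 c2)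
  obtain t1 where t1: "t1 \<le> cost c1" "exec w c1 s = return_spmf (result w c1 s, t1)"
    using Seq by auto
  obtain t2 where "t2 \<le> cost c2" "exec w c2 (result w c1 s) = return_spmf (result w c2 (result w c1 s), t2)"
    using Seq by auto
  with t1 show ?case by (intro exI[of _ "t1 + t2"]) auto
next
  case (If b c1 c2)
  obtain t1 where t1: "t1 \<le> cost c1" "exec w c1 s = return_spmf (result w c1 s, t1)"
    using If by auto
  obtain t2 where "t2 \<le> cost c2" "exec w c2 s = return_spmf (result w c2 s, t2)"
    using If by auto
  with t1 show ?case by (intro exI[of _ "1 + (if bval w b s then t1 else t2)"]) auto
qed auto

text \<open>\<open>I\<close> carries the iteration number, so that one invariant gives termination,
  the final state and the running time. The last 1 is the failing test.\<close>

lemma exec_while_straight: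
  assumes "straight c" "I i s" "i \<le> n"
    and step: "\<And>i s. i < n \<Longrightarrow> I i s \<Longrightarrow> bval w b s \<and> I (Suc i) (result w c s)"
    and stop: "\<And>s. I n s \<Longrightarrow> \<not> bval w b s"
  shows "\<exists>s' t. exec w (While b c) s = return_spmf (s', t) \<and> I n s' \<and> t \<le> (n - i) * (1 + cost c) + 1"
  using assms(2,3)
proof (induction "n - i" arbitrary: i s)
  case 0
  then have "I n s" by simp
  then show ?case using stop by (intro exI[of _ s] exI[of _ 1]) (simp add: while_spmf.simps)
next
  case (Suc j)
  obtain t where t: "t \<le> cost c" "exec w c s = return_spmf (result w c s, t)"
    using exec_straight[OF assms(1)] by blast
  have st: "bval w b s" "I (Suc i) (result w c s)" using step[of i s] Suc by auto
  obtain s' t' where t': "exec w (While b c) (result w c s) = return_spmf (s', t')" "I n s'"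
      "t' \<le> (n - Suc i) * (1 + cost c) + 1"
    using Suc.hyps(1)[of "Suc i" "result w c s"] Suc.hyps(2) Suc.prems st by force
  have "exec w (While b c) s = return_spmf (s', 1 + t + t')"
    using st(1) t(2) t'(1) by (simp add: while_spmf.simps[of _ _ s])
  moreover have "1 + t + t' \<le> (n - i) * (1 + cost c) + 1"
  proof -
    have "n - i = Suc (n - Suc i)" using Suc.hyps(2) by simp
    then show ?thesis using t(1) t'(3) by simp
  qed
  ultimately show ?case using t'(2) by blast
qed

definition seqs :: "com list \<Rightarrow> com" where
  "seqs cs = foldr Seq cs Skip"

lemma seqs_simps [simp]: "seqs [] = Skip" "seqs (c # cs) = Seq c (seqs cs)"
  by (simp_all add: seqs_def)

lemma straight_seqs [simp]: "straight (seqs cs) \<longleftrightarrow> (\<forall>c\<in>set cs. straight c)"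
  by (induction cs) auto

lemma aval_out [simp]: "aval w a (s\<lparr>out := xs\<rparr>) = aval w a s"
  by (induction a) auto

lemma result_emits: "result w (seqs (map Emit es)) s = s\<lparr>out := out s @ map (\<lambda>e. aval w e s) es\<rparr>"
  by (induction es arbitrary: s) auto

text \<open>Register layout: 0 holds \<open>|E|\<close>, 1 the degree bound, 2 the threshold \<open>\<lceil>\<surd>|E|\<rceil>\<close> above which a
  degree is heavy, 3 the number of heavy vertices, 4 the candidate being decoded, 5 its current
  digit, 6 scratch, 7 the success flag, 8 the number of candidates, 9 the position of the
  deterministic scan, 10 whether the scan has succeeded, 11 whether the loop goes on; register
  \<open>12 + i\<close> holds the image of pattern vertex \<open>i\<close>.  Tables: 0 maps \<open>(u, 0)\<close> to the degree of
  \<open>u\<close>, 1 maps \<open>(u, j)\<close> to the \<open>j\<close>-th neighbour of \<open>u\<close>, 2 is the adjacency matrix, 3 maps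
  \<open>(0, j)\<close> to the \<open>j\<close>-th heavy vertex.

  A plan describes how a candidate, read as a mixed radix number, determines an assignment of data
  vertices to pattern vertices: \<open>Arc a b\<close> reads an oriented edge, \<open>Nbr a b\<close> and \<open>Light a b\<close> read an
  index into the adjacency list of the image of \<open>a\<close> (which must be light for \<open>Light\<close>), \<open>Heavy b\<close>
  reads an index into the list of heavy vertices, and \<open>Alt\<close> is the disjoint union of two candidate
  spaces.\<close>

datatype draw = Arc nat nat | Nbr nat nat | Light nat nat | Heavy nat

datatype plan = Done | Draw draw plan | Alt plan plan

abbreviation vreg :: "nat \<Rightarrow> nat" where "vreg i \<equiv> i + 12"

definition assignment :: "state \<Rightarrow> nat \<Rightarrow> nat" where
  "assignment s i = reg s (vreg i)"

text \<open>The two endpoints of an input edge are stored in cells \<open>d\<close> and \<open>flip d\<close>, so the cells below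
  \<open>2 * |E|\<close> enumerate the oriented edges.\<close>

definition flip :: "nat \<Rightarrow> nat" where
  "flip d = d + 1 - 2 * (d mod 2)"

definition flip_exp :: "nat \<Rightarrow> aexp" where
  "flip_exp r = Sub (Add (Reg r) (Const 1)) (Mul (Const 2) (Mod (Reg r) (Const 2)))"

text \<open>Since 4 * m is at most 2^w, neither the constant 2 nor the successor of the register
  wraps.\<close>

lemma aval_flip_exp:
  assumes "reg s r < 2 * m" "4 * m \<le> 2 ^ w"
  shows "aval w (flip_exp r) s = flip (reg s r)"
proof -
  have "1 \<le> m" using assms(1) by linarith
  then have "2 < (2::nat) ^ w" using assms(2) by linarith
  moreover have "reg s r + 1 < 2 ^ w" using assms \<open>1 \<le> m\<close> by linarith
  moreover have "2 * (reg s r mod 2) < 2 ^ w" using calculation(1) by (simp add: mod_2_eq_odd)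
  moreover have "0 < w" using calculation(1) by (cases w) auto
  ultimately show ?thesis by (simp add: flip_def flip_exp_def)
qed

text \<open>A radix depends only on registers 0 to 2, never on vertices already chosen, so the
  candidates of a plan form an interval of numbers. It is an upper bound for the length of the list
  that is indexed; digits beyond the actual length are rejected by \<open>legal\<close>.\<close>

primrec radix :: "state \<Rightarrow> draw \<Rightarrow> nat" where
  "radix s (Arc a b) = 2 * reg s 0"
| "radix s (Nbr a b) = reg s 1"
| "radix s (Light a b) = reg s 2"
| "radix s (Heavy b) = 2 * reg s 2"

primrec radix_exp :: "draw \<Rightarrow> aexp" where
  "radix_exp (Arc a b) = Mul (Const 2) (Reg 0)"
| "radix_exp (Nbr a b) = Reg 1"
| "radix_exp (Light a b) = Reg 2"
| "radix_exp (Heavy b) = Mul (Const 2) (Reg 2)"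

primrec place :: "state \<Rightarrow> draw \<Rightarrow> nat \<Rightarrow> (nat \<Rightarrow> nat) \<Rightarrow> nat \<Rightarrow> nat" where
  "place s (Arc a b) d \<phi> = \<phi>(a := mem s d, b := mem s (flip d))"
| "place s (Nbr a b) d \<phi> = \<phi>(b := tab s 1 (\<phi> a, d))"
| "place s (Light a b) d \<phi> = \<phi>(b := tab s 1 (\<phi> a, d))"
| "place s (Heavy b) d \<phi> = \<phi>(b := tab s 3 (0, d))"

primrec legal :: "state \<Rightarrow> draw \<Rightarrow> nat \<Rightarrow> (nat \<Rightarrow> nat) \<Rightarrow> bool" where
  "legal s (Arc a b) d \<phi> = True"
| "legal s (Nbr a b) d \<phi> = (d < tab s 0 (\<phi> a, 0))"
| "legal s (Light a b) d \<phi> = (d < tab s 0 (\<phi> a, 0) \<and> tab s 0 (\<phi> a, 0) \<le> reg s 2)"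
| "legal s (Heavy b) d \<phi> = (d < reg s 3)"

text \<open>An illegal digit only clears register 7, and decoding goes on with whatever the tables
  return. As nothing aborts, the code remains straight-line.\<close>

primrec draw_code :: "draw \<Rightarrow> com" where
  "draw_code (Arc a b) = Seq (Load (vreg a) (Reg 5))
     (Load (vreg b) (flip_exp 5))"
| "draw_code (Nbr a b) = Seq (Lookup 6 0 (Reg (vreg a)) (Const 0))
     (Seq (If (Less (Reg 5) (Reg 6)) Skip (Assign 7 (Const 0)))
     (Lookup (vreg b) 1 (Reg (vreg a)) (Reg 5)))"
| "draw_code (Light a b) = Seq (Lookup 6 0 (Reg (vreg a)) (Const 0))
     (Seq (If (And (Less (Reg 5) (Reg 6)) (Not (Less (Reg 2) (Reg 6)))) Skip (Assign 7 (Const 0)))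
     (Lookup (vreg b) 1 (Reg (vreg a)) (Reg 5)))"
| "draw_code (Heavy b) = Seq (If (Less (Reg 5) (Reg 3)) Skip (Assign 7 (Const 0)))
     (Lookup (vreg b) 3 (Const 0) (Reg 5))"

primrec plan_size :: "state \<Rightarrow> plan \<Rightarrow> nat" where
  "plan_size s Done = 1"
| "plan_size s (Draw r p) = radix s r * plan_size s p"
| "plan_size s (Alt p q) = plan_size s p + plan_size s q"

primrec size_exp :: "plan \<Rightarrow> aexp" where
  "size_exp Done = Const 1"
| "size_exp (Draw r p) = Mul (radix_exp r) (size_exp p)"
| "size_exp (Alt p q) = Add (size_exp p) (size_exp q)"

primrec fill :: "state \<Rightarrow> plan \<Rightarrow> nat \<Rightarrow> (nat \<Rightarrow> nat) \<Rightarrow> nat \<Rightarrow> nat" where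
  "fill s Done x \<phi> = \<phi>"
| "fill s (Draw r p) x \<phi> = fill s p (x div radix s r) (place s r (x mod radix s r) \<phi>)"
| "fill s (Alt p q) x \<phi> = (if x < plan_size s p then fill s p x \<phi> else fill s q (x - plan_size s p) \<phi>)"

primrec legals :: "state \<Rightarrow> plan \<Rightarrow> nat \<Rightarrow> (nat \<Rightarrow> nat) \<Rightarrow> bool" where
  "legals s Done x \<phi> = True"
| "legals s (Draw r p) x \<phi> = (legal s r (x mod radix s r) \<phi> \<and>
     legals s p (x div radix s r) (place s r (x mod radix s r) \<phi>))"
| "legals s (Alt p q) x \<phi> = (if x < plan_size s p then legals s p x \<phi> else legals s q (x - plan_size s p) \<phi>)"

primrec plan_code :: "plan \<Rightarrow> com" where
  "plan_code Done = Skip"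
| "plan_code (Draw r p) = Seq (Assign 5 (Mod (Reg 4) (radix_exp r)))
     (Seq (Assign 4 (Div (Reg 4) (radix_exp r))) (Seq (draw_code r) (plan_code p)))"
| "plan_code (Alt p q) = If (Less (Reg 4) (size_exp p)) (plan_code p)
     (Seq (Assign 4 (Sub (Reg 4) (size_exp p))) (plan_code q))"

text \<open>What preprocessing produces and operations preserve; this relation is the invariant
  \<open>D\<close> between operations.\<close>

definition same_data :: "state \<Rightarrow> state \<Rightarrow> bool" where
  "same_data s s' \<longleftrightarrow> mem s' = mem s \<and> tab s' = tab s \<and> (\<forall>r<4. reg s' r = reg s r)"

text \<open>Within a single operation a trial must also spare the output and registers 8 to 11,
  which control the loop.\<close>

definition frame :: "state \<Rightarrow> state \<Rightarrow> bool" where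
  "frame s s' \<longleftrightarrow> same_data s s' \<and> out s' = out s \<and> (\<forall>r\<in>{8..<12}. reg s' r = reg s r)"

text \<open>The lower bounds make every radix positive. The upper bounds keep doubled registers and
  \<open>flip_exp\<close> from wrapping.\<close>

definition valid :: "nat \<Rightarrow> state \<Rightarrow> bool" where
  "valid w s \<longleftrightarrow> 1 \<le> reg s 0 \<and> 1 \<le> reg s 1 \<and> 1 \<le> reg s 2 \<and> reg s 2 \<le> reg s 0 \<and> 4 * reg s 0 \<le> 2 ^ w"

lemma valid_word: "valid w s \<Longrightarrow> 0 < w"
  by (cases w) (auto simp: valid_def)

lemma same_data_refl [simp]: "same_data s s" by (simp add: same_data_def)

lemma same_data_trans: "same_data s s' \<Longrightarrow> same_data s' s'' \<Longrightarrow> same_data s s''"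
  by (simp add: same_data_def)

lemma same_data_radix: "same_data s s' \<Longrightarrow> radix s' = radix s"
proof
  fix r
  assume "same_data s s'" then show "radix s' r = radix s r" by (cases r) (auto simp: same_data_def)
qed

lemma same_data_place: "same_data s s' \<Longrightarrow> place s' = place s"
proof (intro ext)
  fix r d \<phi> i
  assume "same_data s s'" then show "place s' r d \<phi> i = place s r d \<phi> i" by (cases r) (auto simp: same_data_def)
qed

lemma same_data_legal: "same_data s s' \<Longrightarrow> legal s' = legal s"
proof (intro ext)
  fix r d \<phi>
  assume "same_data s s'" then show "legal s' r d \<phi> = legal s r d \<phi>" by (cases r) (auto simp: same_data_def)
qed

lemma same_data_plan_size: "same_data s s' \<Longrightarrow> plan_size s' = plan_size s"
proof
  fix p
  assume "same_data s s'" then show "plan_size s' p = plan_size s p" by (induction p) (auto simp: same_data_radix)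
qed

lemma same_data_fill: "same_data s s' \<Longrightarrow> fill s' = fill s"
proof (intro ext)
  fix p x \<phi> i
  assume "same_data s s'" then show "fill s' p x \<phi> i = fill s p x \<phi> i"
    by (induction p arbitrary: x \<phi>) (auto simp: same_data_radix same_data_place same_data_plan_size)
qed

lemma same_data_legals: "same_data s s' \<Longrightarrow> legals s' = legals s"
proof (intro ext)
  fix p x \<phi>
  assume "same_data s s'" then show "legals s' p x \<phi> = legals s p x \<phi>"
    by (induction p arbitrary: x \<phi>) (auto simp: same_data_radix same_data_place same_data_legal same_data_plan_size)
qed

lemma same_data_valid: "same_data s s' \<Longrightarrow> valid w s' = valid w s"
  by (simp add: same_data_def valid_def)

lemmas same_data_simps = same_data_radix same_data_place same_data_legal same_data_plan_size
  same_data_fill same_data_legals same_data_valid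

lemma radix_pos: "valid w s \<Longrightarrow> 0 < radix s r"
  by (cases r) (auto simp: valid_def)

lemma plan_size_pos: "valid w s \<Longrightarrow> 0 < plan_size s p"
  using radix_pos by (induction p) auto

lemma aval_radix_exp: "valid w s \<Longrightarrow> aval w (radix_exp r) s = radix s r"
  by (cases r) (auto simp: valid_def)

text \<open>Radices are positive, so if the whole size fits in a word, no partial product in
  \<open>size_exp\<close> wraps.\<close>

lemma plan_size_less:
  assumes "valid w s" "plan_size s (Draw r p) < B"
  shows "plan_size s p < B"
  using radix_pos[OF assms(1), of r] assms(2)
  by (metis le_less_trans mult_le_mono1 Suc_leI One_nat_def nat_mult_1 plan_size.simps(2))

lemma aval_size_exp: "valid w s \<Longrightarrow> plan_size s p < 2 ^ w \<Longrightarrow> aval w (size_exp p) s = plan_size s p"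
proof (induction p)
  case Done
  then show ?case by (cases w) (auto simp: valid_def)
next
  case (Draw r p)
  then show ?case using plan_size_less[OF Draw.prems] by (simp add: aval_radix_exp)
qed simp

lemma draw_code:
  assumes "valid w s" "reg s 5 < radix s r"
  defines "s' \<equiv> result w (draw_code r) s"
  shows "frame s s'" "reg s' 4 = reg s 4"
    "assignment s' = place s r (reg s 5) (assignment s)"
    "reg s' 7 = (if legal s r (reg s 5) (assignment s) then reg s 7 else 0)"
proof -
  have arc: "aval w (flip_exp 5) (s\<lparr>reg := (reg s)(vreg a := v)\<rparr>) = flip (reg s 5)"
    if "reg s 5 < 2 * reg s 0" for a v
    using assms(1) that by (subst aval_flip_exp[where m = "reg s 0"]) (auto simp: valid_def)
  show "frame s s'" "reg s' 4 = reg s 4"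
    "assignment s' = place s r (reg s 5) (assignment s)"
    "reg s' 7 = (if legal s r (reg s 5) (assignment s) then reg s 7 else 0)"
    using assms(2) arc
    by (cases r; auto simp: s'_def frame_def same_data_def assignment_def fun_eq_iff)+
qed

lemma plan_code:
  assumes "valid w s" "plan_size s p < 2 ^ w" "reg s 4 < plan_size s p"
  defines "s' \<equiv> result w (plan_code p) s"
  shows "frame s s' \<and> assignment s' = fill s p (reg s 4) (assignment s) \<and>
    reg s' 7 = (if legals s p (reg s 4) (assignment s) then reg s 7 else 0)"
  using assms(1-3) unfolding s'_def
proof (induction p arbitrary: s)
  case Done
  then show ?case by (simp add: frame_def)
next
  case (Draw r p)
  define d where "d = reg s 4 mod radix s r"
  define s1 where "s1 = s\<lparr>reg := (reg s)(5 := d, 4 := reg s 4 div radix s r)\<rparr>"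
  define s2 where "s2 = result w (draw_code r) s1"
  have s1: "same_data s s1" "frame s s1" "reg s1 5 = d" "reg s1 4 = reg s 4 div radix s r" "assignment s1 = assignment s" "reg s1 7 = reg s 7"
    by (auto simp: s1_def same_data_def frame_def assignment_def fun_eq_iff)
  have "aval w (radix_exp r) (s\<lparr>reg := (reg s)(5 := d)\<rparr>) = radix s r"
  proof -
    have sd: "same_data s (s\<lparr>reg := (reg s)(5 := d)\<rparr>)" by (simp add: same_data_def)
    then show ?thesis using Draw.prems(1) aval_radix_exp[of w "s\<lparr>reg := (reg s)(5 := d)\<rparr>" r] by (simp add: same_data_simps[OF sd])
  qed
  then have res: "result w (plan_code (Draw r p)) s = result w (plan_code p) s2"
    using aval_radix_exp[OF Draw.prems(1), of r] by (simp add: s2_def s1_def d_def)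
  have v1: "valid w s1" "reg s1 5 < radix s1 r"
    using Draw.prems(1) radix_pos by (auto simp: same_data_simps[OF s1(1)] s1 d_def)
  note s2 = draw_code[OF v1, folded s2_def]
  have sd2: "same_data s s2" using s1(1) s2(1) same_data_trans by (auto simp: frame_def)
  have "frame s2 (result w (plan_code p) s2) \<and> assignment (result w (plan_code p) s2) = fill s2 p (reg s2 4) (assignment s2) \<and>
    reg (result w (plan_code p) s2) 7 = (if legals s2 p (reg s2 4) (assignment s2) then reg s2 7 else 0)"
  proof (rule Draw.IH)
    show "valid w s2" using Draw.prems by (simp add: same_data_simps[OF sd2])
    show "plan_size s2 p < 2 ^ w" using plan_size_less[OF Draw.prems(1,2)] by (simp add: same_data_simps[OF sd2])
    show "reg s2 4 < plan_size s2 p" using Draw.prems(3)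
      by (simp add: same_data_simps[OF sd2] s2 s1 less_mult_imp_div_less mult.commute)
  qed
  moreover have "frame s (result w (plan_code p) s2)"
    using s1(2) s2(1) calculation by (auto simp: frame_def intro: same_data_trans)
  ultimately show ?case
    unfolding res by (simp add: s1 s2 same_data_simps[OF sd2] same_data_simps[OF s1(1)] d_def)
next
  case (Alt p q)
  show ?case
  proof (cases "reg s 4 < plan_size s p")
    case True
    then show ?thesis using Alt.IH(1)[of s] Alt.prems by (simp add: aval_size_exp)
  next
    case False
    define s1 where "s1 = s\<lparr>reg := (reg s)(4 := reg s 4 - plan_size s p)\<rparr>"
    have s1: "same_data s s1" "frame s s1" "reg s1 4 = reg s 4 - plan_size s p" "assignment s1 = assignment s" "reg s1 7 = reg s 7"
      by (auto simp: s1_def same_data_def frame_def assignment_def fun_eq_iff)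
    have "frame s1 (result w (plan_code q) s1) \<and> assignment (result w (plan_code q) s1) = fill s1 q (reg s1 4) (assignment s1) \<and>
      reg (result w (plan_code q) s1) 7 = (if legals s1 q (reg s1 4) (assignment s1) then reg s1 7 else 0)"
      using Alt.IH(2)[of s1] Alt.prems False by (simp add: same_data_simps[OF s1(1)] s1)
    moreover have "frame s (result w (plan_code q) s1)"
      using s1(2) calculation by (auto simp: frame_def intro: same_data_trans)
    moreover have "result w (plan_code (Alt p q)) s = result w (plan_code q) s1"
      using False Alt.prems by (simp add: aval_size_exp s1_def)
    ultimately show ?thesis using False by (simp add: s1 same_data_simps[OF s1(1)])
  qed
qed

lemma straight_plan_code: "straight (plan_code p)"
proof (induction p)
  case (Draw r p)
  then show ?case by (cases r) auto
qed auto

section \<open>Testing and reporting a decoded assignment\<close>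

definition distinct_code :: "nat \<Rightarrow> com" where
  "distinct_code k = seqs [If (Equal (Reg (vreg i)) (Reg (vreg j))) (Assign 7 (Const 0)) Skip.
     j \<leftarrow> [0..<k], i \<leftarrow> [0..<j]]"

definition edges_code :: "(nat \<times> nat) list \<Rightarrow> com" where
  "edges_code es = seqs (map (\<lambda>(i, j). Seq (Lookup 6 2 (Reg (vreg i)) (Reg (vreg j)))
     (If (Equal (Reg 6) (Const 1)) Skip (Assign 7 (Const 0)))) es)"

definition embeds :: "state \<Rightarrow> nat \<Rightarrow> (nat \<times> nat) list \<Rightarrow> (nat \<Rightarrow> nat) \<Rightarrow> bool" where
  "embeds s k es \<phi> \<longleftrightarrow> inj_on \<phi> {..<k} \<and> (\<forall>(i, j)\<in>set es. tab s 2 (\<phi> i, \<phi> j) = 1)"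

lemma same_data_embeds: "same_data s s' \<Longrightarrow> embeds s' = embeds s"
  by (intro ext) (simp add: embeds_def same_data_def)

lemma result_distinct_pairs:
  "result w (seqs (map (\<lambda>(i, j). If (Equal (Reg (vreg i)) (Reg (vreg j))) (Assign 7 (Const 0)) Skip) xs)) s =
    s\<lparr>reg := (reg s)(7 := if \<forall>(i, j)\<in>set xs. assignment s i \<noteq> assignment s j then reg s 7 else 0)\<rparr>"
proof (induction xs arbitrary: s)
  case (Cons x xs)
  obtain i j where x: "x = (i, j)" by force
  define s1 where "s1 = s\<lparr>reg := (reg s)(7 := if assignment s i \<noteq> assignment s j then reg s 7 else 0)\<rparr>"
  have "assignment s1 = assignment s" by (auto simp: s1_def assignment_def fun_eq_iff)
  moreover have "(if bval w (Equal (Reg (vreg i)) (Reg (vreg j))) s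
      then result w (Assign 7 (Const 0)) s else result w Skip s) = s1"
    by (simp add: s1_def assignment_def)
  ultimately have "result w (seqs (map (\<lambda>(i, j). If (Equal (Reg (vreg i)) (Reg (vreg j))) (Assign 7 (Const 0)) Skip) (x # xs))) s =
      s1\<lparr>reg := (reg s1)(7 := if \<forall>(i, j)\<in>set xs. assignment s i \<noteq> assignment s j then reg s1 7 else 0)\<rparr>"
    using Cons.IH[of s1] by (simp only: x list.map case_prod_conv seqs_simps result.simps(9,10))
  then show ?case by (auto simp: x s1_def intro!: state.equality)
qed simp

lemma result_distinct_code:
  "result w (distinct_code k) s = s\<lparr>reg := (reg s)(7 := if inj_on (assignment s) {..<k} then reg s 7 else 0)\<rparr>"
proof -
  define xs where "xs = [(i, j). j \<leftarrow> [0..<k], i \<leftarrow> [0..<j]]"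
  have code: "distinct_code k = seqs (map (\<lambda>(i, j). If (Equal (Reg (vreg i)) (Reg (vreg j))) (Assign 7 (Const 0)) Skip) xs)"
    by (simp add: distinct_code_def xs_def map_concat o_def)
  have "(\<forall>(i, j)\<in>set xs. assignment s i \<noteq> assignment s j) \<longleftrightarrow> inj_on (assignment s) {..<k}"
  proof
    assume L: "\<forall>(i, j)\<in>set xs. assignment s i \<noteq> assignment s j"
    show "inj_on (assignment s) {..<k}"
    proof (rule linorder_inj_onI)
      fix i j assume "i < j" "i \<in> {..<k}" "j \<in> {..<k}"
      then have "(i, j) \<in> set xs" by (force simp: xs_def)
      then show "assignment s i \<noteq> assignment s j" using L by blast
    qed auto
  next
    assume "inj_on (assignment s) {..<k}"
    then show "\<forall>(i, j)\<in>set xs. assignment s i \<noteq> assignment s j"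
      by (fastforce simp: xs_def inj_on_def)
  qed
  then show ?thesis unfolding code result_distinct_pairs by simp
qed

lemma result_edges_code:
  assumes "0 < w"
  shows "frame s (result w (edges_code es) s) \<and>
    assignment (result w (edges_code es) s) = assignment s \<and>
    reg (result w (edges_code es) s) 7 =
      (if \<forall>(i, j)\<in>set es. tab s 2 (assignment s i, assignment s j) = 1 then reg s 7 else 0)"
proof (induction es arbitrary: s)
  case Nil
  then show ?case by (simp add: edges_code_def frame_def)
next
  case (Cons e es)
  obtain i j where e: "e = (i, j)" by force
  define s1 where "s1 = s\<lparr>reg := (reg s)(6 := tab s 2 (assignment s i, assignment s j),
    7 := if tab s 2 (assignment s i, assignment s j) = 1 then reg s 7 else 0)\<rparr>"
  have s1: "frame s s1" "assignment s1 = assignment s" "tab s1 = tab s"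
      "reg s1 7 = (if tab s 2 (assignment s i, assignment s j) = 1 then reg s 7 else 0)"
    by (auto simp: s1_def frame_def same_data_def assignment_def fun_eq_iff)
  have "result w (edges_code (e # es)) s = result w (edges_code es) s1"
    using assms by (auto simp: edges_code_def e s1_def assignment_def fun_upd_idem intro!: arg_cong[where f = "result w _"])
  then show ?case using Cons.IH[of s1] s1 by (auto simp: e frame_def intro: same_data_trans)
qed

definition trial :: "nat \<Rightarrow> (nat \<times> nat) list \<Rightarrow> plan \<Rightarrow> com" where
  "trial k es p = Seq (Assign 7 (Const 1)) (Seq (plan_code p) (Seq (distinct_code k) (edges_code es)))"

definition good :: "state \<Rightarrow> nat \<Rightarrow> (nat \<times> nat) list \<Rightarrow> plan \<Rightarrow> (nat \<Rightarrow> nat) \<Rightarrow> nat \<Rightarrow> bool" where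
  "good s k es p \<phi> x \<longleftrightarrow> legals s p x \<phi> \<and> embeds s k es (fill s p x \<phi>)"

lemma trial:
  fixes k es
  assumes "valid w s" "plan_size s p < 2 ^ w" "reg s 4 < plan_size s p"
  defines "s' \<equiv> result w (trial k es p) s"
  shows "frame s s'" "assignment s' = fill s p (reg s 4) (assignment s)"
    "reg s' 7 = of_bool (good s k es p (assignment s) (reg s 4))"
proof -
  have w: "0 < w" using valid_word[OF assms(1)] .
  define s1 where "s1 = s\<lparr>reg := (reg s)(7 := 1)\<rparr>"
  have s1: "same_data s s1" "frame s s1" "reg s1 4 = reg s 4" "assignment s1 = assignment s" "reg s1 7 = 1"
    by (auto simp: s1_def same_data_def frame_def assignment_def fun_eq_iff)
  define s2 where "s2 = result w (plan_code p) s1"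
  have s2: "frame s1 s2" "assignment s2 = fill s1 p (reg s1 4) (assignment s1)"
    "reg s2 7 = (if legals s1 p (reg s1 4) (assignment s1) then reg s1 7 else 0)"
    using plan_code[of w s1 p] assms(1-3) by (auto simp: s1 same_data_simps[OF s1(1)] s2_def)
  define s3 where "s3 = result w (distinct_code k) s2"
  have s3: "frame s2 s3" "assignment s3 = assignment s2" "reg s3 7 = (if inj_on (assignment s2) {..<k} then reg s2 7 else 0)"
    by (auto simp: s3_def result_distinct_code frame_def same_data_def assignment_def fun_eq_iff)
  have s': "s' = result w (edges_code es) s3"
    using w by (simp add: s'_def trial_def s3_def s2_def s1_def)
  have s4: "frame s3 s'" "assignment s' = assignment s3"
    "reg s' 7 = (if \<forall>(i, j)\<in>set es. tab s3 2 (assignment s3 i, assignment s3 j) = 1 then reg s3 7 else 0)"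
    unfolding s' using result_edges_code[OF w] by auto
  show "frame s s'" using s1(2) s2(1) s3(1) s4(1) by (auto simp: frame_def same_data_def)
  show "assignment s' = fill s p (reg s 4) (assignment s)"
    by (simp add: s4 s3 s2 s1 same_data_simps[OF s1(1)])
  have "tab s3 = tab s" using s1(2) s2(1) s3(1) by (auto simp: frame_def same_data_def)
  then show "reg s' 7 = of_bool (good s k es p (assignment s) (reg s 4))"
    by (simp add: s4 s3 s2 s1 good_def embeds_def same_data_simps[OF s1(1)])
qed

lemma straight_trial: "straight (trial k es p)"
  by (auto simp: trial_def straight_plan_code distinct_code_def edges_code_def)

text \<open>When \<open>es\<close> holds both orientations of every pattern edge, each edge is
  emitted twice; \<open>decode\<close> collects the edges in a set.\<close>

definition report :: "nat \<Rightarrow> (nat \<times> nat) list \<Rightarrow> com" where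
  "report k es = seqs (map Emit (Const k # map (\<lambda>i. Reg (vreg i)) [0..<k] @
     concat (map (\<lambda>(i, j). [Reg (vreg i), Reg (vreg j)]) es)))"

definition image_graph :: "nat \<Rightarrow> (nat \<times> nat) list \<Rightarrow> (nat \<Rightarrow> nat) \<Rightarrow> nat ugraph" where
  "image_graph k es \<phi> = \<lparr>verts = \<phi> ` {..<k}, edges = (\<lambda>(i, j). {\<phi> i, \<phi> j}) ` set es\<rparr>"

lemma pairs_to_edges_concat:
  "pairs_to_edges (concat (map (\<lambda>(i, j). [\<phi> i, \<phi> j]) es)) = (\<lambda>(i, j). {\<phi> i, \<phi> j}) ` set es"
  by (induction es) auto

lemma report:
  fixes es
  assumes "k < 2 ^ w" "out s = []"
  defines "s' \<equiv> result w (report k es) s"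
  shows "decode (out s') = Some (image_graph k es (assignment s))"
    "same_data s s'" "reg s' = reg s"
proof -
  have s': "s' = s\<lparr>out := k # map (assignment s) [0..<k] @ concat (map (\<lambda>(i, j). [assignment s i, assignment s j]) es)\<rparr>"
    using assms(1,2) unfolding s'_def report_def result_emits
    by (simp add: assignment_def o_def map_concat case_prod_unfold)
  show "decode (out s') = Some (image_graph k es (assignment s))"
    by (simp add: s' image_graph_def pairs_to_edges_concat lessThan_atLeast0)
  show "same_data s s'" "reg s' = reg s" by (simp_all add: s' same_data_def)
qed

lemma straight_report: "straight (report k es)"
  by (auto simp: report_def)

section \<open>The sampling loop\<close>

text \<open>Each failed random trial also tests the next candidate of a deterministic scan, which detects the
  absence of occurrences after as many rounds as there are candidates.\<close>

definition attempt :: "nat \<Rightarrow> (nat \<times> nat) list \<Rightarrow> plan \<Rightarrow> com" where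
  "attempt k es p = Seq (trial k es p)
     (If (Equal (Reg 7) (Const 1)) (Seq (report k es) (Assign 11 (Const 0)))
     (If (Less (Reg 9) (Reg 8))
       (Seq (Assign 4 (Reg 9)) (Seq (trial k es p)
         (Seq (If (Equal (Reg 7) (Const 1)) (Assign 10 (Const 1)) Skip)
           (Assign 9 (Add (Reg 9) (Const 1))))))
       (If (Equal (Reg 10) (Const 0)) (Assign 11 (Const 0)) Skip)))"

definition prepare :: "plan \<Rightarrow> com" where
  "prepare p = Seq (Assign 8 (size_exp p)) (Seq (Assign 9 (Const 0))
     (Seq (Assign 10 (Const 0)) (Assign 11 (Const 1))))"

definition sample :: "nat \<Rightarrow> (nat \<times> nat) list \<Rightarrow> plan \<Rightarrow> com" where
  "sample k es p = Seq (prepare p)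
     (While (Equal (Reg 11) (Const 1)) (Seq (Rand 4 (Reg 8)) (attempt k es p)))"

lemma straight_attempt: "straight (attempt k es p)"
  by (simp add: attempt_def straight_trial straight_report)

lemma straight_prepare: "straight (prepare p)"
  by (simp add: prepare_def)

text \<open>The last two assumptions say that decoding a candidate does not depend on what earlier
  trials left in the vertex registers. Only then is the set of accepted candidates the same in all
  rounds and for the scan.\<close>

locale enumeration =
  fixes w :: nat and s0 :: state and k :: nat and es :: "(nat \<times> nat) list" and p :: plan
  assumes valid: "valid w s0" and size: "plan_size s0 p < 2 ^ w" and k: "k < 2 ^ w"
    and es: "\<And>i j. (i, j) \<in> set es \<Longrightarrow> i < k \<and> j < k"
    and legals_indep: "legals s0 p x \<phi> = legals s0 p x (\<lambda>_. 0)"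
    and fill_indep: "i < k \<Longrightarrow> fill s0 p x \<phi> i = fill s0 p x (\<lambda>_. 0) i"
begin

definition "N = plan_size s0 p"

definition embedding :: "nat \<Rightarrow> nat \<Rightarrow> nat" where
  "embedding x = fill s0 p x (\<lambda>_. 0)"

definition "A = {x. x < N \<and> good s0 k es p (\<lambda>_. 0) x}"

definition "c = 1 + cost (attempt k es p)"

text \<open>Register 10 tells whether the scan has met an accepted candidate below register 9. Once
  register 9 equals \<open>N\<close>, it thus decides whether \<open>A\<close> is empty.\<close>

definition Inv :: "state \<Rightarrow> bool" where
  "Inv s \<longleftrightarrow> same_data s0 s \<and> out s = [] \<and> reg s 8 = N \<and> reg s 9 \<le> N \<and>
     reg s 10 = of_bool (\<exists>x\<in>A. x < reg s 9) \<and> reg s 11 = 1"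

definition next_state :: "state \<Rightarrow> nat \<Rightarrow> state" where
  "next_state s x = result w (attempt k es p) (s\<lparr>reg := (reg s)(4 := x)\<rparr>)"

definition body :: com where
  "body = Seq (Rand 4 (Reg 8)) (attempt k es p)"

lemma one_less: "0 < w"
  using valid_word[OF valid] .

lemma N_pos: "0 < N" using plan_size_pos[OF valid] by (simp add: N_def)

lemma A_subset: "A \<subseteq> {..<N}" by (auto simp: A_def)

lemma embeds_cong:
  assumes "\<And>i. i < k \<Longrightarrow> \<phi> i = \<psi> i"
  shows "embeds s0 k es \<phi> = embeds s0 k es \<psi>" "image_graph k es \<phi> = image_graph k es \<psi>"
proof -
  have "inj_on \<phi> {..<k} = inj_on \<psi> {..<k}" by (intro inj_on_cong) (auto simp: assms)
  moreover have "(\<forall>(i, j)\<in>set es. tab s0 2 (\<phi> i, \<phi> j) = 1) = (\<forall>(i, j)\<in>set es. tab s0 2 (\<psi> i, \<psi> j) = 1)"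
    using es by (intro ball_cong refl) (auto simp: assms split_beta)
  ultimately show "embeds s0 k es \<phi> = embeds s0 k es \<psi>" by (simp add: embeds_def)
  have "(\<lambda>(i, j). {\<phi> i, \<phi> j}) ` set es = (\<lambda>(i, j). {\<psi> i, \<psi> j}) ` set es"
    using es by (intro image_cong refl) (auto simp: assms split_beta)
  moreover have "\<phi> ` {..<k} = \<psi> ` {..<k}" by (intro image_cong) (auto simp: assms)
  ultimately show "image_graph k es \<phi> = image_graph k es \<psi>" by (simp add: image_graph_def)
qed

lemma good_indep: "good s0 k es p \<phi> x = good s0 k es p (\<lambda>_. 0) x"
  unfolding good_def legals_indep[of x \<phi>]
  using embeds_cong(1)[of "fill s0 p x \<phi>" "fill s0 p x (\<lambda>_. 0)"] fill_indep by blast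

lemma trial_result:
  assumes "same_data s0 s" "reg s 4 < N"
  defines "s' \<equiv> result w (trial k es p) s"
  shows "frame s s'" "reg s' 7 = of_bool (reg s 4 \<in> A)"
    "image_graph k es (assignment s') = image_graph k es (embedding (reg s 4))"
proof -
  note sd = same_data_simps[OF assms(1)]
  have t: "valid w s" "plan_size s p < 2 ^ w" "reg s 4 < plan_size s p"
    using assms valid size by (auto simp: sd N_def)
  note T = trial[OF t, of k es, folded s'_def]
  show "frame s s'" by (rule T)
  have "good s k es p = good s0 k es p"
    by (intro ext) (simp add: good_def sd same_data_embeds[OF assms(1)])
  then show "reg s' 7 = of_bool (reg s 4 \<in> A)"
    using T(3) good_indep assms(2) by (auto simp: A_def)
  show "image_graph k es (assignment s') = image_graph k es (embedding (reg s 4))"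
    unfolding T(2) sd embedding_def by (intro embeds_cong fill_indep)
qed

lemma next_state:
  assumes "Inv s" "x < N"
  shows accept: "x \<in> A \<Longrightarrow> same_data s0 (next_state s x) \<and> reg (next_state s x) 11 = 0 \<and>
      decode (out (next_state s x)) = Some (image_graph k es (embedding x))"
    and reject_scan: "x \<notin> A \<Longrightarrow> reg s 9 < N \<Longrightarrow> Inv (next_state s x) \<and> reg (next_state s x) 9 = Suc (reg s 9)"
    and reject_end: "x \<notin> A \<Longrightarrow> reg s 9 = N \<Longrightarrow> A \<noteq> {} \<Longrightarrow> Inv (next_state s x)"
    and stop: "A = {} \<Longrightarrow> reg s 9 = N \<Longrightarrow> same_data s0 (next_state s x) \<and> reg (next_state s x) 11 = 0 \<and> out (next_state s x) = []"
proof -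
  define s1 where "s1 = s\<lparr>reg := (reg s)(4 := x)\<rparr>"
  define s2 where "s2 = result w (trial k es p) s1"
  have s1: "same_data s0 s1" "reg s1 4 < N" "reg s1 4 = x" "out s1 = []" "reg s1 8 = N" "reg s1 9 = reg s 9"
      "reg s1 10 = reg s 10" "reg s1 11 = 1"
    using assms by (auto simp: s1_def Inv_def same_data_def)
  note s2 = trial_result[OF s1(1,2), folded s2_def, unfolded s1(3)]
  have s2': "same_data s0 s2" "out s2 = []" "reg s2 8 = N" "reg s2 9 = reg s 9" "reg s2 10 = reg s 10" "reg s2 11 = 1"
    using s2(1) s1 by (auto simp: frame_def intro: same_data_trans)
  have I: "reg s 10 = of_bool (\<exists>y\<in>A. y < reg s 9)" "reg s 9 \<le> N" using assms by (auto simp: Inv_def)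
  show "same_data s0 (next_state s x) \<and> reg (next_state s x) 11 = 0 \<and>
      decode (out (next_state s x)) = Some (image_graph k es (embedding x))" if "x \<in> A"
  proof -
    have eq: "next_state s x = (let s3 = result w (report k es) s2 in s3\<lparr>reg := (reg s3)(11 := 0)\<rparr>)"
      using that s2(2) one_less
      by (simp add: next_state_def attempt_def s1_def[symmetric] s2_def[symmetric] Let_def)
    show ?thesis using report[OF k s2'(2), of es] s2(3) s2'(1) unfolding eq
      by (auto simp: Let_def same_data_def)
  qed
  show "Inv (next_state s x) \<and> reg (next_state s x) 9 = Suc (reg s 9)" if nA: "x \<notin> A" and lt: "reg s 9 < N"
  proof -
    define s3 where "s3 = s2\<lparr>reg := (reg s2)(4 := reg s 9)\<rparr>"
    define s4 where "s4 = result w (trial k es p) s3"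
    have s3: "same_data s0 s3" "reg s3 4 < N" "reg s3 4 = reg s 9" "out s3 = []" "reg s3 8 = N" "reg s3 9 = reg s 9"
        "reg s3 10 = reg s 10" "reg s3 11 = 1"
      using s2' lt by (auto simp: s3_def Inv_def same_data_def)
    note s4 = trial_result[OF s3(1,2), folded s4_def, unfolded s3(3)]
    have s4': "same_data s0 s4" "out s4 = []" "reg s4 8 = N" "reg s4 9 = reg s 9" "reg s4 10 = reg s 10" "reg s4 11 = 1"
      using s4(1) s3 by (auto simp: frame_def intro: same_data_trans)
    have small: "Suc (reg s 9) < 2 ^ w" using lt size by (simp add: N_def)
    have eq: "next_state s x = s4\<lparr>reg := (reg s4)(10 := (if reg s 9 \<in> A then 1 else reg s 10), 9 := Suc (reg s 9))\<rparr>"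
      using nA s2(2) one_less s2' lt s4(2) s4' small
      by (auto simp: next_state_def attempt_def s1_def[symmetric] s2_def[symmetric] s3_def[symmetric] s4_def[symmetric] fun_eq_iff intro!: state.equality)
    have "(\<exists>y\<in>A. y < Suc (reg s 9)) \<longleftrightarrow> reg s 9 \<in> A \<or> (\<exists>y\<in>A. y < reg s 9)"
      by (auto simp: less_Suc_eq)
    then show ?thesis using s4' lt I unfolding eq Inv_def
      by (auto simp: same_data_def)
  qed
  show "Inv (next_state s x)" if nA: "x \<notin> A" and e: "reg s 9 = N" and ne: "A \<noteq> {}"
  proof -
    \<comment> \<open>A completed scan has met every element of \<open>A\<close>, so the random
      search continues instead of reporting that there is no occurrence.\<close>
    have "reg s 10 = 1" using I(1) e ne A_subset by auto
    then have "next_state s x = s2"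
      using nA s2(2) one_less s2' e
      by (simp add: next_state_def attempt_def s1_def[symmetric] s2_def[symmetric])
    then show ?thesis using s2' I by (simp add: Inv_def)
  qed
  show "same_data s0 (next_state s x) \<and> reg (next_state s x) 11 = 0 \<and> out (next_state s x) = []"
    if emp: "A = {}" and e: "reg s 9 = N"
  proof -
    have "reg s 10 = 0" using I(1) emp by auto
    then have "next_state s x = s2\<lparr>reg := (reg s2)(11 := 0)\<rparr>"
      using emp s2(2) one_less s2' e
      by (simp add: next_state_def attempt_def s1_def[symmetric] s2_def[symmetric])
    then show ?thesis using s2' by (simp add: same_data_def)
  qed
qed

abbreviation "guard \<equiv> bval w (Equal (Reg 11) (Const 1))"

lemma guard: "guard s \<longleftrightarrow> reg s 11 = 1"
  using one_less by simp

lemma exec_body: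
  assumes "Inv s"
  shows "\<exists>T. (\<forall>x. T x \<le> c) \<and>
    exec w body s = map_spmf (\<lambda>x. (next_state s x, T x)) (spmf_of_set {..<N})"
proof -
  obtain T where T: "\<And>s. T s \<le> cost (attempt k es p)"
      "\<And>s. exec w (attempt k es p) s = return_spmf (result w (attempt k es p) s, T s)"
    using exec_straight[OF straight_attempt[of k es p], of w] by metis
  have "exec w body s = map_spmf (\<lambda>x. (next_state s x, 1 + T (s\<lparr>reg := (reg s)(4 := x)\<rparr>))) (spmf_of_set {..<N})"
    using assms N_pos by (simp add: body_def Inv_def bind_map_spmf o_def T(2) next_state_def map_spmf_conv_bind_spmf)
  then show ?thesis using T(1) by (intro exI[of _ "\<lambda>x. 1 + T (s\<lparr>reg := (reg s)(4 := x)\<rparr>)"]) (auto simp: c_def)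
qed

text \<open>Every round now advances the scan by one, and one more round notices that it is
  complete. The number of rounds is therefore the same in all runs, and the time bound holds
  surely.\<close>

lemma exhausted_loop:
  assumes "A = {}" "Inv s"
  shows "\<exists>M. while_spmf guard (exec w body) s = spmf_of_pmf M \<and>
    (\<forall>r\<in>set_pmf M. same_data s0 (fst r) \<and> out (fst r) = [] \<and> snd r \<le> (N - reg s 9 + 1) * (c + 1) + 1)"
  using assms(2)
proof (induction "N - reg s 9" arbitrary: s rule: less_induct)
  case less
  obtain T where T: "\<forall>x. T x \<le> c" "exec w body s = map_spmf (\<lambda>x. (next_state s x, T x)) (spmf_of_set {..<N})"
    using exec_body[OF less.prems] by blast
  have le: "reg s 9 \<le> N" and g: "guard s" using less.prems guard[of s] by (auto simp: Inv_def simp del: bval.simps)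
  have "\<exists>M. while_spmf guard (exec w body) (next_state s x) = spmf_of_pmf M \<and>
    (\<forall>r\<in>set_pmf M. same_data s0 (fst r) \<and> out (fst r) = [] \<and> snd r \<le> (N - reg s 9) * (c + 1) + 1)" if x: "x < N" for x
  proof (cases "reg s 9 < N")
    case True
    have n: "Inv (next_state s x)" "reg (next_state s x) 9 = Suc (reg s 9)"
      using reject_scan[OF less.prems x _ True] assms by auto
    have "N - Suc (reg s 9) + 1 = N - reg s 9" using True by simp
    then show ?thesis using less.hyps[of "next_state s x"] n True by (metis diff_less_mono2 lessI)
  next
    case False
    then have "same_data s0 (next_state s x)" "reg (next_state s x) 11 = 0" "out (next_state s x) = []"
      using stop[OF less.prems x assms(1)] le by auto
    then show ?thesis using guard[of "next_state s x"]
      by (intro exI[of _ "return_pmf (next_state s x, 1)"]) (subst while_spmf.simps, auto simp del: bval.simps)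
  qed
  then obtain L where L: "\<And>x. x < N \<Longrightarrow> while_spmf guard (exec w body) (next_state s x) = spmf_of_pmf (L x)"
      "\<And>x r. x < N \<Longrightarrow> r \<in> set_pmf (L x) \<Longrightarrow>
        same_data s0 (fst r) \<and> out (fst r) = [] \<and> snd r \<le> (N - reg s 9) * (c + 1) + 1"
    by metis
  define R where "R = bind_pmf (pmf_of_set {..<N}) (\<lambda>x. map_pmf (\<lambda>(s', t). (s', 1 + T x + t)) (L x))"
  have fin: "set_pmf (pmf_of_set {..<N}) = {..<N}" using N_pos by (intro set_pmf_of_set) auto
  have "while_spmf guard (exec w body) s = bind_pmf (pmf_of_set {..<N})
      (\<lambda>x. map_spmf (\<lambda>(s', t). (s', 1 + T x + t)) (while_spmf guard (exec w body) (next_state s x)))"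
    by (rule while_spmf_random[where b = guard and f = "exec w body" and S = "next_state s" and T = T, OF g T(2) N_pos])
  also have "\<dots> = spmf_of_pmf R"
    unfolding R_def spmf_of_pmf_bind
  proof (rule bind_pmf_cong[OF refl])
    fix x assume "x \<in> set_pmf (pmf_of_set {..<N})"
    then have "x < N" by (simp add: fin)
    then show "map_spmf (\<lambda>(s', t). (s', 1 + T x + t)) (while_spmf guard (exec w body) (next_state s x)) =
        spmf_of_pmf (map_pmf (\<lambda>(s', t). (s', 1 + T x + t)) (L x))"
      by (simp only: L(1) map_spmf_of_pmf)
  qed
  finally have "while_spmf guard (exec w body) s = spmf_of_pmf R" .
  moreover have "same_data s0 (fst r) \<and> out (fst r) = [] \<and> snd r \<le> (N - reg s 9 + 1) * (c + 1) + 1"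
    if r: "r \<in> set_pmf R" for r
  proof -
    obtain x y where x: "x < N" "y \<in> set_pmf (L x)" "r = (fst y, 1 + T x + snd y)"
      using r unfolding R_def by (auto simp: fin)
    show ?thesis using L(2)[OF x(1,2)] T(1)[rule_format, of x] by (simp add: x(3))
  qed
  ultimately show ?case by blast
qed

definition "answer_pmf = (if A = {} then return_pmf None
  else map_pmf (\<lambda>x. Some (image_graph k es (embedding x))) (pmf_of_set A))"

lemma loop:
  assumes "Inv s" "reg s 9 = 0"
  shows "\<exists>M. while_spmf guard (exec w body) s = spmf_of_pmf M \<and> (\<forall>r\<in>set_pmf M. same_data s0 (fst r)) \<and>
    map_pmf (\<lambda>r. decode (out (fst r))) M = answer_pmf \<and>
    (\<integral>\<^sup>+r. of_nat (snd r) \<partial>measure_pmf M) \<le> ennreal ((2 * c + 3) * (N / max 1 (card A)))"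
proof (cases "A = {}")
  case True
  obtain M where M: "while_spmf guard (exec w body) s = spmf_of_pmf M"
    "\<And>r. r \<in> set_pmf M \<Longrightarrow> same_data s0 (fst r) \<and> out (fst r) = [] \<and> snd r \<le> (N + 1) * (c + 1) + 1"
    using exhausted_loop[OF True assms(1)] assms(2) by auto
  have "map_pmf (\<lambda>r. decode (out (fst r))) M = map_pmf (\<lambda>r. None) M"
    using M(2) by (intro map_pmf_cong refl) auto
  then have dist: "map_pmf (\<lambda>r. decode (out (fst r))) M = answer_pmf"
    using True by (simp add: answer_pmf_def)
  \<comment> \<open>This is the origin of the constant 2 c + 3, which also dominates the c + 2 of
    the case with accepted candidates.\<close>
  have "(N + 1) * (c + 1) + 1 \<le> 2 * N * (c + 1) + N"
    using N_pos by (intro add_mono mult_right_mono) auto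
  also have "\<dots> = (2 * c + 3) * N" by (simp add: algebra_simps)
  finally have b: "(N + 1) * (c + 1) + 1 \<le> (2 * c + 3) * N" .
  have "(\<integral>\<^sup>+r. of_nat (snd r) \<partial>measure_pmf M) \<le> (\<integral>\<^sup>+r. of_nat ((2 * c + 3) * N) \<partial>measure_pmf M)"
    using M(2) b by (intro nn_integral_mono_AE) (fastforce simp: AE_measure_pmf_iff simp del: of_nat_mult of_nat_add)
  also have "\<dots> = of_nat ((2 * c + 3) * N)" by simp
  also have "\<dots> = ennreal ((2 * c + 3) * (N / max 1 (card A)))"
    using True by (simp add: ennreal_of_nat_eq_real_of_nat del: of_nat_mult of_nat_add) simp
  finally show ?thesis using M dist by blast
next
  case False
  interpret rejection_loop guard "exec w body" next_state Inv
    "\<lambda>s'. same_data s0 s'" "\<lambda>s'. decode (out s')" N c A "\<lambda>x. Some (image_graph k es (embedding x))"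
  proof unfold_locales
    show "A \<subseteq> {..<N}" by (rule A_subset)
    show "A \<noteq> {}" by (rule False)
    show "guard s" if "Inv s" for s using that guard[of s] by (simp add: Inv_def del: bval.simps)
    show "\<exists>T. (\<forall>x. T x \<le> c) \<and> exec w body s = map_spmf (\<lambda>x. (next_state s x, T x)) (spmf_of_set {..<N})"
      if "Inv s" for s using exec_body[OF that] .
    show "\<not> guard (next_state s x) \<and> same_data s0 (next_state s x) \<and>
      decode (out (next_state s x)) = Some (image_graph k es (embedding x))" if "Inv s" "x \<in> A" for s x
      using that accept[of s x] A_subset guard[of "next_state s x"] by (auto simp del: bval.simps)
    show "Inv (next_state s x)" if "Inv s" "x < N" "x \<notin> A" for s x
      using reject_scan[OF that] reject_end[OF that _ False] that(1) by (auto simp: Inv_def le_less)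
  qed
  have pos: "card A > 0" by (rule card_A)
  obtain M where M: "while_spmf guard (exec w body) s = spmf_of_pmf M" "\<forall>r\<in>set_pmf M. same_data s0 (fst r)"
    "map_pmf (\<lambda>r. decode (out (fst r))) M = map_pmf (\<lambda>x. Some (image_graph k es (embedding x))) (pmf_of_set A)"
    "(\<integral>\<^sup>+r. of_nat (snd r) \<partial>measure_pmf M) \<le> ennreal ((c + 2) * N / card A)"
    using rejection_loop[OF assms(1)] by blast
  note M(4)
  also have "ennreal ((c + 2) * N / card A) \<le> ennreal ((2 * c + 3) * (N / max 1 (card A)))"
    using pos by (intro ennreal_leI) (simp add: max_def divide_simps algebra_simps)
  finally show ?thesis using M(1-3) False by (auto simp: answer_pmf_def)
qed

lemma sample_answers:
  "answers w (sample k es p) (same_data s0) answer_pmf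
    ((cost (prepare p) + 2 * c + 3) * (N / max 1 (card A)))"
  unfolding answers_def
proof (intro allI impI)
  fix s assume sd: "same_data s0 s"
  define s1 where "s1 = result w (prepare p) (s\<lparr>out := []\<rparr>)"
  obtain t where t: "t \<le> cost (prepare p)" "exec w (prepare p) (s\<lparr>out := []\<rparr>) = return_spmf (s1, t)"
    using exec_straight[OF straight_prepare[of p]] unfolding s1_def by blast
  have sd': "same_data s0 (s\<lparr>out := []\<rparr>)" using sd by (simp add: same_data_def)
  have "aval w (size_exp p) s = N"
    using aval_size_exp[of w s p] valid size by (simp add: same_data_simps[OF sd] N_def)
  then have s1: "Inv s1" "reg s1 9 = 0"
    using sd one_less by (auto simp: s1_def prepare_def Inv_def same_data_def)
  obtain M where M: "while_spmf guard (exec w body) s1 = spmf_of_pmf M" "\<forall>r\<in>set_pmf M. same_data s0 (fst r)"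
    "map_pmf (\<lambda>r. decode (out (fst r))) M = answer_pmf"
    "(\<integral>\<^sup>+r. of_nat (snd r) \<partial>measure_pmf M) \<le> ennreal ((2 * c + 3) * (N / max 1 (card A)))"
    using loop[OF s1] by blast
  define R where "R = map_pmf (\<lambda>r. (fst r, t + snd r)) M"
  have "exec w (sample k es p) (s\<lparr>out := []\<rparr>) = spmf_of_pmf R"
    using t(2) M(1)
    by (simp add: sample_def body_def[symmetric] R_def case_prod_unfold map_pmf_def spmf_of_pmf_bind del: bval.simps)
  moreover have "\<forall>r\<in>set_pmf R. same_data s0 (fst r)" using M(2) by (auto simp: R_def)
  moreover have "map_pmf (\<lambda>r. decode (out (fst r))) R = answer_pmf"
    using M(3) by (simp add: R_def pmf.map_comp o_def)
  moreover have "(\<integral>\<^sup>+r. of_nat (snd r) \<partial>measure_pmf R) \<le> ennreal ((cost (prepare p) + 2 * c + 3) * (N / max 1 (card A)))"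
  proof -
    \<comment> \<open>The quotient of \<open>N\<close> by this maximum is at least 1, so the cost of
      \<open>prepare\<close> can be absorbed as a factor.\<close>
    have cN: "max 1 (card A) \<le> N" using N_pos A_subset card_mono[of "{..<N}" A] by auto
    then have N1: "1 \<le> real N / real (max 1 (card A))" by (simp add: le_divide_eq)
    have "(\<integral>\<^sup>+r. of_nat (snd r) \<partial>measure_pmf R) = of_nat t + (\<integral>\<^sup>+r. of_nat (snd r) \<partial>measure_pmf M)"
      by (simp add: R_def nn_integral_add)
    also have "\<dots> \<le> ennreal (cost (prepare p)) + ennreal ((2 * c + 3) * (N / max 1 (card A)))"
      using t(1) M(4) by (intro add_mono) (auto simp: ennreal_of_nat_eq_real_of_nat)
    also have "\<dots> = ennreal (cost (prepare p) + (2 * c + 3) * (N / max 1 (card A)))"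
      by (intro ennreal_plus[symmetric]) auto
    also have "\<dots> \<le> ennreal ((cost (prepare p) + 2 * c + 3) * (N / max 1 (card A)))"
      using mult_left_mono[OF N1, of "real (cost (prepare p))"]
      by (intro ennreal_leI) (simp add: algebra_simps add_divide_distrib)
    finally show ?thesis .
  qed
  ultimately show "\<exists>M. exec w (sample k es p) (s\<lparr>out := []\<rparr>) = spmf_of_pmf M \<and>
      (\<forall>r\<in>set_pmf M. same_data s0 (fst r)) \<and> map_pmf (\<lambda>r. decode (out (fst r))) M = answer_pmf \<and>
      (\<integral>\<^sup>+r. of_nat (snd r) \<partial>measure_pmf M) \<le> ennreal ((cost (prepare p) + 2 * c + 3) * (N / max 1 (card A)))"
    by blast
qed

end

section \<open>Preprocessing\<close>

text \<open>Stated for an arbitrary set \<open>E\<close> of oriented edges, so that it can serve as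
  the invariant while arcs are inserted one by one. Heaviness refers to the degrees counted so
  far.\<close>

definition tables :: "(nat \<times> nat) set \<Rightarrow> state \<Rightarrow> bool" where
  "tables E s \<longleftrightarrow>
     (\<forall>u. bij_betw (\<lambda>j. tab s 1 (u, j)) {..<tab s 0 (u, 0)} (E `` {u})) \<and>
     (\<forall>u v. tab s 2 (u, v) = of_bool ((u, v) \<in> E)) \<and>
     bij_betw (\<lambda>j. tab s 3 (0, j)) {..<reg s 3} {u. reg s 2 < tab s 0 (u, 0)}"

definition indexed :: "(nat \<times> nat) set \<Rightarrow> state \<Rightarrow> bool" where
  "indexed E s \<longleftrightarrow> tables E s \<and> bij_betw (\<lambda>d. (mem s d, mem s (flip d))) {..<2 * reg s 0} E"

lemma bij_betw_snoc:
  assumes "bij_betw f {..<n} B" "y \<notin> B" "\<And>j. j < n \<Longrightarrow> g j = f j" "g n = y"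
  shows "bij_betw g {..<Suc n} (insert y B)"
proof -
  have "bij_betw g {..<n} B" using assms(1,3) by (subst bij_betw_cong[where g = f]) auto
  then show ?thesis unfolding lessThan_Suc
    using assms(2,4) by (metis lessThan_iff less_irrefl notIn_Un_bij_betw Un_insert_right sup_bot_right)
qed

text \<open>A vertex enters the heavy list exactly once, at the arc that raises its degree from the
  threshold to the threshold plus 1. The old degree, held in register 7, is at the same time the
  index of the new neighbour.\<close>

definition insert_arc :: com where
  "insert_arc = seqs [Load 5 (Reg 4), Load 6 (flip_exp 4), Lookup 7 0 (Reg 5) (Const 0),
     Update 1 (Reg 5) (Reg 7) (Reg 6), Update 2 (Reg 5) (Reg 6) (Const 1),
     If (Equal (Reg 7) (Reg 2)) (Seq (Update 3 (Const 0) (Reg 3) (Reg 5)) (Assign 3 (Add (Reg 3) (Const 1)))) Skip,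
     Update 0 (Reg 5) (Const 0) (Add (Reg 7) (Const 1)),
     Assign 4 (Add (Reg 4) (Const 1))]"

text \<open>These bounds keep the degree counters and the length of the heavy list from wrapping.
  Every heavy vertex is the source of some arc, hence the second one.\<close>

lemma tables_bounds:
  assumes "tables E s" "finite E"
  shows "tab s 0 (u, 0) \<le> card E" "reg s 3 \<le> card E"
proof -
  have deg: "tab s 0 (u, 0) = card (E `` {u})" for u
    using assms(1) bij_betw_same_card[of _ "{..<tab s 0 (u, 0)}"] by (fastforce simp: tables_def)
  have "card (Pair u ` (E `` {u})) \<le> card E" using assms(2) by (intro card_mono) auto
  then show "tab s 0 (u, 0) \<le> card E" unfolding deg by (simp add: card_image inj_on_def)
  have "reg s 3 = card {u. reg s 2 < tab s 0 (u, 0)}"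
    using assms(1) bij_betw_same_card[of _ "{..<reg s 3}"] by (fastforce simp: tables_def)
  also have "\<dots> \<le> card (fst ` E)"
  proof (rule card_mono)
    show "{u. reg s 2 < tab s 0 (u, 0)} \<subseteq> fst ` E"
    proof
      fix u assume "u \<in> {u. reg s 2 < tab s 0 (u, 0)}"
      then have "E `` {u} \<noteq> {}" using deg[of u] by (metis card.empty mem_Collect_eq not_less0)
      then show "u \<in> fst ` E" by force
    qed
  qed (use assms(2) in simp)
  also have "\<dots> \<le> card E" using assms(2) by (rule card_image_le)
  finally show "reg s 3 \<le> card E" .
qed

lemma insert_arc:
  assumes T: "tables E s" "finite E" "(mem s (reg s 4), mem s (flip (reg s 4))) \<notin> E" "card E < 2 * m"
    and w: "reg s 4 < 2 * m" "4 * m \<le> 2 ^ w"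
  defines "s' \<equiv> result w insert_arc s"
  shows "tables (insert (mem s (reg s 4), mem s (flip (reg s 4))) E) s'"
    "mem s' = mem s" "reg s' 0 = reg s 0" "reg s' 1 = reg s 1" "reg s' 2 = reg s 2" "reg s' 4 = Suc (reg s 4)"
proof -
  define u v where uv: "u = mem s (reg s 4)" "v = mem s (flip (reg s 4))"
  define d where "d = tab s 0 (u, 0)"
  note b = tables_bounds[OF T(1,2)]
  have w': "0 < w" using w by (cases w) auto
  have small: "Suc d < 2 ^ w" "Suc (reg s 3) < 2 ^ w" "Suc (reg s 4) < 2 ^ w"
    using b(1)[of u] b(2) T(4) w by (auto simp: d_def)
  have fl: "aval w (flip_exp 4) (s\<lparr>reg := (reg s)(5 := u)\<rparr>) = flip (reg s 4)"
    using w by (subst aval_flip_exp[where m = m]) auto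
  have s': "mem s' = mem s" "reg s' 0 = reg s 0" "reg s' 1 = reg s 1" "reg s' 2 = reg s 2" "reg s' 4 = Suc (reg s 4)"
    "reg s' 3 = (if d = reg s 2 then Suc (reg s 3) else reg s 3)"
    "tab s' 0 = (tab s 0)((u, 0) := Suc d)" "tab s' 1 = (tab s 1)((u, d) := v)" "tab s' 2 = (tab s 2)((u, v) := 1)"
    "tab s' 3 = (if d = reg s 2 then (tab s 3)((0, reg s 3) := u) else tab s 3)"
    using small w' fl by (simp_all add: s'_def insert_arc_def uv[symmetric] d_def[symmetric])
  show "mem s' = mem s" "reg s' 0 = reg s 0" "reg s' 1 = reg s 1" "reg s' 2 = reg s 2" "reg s' 4 = Suc (reg s 4)"
    by (fact s')+
  have "bij_betw (\<lambda>j. tab s' 1 (x, j)) {..<tab s' 0 (x, 0)} (insert (u, v) E `` {x})" for x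
  proof (cases "x = u")
    case True
    have "bij_betw (\<lambda>j. tab s' 1 (u, j)) {..<Suc d} (insert v (E `` {u}))"
      using T(1,3) by (intro bij_betw_snoc[where f = "\<lambda>j. tab s 1 (u, j)"]) (auto simp: tables_def d_def s' uv simp del: One_nat_def)
    moreover have "insert (u, v) E `` {u} = insert v (E `` {u})" by auto
    ultimately show ?thesis using True by (simp add: s')
  next
    case False
    then have "insert (u, v) E `` {x} = E `` {x}" by auto
    then show ?thesis using T(1) False by (simp add: tables_def s' del: One_nat_def)
  qed
  moreover have "tab s' 2 (x, y) = of_bool ((x, y) \<in> insert (u, v) E)" for x y
    using T(1) by (simp add: tables_def s')
  moreover have "bij_betw (\<lambda>j. tab s' 3 (0, j)) {..<reg s' 3} {x. reg s' 2 < tab s' 0 (x, 0)}"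
  proof (cases "d = reg s 2")
    case True
    then have "{x. reg s' 2 < tab s' 0 (x, 0)} = insert u {x. reg s 2 < tab s 0 (x, 0)}"
      by (auto simp: s')
    then show ?thesis using T(1) True
      by (simp add: s') (intro bij_betw_snoc[where f = "\<lambda>j. tab s 3 (0, j)"], auto simp: tables_def d_def)
  next
    case False
    then have "{x. reg s' 2 < tab s' 0 (x, 0)} = {x. reg s 2 < tab s 0 (x, 0)}"
      by (auto simp: s' d_def)
    then show ?thesis using T(1) False by (simp add: s' tables_def)
  qed
  ultimately show "tables (insert (mem s (reg s 4), mem s (flip (reg s 4))) E) s'"
    by (simp add: tables_def uv[symmetric])
qed

text \<open>The threshold is found by linear search, which takes O(sqrt m) rounds and so stays
  within linear time. Both loops count from the value 0 that registers 2 and 4 have in the input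
  state.\<close>

definition preprocess :: com where
  "preprocess = Seq (While (Less (Mul (Reg 2) (Reg 2)) (Reg 0)) (Assign 2 (Add (Reg 2) (Const 1))))
     (While (Less (Reg 4) (Mul (Const 2) (Reg 0))) insert_arc)"

definition arcs :: "nat ugraph \<Rightarrow> (nat \<times> nat) set" where
  "arcs G = {(u, v). {u, v} \<in> edges G}"

lemma edge_list_length: "edge_list G es \<Longrightarrow> length es = card (edges G)"
  unfolding edge_list_def by (metis distinct_card length_map)

text \<open>Even cells start an arc in the listed orientation, odd cells in the reverse one. Equal
  arcs have the same underlying edge, hence the same position in the list, and then the same parity
  because an edge without loop differs from its reversal.\<close>

lemma input_arcs:
  assumes "simple_graph G" "edge_list G es"
  shows "bij_betw (\<lambda>d. (mem (input_state es l) d, mem (input_state es l) (flip d))) {..<2 * length es} (arcs G)"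
proof -
  define arc where "arc d = (if even d then es ! (d div 2) else prod.swap (es ! (d div 2)))" for d
  have arc: "(mem (input_state es l) d, mem (input_state es l) (flip d)) = arc d" if "d < 2 * length es" for d
  proof (cases "even d")
    case True
    then obtain i where "d = 2 * i" by (elim evenE)
    then show ?thesis using that by (simp add: input_state_def arc_def flip_def)
  next
    case False
    then obtain i where "d = 2 * i + 1" by (elim oddE)
    then show ?thesis using that by (simp add: input_state_def arc_def flip_def prod_eq_iff)
  qed
  have edge: "{fst (es ! i), snd (es ! i)} \<in> edges G" if "i < length es" for i
  proof -
    have "(\<lambda>(u, v). {u, v}) (es ! i) \<in> (\<lambda>(u, v). {u, v}) ` set es" using that by simp
    then show ?thesis using assms(2) by (auto simp: edge_list_def split_beta)
  qed
  have loopless: "fst (es ! i) \<noteq> snd (es ! i)" if "i < length es" for i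
    using edge[OF that] assms(1) unfolding simple_graph_def by (metis doubleton_eq_iff)
  have dist: "distinct (map (\<lambda>(u, v). {u, v}) es)" using assms(2) by (simp add: edge_list_def)
  have "inj_on arc {..<2 * length es}"
  proof (rule inj_onI)
    fix d d' assume d: "d \<in> {..<2 * length es}" "d' \<in> {..<2 * length es}" "arc d = arc d'"
    have lt: "d div 2 < length es" "d' div 2 < length es" using d by auto
    have "{fst (arc d), snd (arc d)} = map (\<lambda>(u, v). {u, v}) es ! (d div 2)"
      "{fst (arc d'), snd (arc d')} = map (\<lambda>(u, v). {u, v}) es ! (d' div 2)"
      using lt by (auto simp: arc_def split_beta)
    then have eq: "d div 2 = d' div 2" using dist lt d(3) by (metis length_map nth_eq_iff_index_eq)
    moreover have "even d = even d'"
      using d(3) eq loopless[OF lt(1)] by (auto simp: arc_def prod_eq_iff split: if_splits)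
    ultimately show "d = d'" by (metis even_two_times_div_two odd_two_times_div_two_succ)
  qed
  moreover have "arc ` {..<2 * length es} = arcs G"
  proof
    show "arc ` {..<2 * length es} \<subseteq> arcs G"
    proof
      fix a assume "a \<in> arc ` {..<2 * length es}"
      then obtain d where d: "d < 2 * length es" "a = arc d" by auto
      then have "d div 2 < length es" by auto
      from edge[OF this] show "a \<in> arcs G" by (auto simp: d(2) arc_def arcs_def insert_commute split_beta)
    qed
    show "arcs G \<subseteq> arc ` {..<2 * length es}"
    proof
      fix a assume "a \<in> arcs G"
      then have "{fst a, snd a} \<in> (\<lambda>(u, v). {u, v}) ` set es" using assms(2) by (auto simp: arcs_def edge_list_def)
      then obtain x where "x \<in> set es" "{fst a, snd a} = {fst x, snd x}" by auto
      then obtain i where i: "i < length es" "{fst a, snd a} = {fst (es ! i), snd (es ! i)}" by (metis in_set_conv_nth)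
      have "a = arc (2 * i) \<or> a = arc (2 * i + 1)"
        using i(2) by (auto simp: arc_def doubleton_eq_iff prod_eq_iff)
      then show "a \<in> arc ` {..<2 * length es}" using i(1) by auto
    qed
  qed
  ultimately have "bij_betw arc {..<2 * length es} (arcs G)" by (simp add: bij_betw_def)
  then show ?thesis by (subst bij_betw_cong[where g = arc]) (auto simp: arc)
qed

lemma preprocess:
  fixes es :: "(nat \<times> nat) list" and l :: nat
  assumes G: "simple_graph G" "edge_list G es" and m: "m = card (edges G)" "1 \<le> m"
    and w: "4 * m \<le> 2 ^ w" "m * m < 2 ^ w"
  shows "\<exists>s t. exec w preprocess (input_state es l) = return_spmf (s, t) \<and>
    t \<le> (6 + 2 * cost insert_arc) * m \<and> indexed (arcs G) s \<and> reg s 0 = m \<and> reg s 1 = l \<and>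
    m \<le> reg s 2 * reg s 2 \<and> (reg s 2 - 1) * (reg s 2 - 1) < m \<and> 1 \<le> reg s 2 \<and> reg s 2 \<le> m"
proof -
  define s0 where "s0 = input_state es l"
  have len: "length es = m" using edge_list_length[OF G(2)] m(1) by simp
  have s0: "reg s0 0 = m" "reg s0 1 = l" "reg s0 2 = 0" "reg s0 3 = 0" "reg s0 4 = 0" "tab s0 = (\<lambda>_ _. 0)"
    by (auto simp: s0_def input_state_def len)
  have w0: "0 < w" using w m(2) by (cases w) auto
  define S where "S = (LEAST n. m \<le> n * n)"
  have S: "m \<le> S * S" unfolding S_def by (rule LeastI[of _ m]) simp
  have less: "i * i < m" if "i < S" for i using not_less_Least[of i "\<lambda>n. m \<le> n * n"] that by (simp add: S_def)
  have S_le: "S \<le> m" unfolding S_def by (rule Least_le) simp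
  have S_pos: "1 \<le> S" using S m(2) by (cases S) auto
  define I1 where "I1 i s \<longleftrightarrow> s = s0\<lparr>reg := (reg s0)(2 := i)\<rparr>" for i s
  have "\<exists>s1 t1. exec w (While (Less (Mul (Reg 2) (Reg 2)) (Reg 0)) (Assign 2 (Add (Reg 2) (Const 1)))) s0 = return_spmf (s1, t1)
      \<and> I1 S s1 \<and> t1 \<le> (S - 0) * (1 + cost (Assign 2 (Add (Reg 2) (Const 1)))) + 1"
  proof (rule exec_while_straight)
    show "I1 0 s0" using s0(3) by (auto simp: I1_def fun_upd_idem)
    fix i s assume i: "i < S" "I1 i s"
    have "Suc i \<le> S" "Suc i < 2 ^ w" "i * i < 2 ^ w" using i(1) S_le w less[OF i(1)] m(2) by auto
    then show "bval w (Less (Mul (Reg 2) (Reg 2)) (Reg 0)) s \<and> I1 (Suc i) (result w (Assign 2 (Add (Reg 2) (Const 1))) s)"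
      using i less[OF i(1)] w0 by (auto simp: I1_def s0)
  next
    fix s assume "I1 S s"
    \<comment> \<open>The last test squares \<open>S\<close>, which is at most m; hence m * m has to
      fit in a word.\<close>
    moreover have "S * S < 2 ^ w" using mult_le_mono[OF S_le S_le] w(2) by simp
    ultimately show "\<not> bval w (Less (Mul (Reg 2) (Reg 2)) (Reg 0)) s"
      using S by (auto simp: I1_def s0)
  qed auto
  then obtain s1 t1 where s1: "exec w (While (Less (Mul (Reg 2) (Reg 2)) (Reg 0)) (Assign 2 (Add (Reg 2) (Const 1)))) s0 = return_spmf (s1, t1)"
      "I1 S s1" "t1 \<le> 2 * S + 1" by auto
  define arc where "arc d = (mem s0 d, mem s0 (flip d))" for d
  have arc: "bij_betw arc {..<2 * m} (arcs G)"
    using input_arcs[OF G, of l] unfolding arc_def s0_def len .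
  define I2 where "I2 d s \<longleftrightarrow> tables (arc ` {..<d}) s \<and> mem s = mem s0 \<and> reg s 0 = m \<and> reg s 1 = l \<and>
      reg s 2 = S \<and> reg s 4 = d \<and> d \<le> 2 * m" for d s
  have two: "2 mod 2 ^ w * m mod 2 ^ w = 2 * m"
  proof -
    have "2 < (2::nat) ^ w" "2 * m < 2 ^ w" using w m(2) by auto
    then show ?thesis by simp
  qed
  have "\<exists>s2 t2. exec w (While (Less (Reg 4) (Mul (Const 2) (Reg 0))) insert_arc) s1 = return_spmf (s2, t2)
      \<and> I2 (2 * m) s2 \<and> t2 \<le> (2 * m - 0) * (1 + cost insert_arc) + 1"
  proof (rule exec_while_straight)
    show "straight insert_arc" by (simp add: insert_arc_def)
    show "I2 0 s1" using s1(2) by (auto simp: I1_def I2_def s0 tables_def bij_betw_def simp del: One_nat_def)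
    fix d s assume d: "d < 2 * m" "I2 d s"
    have inj: "inj_on arc {..<2 * m}" using arc by (simp add: bij_betw_def)
    \<comment> \<open>Inserting an arc requires that it be new, which injectivity of the enumeration
      provides.\<close>
    have "arc d \<notin> arc ` {..<d}" using inj d(1) by (auto dest!: inj_onD)
    moreover have "card (arc ` {..<d}) < 2 * m" using d(1) card_image_le[of "{..<d}" arc] by simp
    ultimately have T: "tables (arc ` {..<d}) s" "finite (arc ` {..<d})" "(mem s (reg s 4), mem s (flip (reg s 4))) \<notin> arc ` {..<d}"
        "card (arc ` {..<d}) < 2 * m" "reg s 4 < 2 * m"
      using d by (auto simp: I2_def arc_def)
    have "I2 (Suc d) (result w insert_arc s)"
      using insert_arc[OF T w(1)] d by (auto simp: I2_def lessThan_Suc arc_def)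
    then show "bval w (Less (Reg 4) (Mul (Const 2) (Reg 0))) s \<and> I2 (Suc d) (result w insert_arc s)"
      using d two by (simp add: I2_def)
  next
    fix s assume "I2 (2 * m) s"
    then show "\<not> bval w (Less (Reg 4) (Mul (Const 2) (Reg 0))) s" using two by (simp add: I2_def)
  qed auto
  then obtain s2 t2 where s2: "exec w (While (Less (Reg 4) (Mul (Const 2) (Reg 0))) insert_arc) s1 = return_spmf (s2, t2)"
      "I2 (2 * m) s2" "t2 \<le> 2 * m * (1 + cost insert_arc) + 1" by auto
  have "exec w preprocess s0 = return_spmf (s2, t1 + t2)"
    using s1(1) s2(1) by (simp add: preprocess_def del: exec.simps(11))
  moreover have "t1 + t2 \<le> (6 + 2 * cost insert_arc) * m"
  proof -
    have "t1 + t2 \<le> 2 * m + 1 + (2 * m * (1 + cost insert_arc) + 1)" using s1(3) s2(3) S_le by simp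
    \<comment> \<open>The two failing guards cost 1 each, and 1 is at most m.\<close>
    also have "\<dots> \<le> 2 * m + m + (2 * m * (1 + cost insert_arc) + m)" using m(2) by (intro add_mono) auto
    also have "\<dots> = (6 + 2 * cost insert_arc) * m" by (simp add: algebra_simps)
    finally show ?thesis .
  qed
  moreover have "indexed (arcs G) s2"
  proof -
    have im: "arc ` {..<2 * m} = arcs G" using arc by (simp add: bij_betw_def)
    have "bij_betw (\<lambda>d. (mem s2 d, mem s2 (flip d))) {..<2 * m} (arcs G)"
      using arc s2(2) by (subst bij_betw_cong[where g = arc]) (auto simp: I2_def arc_def)
    moreover have "tables (arcs G) s2" using s2(2) unfolding I2_def im by blast
    ultimately show ?thesis using s2(2) by (simp add: indexed_def I2_def)
  qed
  moreover have "(S - 1) * (S - 1) < m" using less[of "S - 1"] S_pos by simp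
  ultimately show ?thesis using s2(2) S S_pos S_le unfolding s0_def[symmetric] I2_def by blast
qed

section \<open>Candidates, embeddings and occurrences\<close>

primrec writes :: "draw \<Rightarrow> nat set" where
  "writes (Arc a b) = {a, b}"
| "writes (Nbr a b) = {b}"
| "writes (Light a b) = {b}"
| "writes (Heavy b) = {b}"

primrec reads :: "draw \<Rightarrow> nat set" where
  "reads (Arc a b) = {}"
| "reads (Nbr a b) = {a}"
| "reads (Light a b) = {a}"
| "reads (Heavy b) = {}"

primrec proper :: "draw \<Rightarrow> bool" where
  "proper (Arc a b) = (a \<noteq> b)"
| "proper (Nbr a b) = True"
| "proper (Light a b) = True"
| "proper (Heavy b) = True"

text \<open>\<open>V\<close> holds the pattern vertices placed so far. Draws read only placed
  vertices and never overwrite one, so the final assignment determines what each draw must have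
  placed. Both branches of \<open>Alt\<close> place the same remaining vertices.\<close>

primrec wf_plan :: "nat \<Rightarrow> nat set \<Rightarrow> plan \<Rightarrow> bool" where
  "wf_plan k V Done = (V = {..<k})"
| "wf_plan k V (Draw r p) = (proper r \<and> reads r \<subseteq> V \<and> writes r \<inter> V = {} \<and> wf_plan k (V \<union> writes r) p)"
| "wf_plan k V (Alt p q) = (wf_plan k V p \<and> wf_plan k V q)"

text \<open>\<open>multiplicity\<close> is the number of candidates that decode to the assignment \<open>\<psi>\<close>.\<close>

primrec consistent :: "(nat \<times> nat) set \<Rightarrow> state \<Rightarrow> draw \<Rightarrow> (nat \<Rightarrow> nat) \<Rightarrow> bool" where
  "consistent E s (Arc a b) \<psi> = ((\<psi> a, \<psi> b) \<in> E)"
| "consistent E s (Nbr a b) \<psi> = ((\<psi> a, \<psi> b) \<in> E)"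
| "consistent E s (Light a b) \<psi> = ((\<psi> a, \<psi> b) \<in> E \<and> tab s 0 (\<psi> a, 0) \<le> reg s 2)"
| "consistent E s (Heavy b) \<psi> = (reg s 2 < tab s 0 (\<psi> b, 0))"

primrec multiplicity :: "(nat \<times> nat) set \<Rightarrow> state \<Rightarrow> plan \<Rightarrow> (nat \<Rightarrow> nat) \<Rightarrow> nat" where
  "multiplicity E s Done \<psi> = 1"
| "multiplicity E s (Draw r p) \<psi> = of_bool (consistent E s r \<psi>) * multiplicity E s p \<psi>"
| "multiplicity E s (Alt p q) \<psi> = multiplicity E s p \<psi> + multiplicity E s q \<psi>"

text \<open>The radices of \<open>Nbr\<close> and \<open>Heavy\<close> are at least the lengths of
  the lists they index, so no list entry is out of reach.\<close>

definition within_bounds :: "state \<Rightarrow> bool" where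
  "within_bounds s \<longleftrightarrow> (\<forall>u. tab s 0 (u, 0) \<le> reg s 1) \<and> reg s 3 \<le> 2 * reg s 2"

lemma card_preimage:
  assumes "bij_betw f {..<n} B"
  shows "card {d. d < n \<and> f d = y} = of_bool (y \<in> B)"
proof (cases "y \<in> B")
  case True
  then obtain d where d: "d < n" "f d = y" using assms by (auto simp: bij_betw_def)
  then have "{d. d < n \<and> f d = y} = {d}" using assms by (auto simp: bij_betw_def inj_on_def)
  then show ?thesis using True by simp
next
  case False
  then have "{d. d < n \<and> f d = y} = {}" using assms by (auto simp: bij_betw_def)
  then have "card {d. d < n \<and> f d = y} = 0" by (simp only: card.empty)
  then show ?thesis using False by simp
qed

lemma place_other: "i \<notin> writes r \<Longrightarrow> place s r d \<phi> i = \<phi> i"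
  by (cases r) auto

lemma place_cong:
  assumes "reads r \<subseteq> V" "\<And>i. i \<in> V \<Longrightarrow> \<phi> i = \<phi>' i" "i \<in> V \<union> writes r"
  shows "place s r d \<phi> i = place s r d \<phi>' i"
  using assms by (cases r) auto

lemma legal_cong:
  assumes "reads r \<subseteq> V" "\<And>i. i \<in> V \<Longrightarrow> \<phi> i = \<phi>' i"
  shows "legal s r d \<phi> = legal s r d \<phi>'"
  using assms by (cases r) auto

lemma wf_plan_subset: "wf_plan k V p \<Longrightarrow> V \<subseteq> {..<k}"
  by (induction p arbitrary: V) auto

lemma fill_other: "wf_plan k V p \<Longrightarrow> i \<in> V \<Longrightarrow> fill s p x \<phi> i = \<phi> i"
proof (induction p arbitrary: V x \<phi>)
  case (Draw r p)
  then have "i \<notin> writes r" by auto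
  then show ?case using Draw.IH[of "V \<union> writes r"] Draw.prems by (simp add: place_other)
qed auto

lemma fill_cong:
  assumes "wf_plan k V p" "\<And>i. i \<in> V \<Longrightarrow> \<phi> i = \<phi>' i"
  shows "legals s p x \<phi> = legals s p x \<phi>' \<and> (\<forall>i<k. fill s p x \<phi> i = fill s p x \<phi>' i)"
  using assms
proof (induction p arbitrary: V x \<phi> \<phi>')
  case (Draw r p)
  have "place s r d \<phi> i = place s r d \<phi>' i" if "i \<in> V \<union> writes r" for d i
    using Draw.prems that by (intro place_cong[of r V]) auto
  moreover have "legal s r d \<phi> = legal s r d \<phi>'" for d
    using Draw.prems by (intro legal_cong[of r V]) auto
  moreover have "wf_plan k (V \<union> writes r) p" using Draw.prems(1) by simp
  ultimately show ?case
    using Draw.IH[of "V \<union> writes r" "place s r (x mod radix s r) \<phi>" "place s r (x mod radix s r) \<phi>'" "x div radix s r"] by simp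
next
  case (Alt p q)
  have "wf_plan k V p" "wf_plan k V q" using Alt.prems(1) by auto
  then show ?case using Alt.IH(1)[of V \<phi> \<phi>' x] Alt.IH(2)[of V \<phi> \<phi>' "x - plan_size s p"] Alt.prems(2) by simp
qed simp

text \<open>Every list enumerates its set bijectively, so the values prescribed by
  \<open>\<psi>\<close> come from exactly one digit if they belong to the set and from none
  otherwise.\<close>

lemma card_draw:
  assumes E: "indexed E s" "within_bounds s"
    and r: "proper r" "reads r \<subseteq> V" and \<phi>: "\<And>i. i \<in> V \<Longrightarrow> \<phi> i = \<psi> i"
  shows "card {d. d < radix s r \<and> legal s r d \<phi> \<and> (\<forall>i\<in>writes r. place s r d \<phi> i = \<psi> i)} =
    of_bool (consistent E s r \<psi>)"
proof (cases r)
  case (Arc a b)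
  have "bij_betw (\<lambda>d. (mem s d, mem s (flip d))) {..<2 * reg s 0} E" using E(1) by (simp add: indexed_def)
  from card_preimage[OF this, of "(\<psi> a, \<psi> b)"] show ?thesis using r(1) by (simp add: Arc)
next
  case (Nbr a b)
  have "{d. d < radix s r \<and> legal s r d \<phi> \<and> (\<forall>i\<in>writes r. place s r d \<phi> i = \<psi> i)} =
      {d. d < tab s 0 (\<psi> a, 0) \<and> tab s 1 (\<psi> a, d) = \<psi> b}"
    using E(2) r(2) \<phi> less_le_trans by (fastforce simp: Nbr within_bounds_def)
  moreover have "bij_betw (\<lambda>j. tab s 1 (\<psi> a, j)) {..<tab s 0 (\<psi> a, 0)} (E `` {\<psi> a})"
    using E(1) by (simp add: indexed_def tables_def)
  from card_preimage[OF this, of "\<psi> b"] have "card {d. d < tab s 0 (\<psi> a, 0) \<and> tab s 1 (\<psi> a, d) = \<psi> b} =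
     of_bool ((\<psi> a, \<psi> b) \<in> E)" by simp
  ultimately show ?thesis by (simp add: Nbr)
next
  case (Light a b)
  show ?thesis
  proof (cases "tab s 0 (\<psi> a, 0) \<le> reg s 2")
    case True
    then have "{d. d < radix s r \<and> legal s r d \<phi> \<and> (\<forall>i\<in>writes r. place s r d \<phi> i = \<psi> i)} =
        {d. d < tab s 0 (\<psi> a, 0) \<and> tab s 1 (\<psi> a, d) = \<psi> b}"
      using r(2) \<phi> by (auto simp: Light)
    moreover have "bij_betw (\<lambda>j. tab s 1 (\<psi> a, j)) {..<tab s 0 (\<psi> a, 0)} (E `` {\<psi> a})"
      using E(1) by (simp add: indexed_def tables_def)
    from card_preimage[OF this, of "\<psi> b"] have "card {d. d < tab s 0 (\<psi> a, 0) \<and> tab s 1 (\<psi> a, d) = \<psi> b} =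
       of_bool ((\<psi> a, \<psi> b) \<in> E)" by simp
    ultimately show ?thesis using True by (simp add: Light)
  qed (use r(2) \<phi> in \<open>simp add: Light\<close>)
next
  case (Heavy b)
  have "{d. d < radix s r \<and> legal s r d \<phi> \<and> (\<forall>i\<in>writes r. place s r d \<phi> i = \<psi> i)} =
      {d. d < reg s 3 \<and> tab s 3 (0, d) = \<psi> b}"
    using E(2) by (auto simp: Heavy within_bounds_def)
  moreover have "bij_betw (\<lambda>j. tab s 3 (0, j)) {..<reg s 3} {u. reg s 2 < tab s 0 (u, 0)}"
    using E(1) by (simp add: indexed_def tables_def)
  from card_preimage[OF this, of "\<psi> b"] have "card {d. d < reg s 3 \<and> tab s 3 (0, d) = \<psi> b} =
     of_bool (reg s 2 < tab s 0 (\<psi> b, 0))" by simp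
  ultimately show ?thesis by (simp add: Heavy)
qed

text \<open>The count multiplies along draws and adds over alternatives, just as
  \<open>multiplicity\<close> does.\<close>

lemma card_plan:
  assumes E: "indexed E s" "within_bounds s"
    and "wf_plan k V p" "\<And>i. i \<in> V \<Longrightarrow> \<phi> i = \<psi> i"
  shows "card {x. x < plan_size s p \<and> legals s p x \<phi> \<and> (\<forall>i<k. fill s p x \<phi> i = \<psi> i)} = multiplicity E s p \<psi>"
  using assms(3,4)
proof (induction p arbitrary: V \<phi>)
  case Done
  then have "{x. x < plan_size s Done \<and> legals s Done x \<phi> \<and> (\<forall>i<k. fill s Done x \<phi> i = \<psi> i)} = {0}" by auto
  then show ?case by simp
next
  case (Draw r p)
  let ?R = "radix s r" and ?N = "plan_size s p"
  define D where "D = {d. d < ?R \<and> legal s r d \<phi> \<and> (\<forall>i\<in>writes r. place s r d \<phi> i = \<psi> i)}"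
  define Y where "Y d = {y. y < ?N \<and> legals s p y (place s r d \<phi>) \<and> (\<forall>i<k. fill s p y (place s r d \<phi>) i = \<psi> i)}" for d
  have wf: "proper r" "reads r \<subseteq> V" "writes r \<inter> V = {}" "wf_plan k (V \<union> writes r) p" using Draw.prems(1) by auto
  have "card D = of_bool (consistent E s r \<psi>)"
    unfolding D_def using card_draw[OF E wf(1,2)] Draw.prems(2) by blast
  moreover have "card (Y d) = multiplicity E s p \<psi>" if "d \<in> D" for d
    unfolding Y_def
  proof (rule Draw.IH[OF wf(4)])
    fix i assume "i \<in> V \<union> writes r"
    then show "place s r d \<phi> i = \<psi> i"
      using that wf(3) Draw.prems(2) place_other[of i r s d \<phi>] by (cases "i \<in> writes r") (auto simp: D_def)
  qed
  \<comment> \<open>Splitting off the least significant digit. The set \<open>Y d\<close> of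
    admissible rests depends on the digit, but its size does not.\<close>
  moreover have "bij_betw (\<lambda>(d, y). y * ?R + d) (Sigma D Y)
    {x. x < plan_size s (Draw r p) \<and> legals s (Draw r p) x \<phi> \<and> (\<forall>i<k. fill s (Draw r p) x \<phi> i = \<psi> i)}"
  proof (rule bij_betw_byWitness[where f' = "\<lambda>x. (x mod ?R, x div ?R)"])
    show "\<forall>a\<in>Sigma D Y. ((case a of (d, y) \<Rightarrow> y * ?R + d) mod ?R, (case a of (d, y) \<Rightarrow> y * ?R + d) div ?R) = a"
      by (auto simp: D_def)
    show "\<forall>x\<in>{x. x < plan_size s (Draw r p) \<and> legals s (Draw r p) x \<phi> \<and> (\<forall>i<k. fill s (Draw r p) x \<phi> i = \<psi> i)}.
        (case (x mod ?R, x div ?R) of (d, y) \<Rightarrow> y * ?R + d) = x"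
      by (simp only: prod.case div_mult_mod_eq) simp
    have "y * ?R + d < ?R * ?N" if "d < ?R" "y < ?N" for d y
    proof -
      have "y * ?R + d < Suc y * ?R" using that by simp
      also have "\<dots> \<le> ?N * ?R" using that by (intro mult_right_mono) auto
      finally show ?thesis by (simp add: mult.commute)
    qed
    then show "(\<lambda>(d, y). y * ?R + d) ` Sigma D Y \<subseteq>
        {x. x < plan_size s (Draw r p) \<and> legals s (Draw r p) x \<phi> \<and> (\<forall>i<k. fill s (Draw r p) x \<phi> i = \<psi> i)}"
      by (auto simp: D_def Y_def)
    show "(\<lambda>x. (x mod ?R, x div ?R)) ` {x. x < plan_size s (Draw r p) \<and> legals s (Draw r p) x \<phi> \<and>
        (\<forall>i<k. fill s (Draw r p) x \<phi> i = \<psi> i)} \<subseteq> Sigma D Y"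
    proof (rule image_subsetI)
      fix x assume x: "x \<in> {x. x < plan_size s (Draw r p) \<and> legals s (Draw r p) x \<phi> \<and> (\<forall>i<k. fill s (Draw r p) x \<phi> i = \<psi> i)}"
      then have R: "0 < ?R" by (cases "?R = 0") auto
      \<comment> \<open>Later draws never overwrite a vertex, so its final value is already the one
        placed by this digit.\<close>
      have "place s r (x mod ?R) \<phi> i = \<psi> i" if "i \<in> writes r" for i
        using x fill_other[OF wf(4), of i s "x div ?R" "place s r (x mod ?R) \<phi>"] wf_plan_subset[OF wf(4)] that by auto
      then show "(x mod ?R, x div ?R) \<in> Sigma D Y"
        using x R by (auto simp: D_def Y_def less_mult_imp_div_less mult.commute)
    qed
  qed
  then have "card {x. x < plan_size s (Draw r p) \<and> legals s (Draw r p) x \<phi> \<and> (\<forall>i<k. fill s (Draw r p) x \<phi> i = \<psi> i)} =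
      card (Sigma D Y)" by (simp add: bij_betw_same_card)
  moreover have "finite D" "\<And>d. finite (Y d)" by (auto simp: D_def Y_def)
  ultimately show ?case by simp
next
  case (Alt p q)
  let ?S = "\<lambda>p. {x. x < plan_size s p \<and> legals s p x \<phi> \<and> (\<forall>i<k. fill s p x \<phi> i = \<psi> i)}"
  have "?S (Alt p q) = ?S p \<union> (\<lambda>x. x + plan_size s p) ` ?S q"
  proof (intro subset_antisym subsetI)
    fix x assume x: "x \<in> ?S (Alt p q)"
    show "x \<in> ?S p \<union> (\<lambda>x. x + plan_size s p) ` ?S q"
    proof (cases "x < plan_size s p")
      case False
      then have "x = (x - plan_size s p) + plan_size s p" "x - plan_size s p \<in> ?S q" using x by auto
      then show ?thesis by blast
    qed (use x in auto)
  qed auto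
  moreover have "card (?S p \<union> (\<lambda>x. x + plan_size s p) ` ?S q) = card (?S p) + card (?S q)"
    by (subst card_Un_disjoint) (auto simp: card_image)
  ultimately show ?case using Alt.IH[of V \<phi>] Alt.prems by simp
qed

section \<open>Occurrences as images of embeddings\<close>

lemma map_pmf_of_set_equal_fibres:
  assumes "finite A" "A \<noteq> {}" and fib: "\<And>y. y \<in> f ` A \<Longrightarrow> card {x \<in> A. f x = y} = n"
  shows "map_pmf f (pmf_of_set A) = pmf_of_set (f ` A)"
proof (rule pmf_eqI)
  fix y
  have "card A = (\<Sum>y\<in>f ` A. card {x \<in> A. f x = y})"
    using sum.image_gen[OF assms(1), of "\<lambda>_. 1 :: nat" f] by simp
  then have A: "card A = card (f ` A) * n" using fib by simp
  then have n: "n > 0" using assms(1,2) by (metis card_gt_0_iff mult_0_right not_gr_zero)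
  have "pmf (map_pmf f (pmf_of_set A)) y = card {x \<in> A. f x = y} / card A"
    using assms(1,2) by (simp add: pmf_map measure_pmf_of_set vimage_def Int_def)
  also have "\<dots> = pmf (pmf_of_set (f ` A)) y"
  proof (cases "y \<in> f ` A")
    case True
    then show ?thesis using assms(1,2) n by (simp add: fib A)
  next
    case False
    then have "{x \<in> A. f x = y} = {}" by auto
    then have "card {x \<in> A. f x = y} = 0" by (simp only: card.empty)
    then show ?thesis using False assms(1,2) by simp
  qed
  finally show "pmf (map_pmf f (pmf_of_set A)) y = pmf (pmf_of_set (f ` A)) y" .
qed

text \<open>The vertices of the pattern are renamed to numbers below \<open>k\<close>.
  \<open>es\<close> lists both orientations of each edge, so that edges can be handled as a
  symmetric relation.\<close>

locale pattern =
  fixes P :: "'p ugraph" and k :: nat and vx :: "nat \<Rightarrow> 'p" and es :: "(nat \<times> nat) list"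
  assumes P: "simple_graph P" "connected_graph P" and k: "2 \<le> k"
    and vx: "bij_betw vx {..<k} (verts P)"
    and es: "set es = {(i, j). i < k \<and> j < k \<and> {vx i, vx j} \<in> edges P}"
begin

lemma vx_eq: "i < k \<Longrightarrow> j < k \<Longrightarrow> vx i = vx j \<longleftrightarrow> i = j"
  using vx by (auto simp: bij_betw_def inj_on_def)

lemma vx_vert: "i < k \<Longrightarrow> vx i \<in> verts P"
  using vx by (auto simp: bij_betw_def)

lemma vx_obtain: assumes "v \<in> verts P" obtains i where "i < k" "v = vx i"
  using vx assms by (auto simp: bij_betw_def)

lemma es_less: "(i, j) \<in> set es \<Longrightarrow> i < k \<and> j < k" by (simp add: es)

lemma es_sym: "(i, j) \<in> set es \<Longrightarrow> (j, i) \<in> set es" by (simp add: es insert_commute)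

lemma es_irrefl: "(i, j) \<in> set es \<Longrightarrow> i \<noteq> j"
  using P(1) by (fastforce simp: es simple_graph_def doubleton_eq_iff)

lemma es_edge: "i < k \<Longrightarrow> j < k \<Longrightarrow> {vx i, vx j} \<in> edges P \<longleftrightarrow> (i, j) \<in> set es"
  by (simp add: es)

text \<open>A connected pattern with at least two vertices has no isolated vertex. Hence edges
  mapped into the data graph already force the vertices into it, and the first edge of a tree plan
  exists.\<close>

lemma es_neighbour:
  assumes "i < k"
  obtains j where "(i, j) \<in> set es"
proof -
  obtain j where j: "j < k" "j \<noteq> i"
  proof (cases "i = 0")
    case True then show ?thesis using that[of 1] k by simp
  next
    case False then show ?thesis using that[of 0] k by simp
  qed
  have "(vx i, vx j) \<in> {(x, y). {x, y} \<in> edges P}\<^sup>*"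
    using P(2) vx_vert assms j(1) by (auto simp: connected_graph_def)
  moreover have "vx i \<noteq> vx j" using vx_eq assms j by auto
  ultimately obtain y where y: "{vx i, y} \<in> edges P" by (auto elim: converse_rtranclE)
  then have "y \<in> verts P" using P(1) by (fastforce simp: simple_graph_def doubleton_eq_iff)
  then obtain j' where "j' < k" "y = vx j'" by (rule vx_obtain)
  then show ?thesis using that[of j'] y assms by (simp add: es)
qed

text \<open>Extensionality makes an embedding determined by its values below \<open>k\<close>, so
  that embeddings can be counted. Non-edges may be mapped to edges, because occurrences need not be
  induced subgraphs.\<close>

definition embeddings :: "nat ugraph \<Rightarrow> (nat \<Rightarrow> nat) set" where
  "embeddings G = {\<phi> \<in> extensional {..<k}. inj_on \<phi> {..<k} \<and> (\<forall>(i, j)\<in>set es. {\<phi> i, \<phi> j} \<in> edges G)}"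

lemma image_graph_edge:
  assumes "inj_on \<phi> {..<k}" "i < k" "j < k"
  shows "{\<phi> i, \<phi> j} \<in> edges (image_graph k es \<phi>) \<longleftrightarrow> (i, j) \<in> set es"
proof
  assume "{\<phi> i, \<phi> j} \<in> edges (image_graph k es \<phi>)"
  then obtain a b where ab: "(a, b) \<in> set es" "{\<phi> i, \<phi> j} = {\<phi> a, \<phi> b}" by (auto simp: image_graph_def)
  then have "(i = a \<and> j = b) \<or> (i = b \<and> j = a)"
    using assms es_less[OF ab(1)] by (auto simp: doubleton_eq_iff inj_on_eq_iff)
  then show "(i, j) \<in> set es" using ab(1) es_sym by auto
qed (force simp: image_graph_def)

lemma image_graph_occurrence:
  assumes G: "simple_graph G" and \<phi>: "\<phi> \<in> embeddings G"
  shows "image_graph k es \<phi> \<in> occurrences P G"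
proof -
  let ?H = "image_graph k es \<phi>"
  have inj: "inj_on \<phi> {..<k}" and E: "\<And>i j. (i, j) \<in> set es \<Longrightarrow> {\<phi> i, \<phi> j} \<in> edges G"
    using \<phi> by (auto simp: embeddings_def)
  have V: "verts ?H = \<phi> ` {..<k}" by (simp add: image_graph_def)
  have "\<exists>u\<in>verts ?H. \<exists>v\<in>verts ?H. u \<noteq> v \<and> e = {u, v}" if e: "e \<in> edges ?H" for e
  proof -
    obtain i j where ij: "(i, j) \<in> set es" "e = {\<phi> i, \<phi> j}" using e by (auto simp: image_graph_def)
    have "\<phi> i \<noteq> \<phi> j" using inj es_less[OF ij(1)] es_irrefl[OF ij(1)] by (auto simp: inj_on_eq_iff)
    then show ?thesis using ij es_less[OF ij(1)] by (auto simp: V)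
  qed
  then have "simple_graph ?H" by (auto simp: simple_graph_def V)
  moreover have "edges ?H \<subseteq> edges G" using E by (auto simp: image_graph_def)
  moreover have "verts ?H \<subseteq> verts G"
  proof
    fix u assume "u \<in> verts ?H"
    then obtain i where i: "i < k" "u = \<phi> i" by (auto simp: V)
    obtain j where "(i, j) \<in> set es" using es_neighbour[OF i(1)] .
    from E[OF this] show "u \<in> verts G" using G by (fastforce simp: i simple_graph_def doubleton_eq_iff)
  qed
  moreover define f where "f = vx \<circ> inv_into {..<k} \<phi>"
  have f: "f (\<phi> i) = vx i" if "i < k" for i using inj that by (simp add: f_def)
  have "bij_betw f (verts ?H) (verts P)"
    unfolding f_def V using bij_betw_trans[OF bij_betw_inv_into[OF inj_on_imp_bij_betw[OF inj]] vx] .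
  moreover have "\<forall>u1\<in>verts ?H. \<forall>u2\<in>verts ?H. u1 \<noteq> u2 \<longrightarrow> ({u1, u2} \<in> edges ?H \<longleftrightarrow> {f u1, f u2} \<in> edges P)"
    using image_graph_edge[OF inj] by (auto simp: V f es_edge)
  ultimately show ?thesis unfolding occurrences_def subgraph_def by blast
qed

text \<open>The embedding is the inverse of the isomorphism \<open>f\<close>. The equivalence for
  edges makes the image graph all of \<open>H\<close>, not just a part of it.\<close>

lemma occurrence_image_graph:
  assumes H: "H \<in> occurrences P G"
  shows "\<exists>\<phi>\<in>embeddings G. H = image_graph k es \<phi>"
proof -
  obtain f where sub: "subgraph H G" and f: "bij_betw f (verts H) (verts P)"
    and E: "\<And>u1 u2. u1 \<in> verts H \<Longrightarrow> u2 \<in> verts H \<Longrightarrow> u1 \<noteq> u2 \<Longrightarrow> {u1, u2} \<in> edges H \<longleftrightarrow> {f u1, f u2} \<in> edges P"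
    using H by (auto simp: occurrences_def)
  define g where "g = inv_into (verts H) f \<circ> vx"
  have g: "bij_betw g {..<k} (verts H)"
    unfolding g_def using bij_betw_trans[OF vx bij_betw_inv_into[OF f]] .
  have fg: "f (g i) = vx i" if "i < k" for i
    using bij_betw_inv_into_right[OF f] vx_vert[OF that] by (simp add: g_def)
  have gE: "{g i, g j} \<in> edges H \<longleftrightarrow> (i, j) \<in> set es" if "i < k" "j < k" "i \<noteq> j" for i j
  proof -
    have "g i \<noteq> g j" "g i \<in> verts H" "g j \<in> verts H" using g that by (auto simp: bij_betw_def inj_on_eq_iff)
    then show ?thesis using E fg that by (simp add: es_edge)
  qed
  define \<phi> where "\<phi> = restrict g {..<k}"
  have \<phi>: "\<phi> i = g i" if "i < k" for i using that by (simp add: \<phi>_def)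
  have "\<phi> \<in> embeddings G"
    unfolding embeddings_def
  proof (intro CollectI conjI ballI)
    show "\<phi> \<in> extensional {..<k}" by (simp add: \<phi>_def)
    show "inj_on \<phi> {..<k}" using g by (simp add: \<phi>_def bij_betw_def inj_on_restrict_eq)
    fix x assume x: "x \<in> set es"
    obtain i j where ij: "x = (i, j)" by force
    show "case x of (i, j) \<Rightarrow> {\<phi> i, \<phi> j} \<in> edges G"
      using x es_less es_irrefl gE sub by (auto simp: ij \<phi> subgraph_def)
  qed
  moreover have "verts H = verts (image_graph k es \<phi>)"
    using g by (auto simp: image_graph_def bij_betw_def \<phi>_def)
  moreover have "edges H = edges (image_graph k es \<phi>)"
  proof (intro subset_antisym subsetI)
    fix e assume e: "e \<in> edges H"
    then obtain u v where uv: "u \<in> verts H" "v \<in> verts H" "u \<noteq> v" "e = {u, v}"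
      using sub by (fastforce simp: subgraph_def simple_graph_def)
    have "g ` {..<k} = verts H" using g by (simp add: bij_betw_def)
    then have "u \<in> g ` {..<k}" "v \<in> g ` {..<k}" using uv by simp_all
    then obtain i j where ij: "i < k" "j < k" "u = g i" "v = g j" by blast
    then have "(i, j) \<in> set es" using gE[of i j] e uv by auto
    then show "e \<in> edges (image_graph k es \<phi>)" using ij uv(4) by (force simp: image_graph_def \<phi>)
  next
    fix e assume "e \<in> edges (image_graph k es \<phi>)"
    then obtain i j where "(i, j) \<in> set es" "e = {\<phi> i, \<phi> j}" by (auto simp: image_graph_def)
    then show "e \<in> edges H" using gE[of i j] es_less es_irrefl by (auto simp: \<phi>)
  qed
  ultimately show ?thesis by (intro bexI[of _ \<phi>]) (auto intro: ugraph.equality)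
qed

lemma occurrences_eq: "simple_graph G \<Longrightarrow> occurrences P G = image_graph k es ` embeddings G"
  using image_graph_occurrence occurrence_image_graph by blast

text \<open>Any two embeddings with the same image differ by an automorphism of the pattern, so every
  occurrence is the image of the same number of embeddings.\<close>

lemma fibre_le:
  assumes fin: "finite (embeddings G)" and \<phi>: "\<phi>0 \<in> embeddings G" "\<phi>1 \<in> embeddings G"
  shows "card {\<phi> \<in> embeddings G. image_graph k es \<phi> = image_graph k es \<phi>0} \<le>
    card {\<phi> \<in> embeddings G. image_graph k es \<phi> = image_graph k es \<phi>1}"
proof -
  \<comment> \<open>For \<open>\<phi>\<close> in the fibre of \<open>\<phi>0\<close> this is the
    automorphism with \<open>\<phi>\<close> = \<open>\<phi>0\<close> o
    \<open>\<sigma> \<phi>\<close>. Composing it with \<open>\<phi>1\<close> instead carries one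
    fibre injectively into the other.\<close>
  define \<sigma> where "\<sigma> \<phi> = inv_into {..<k} \<phi>0 \<circ> \<phi>" for \<phi> :: "nat \<Rightarrow> nat"
  define T where "T \<phi> = restrict (\<phi>1 \<circ> \<sigma> \<phi>) {..<k}" for \<phi>
  have inj0: "inj_on \<phi>0 {..<k}" and inj1: "inj_on \<phi>1 {..<k}"
    and E1: "\<And>i j. (i, j) \<in> set es \<Longrightarrow> {\<phi>1 i, \<phi>1 j} \<in> edges G"
    using \<phi> by (auto simp: embeddings_def)
  let ?F = "\<lambda>\<psi>. {\<phi> \<in> embeddings G. image_graph k es \<phi> = image_graph k es \<psi>}"
  have bij: "bij_betw (\<sigma> \<phi>) {..<k} {..<k}" and \<phi>0\<sigma>: "\<And>i. i < k \<Longrightarrow> \<phi>0 (\<sigma> \<phi> i) = \<phi> i" if "\<phi> \<in> ?F \<phi>0" for \<phi>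
  proof -
    have im: "\<phi> ` {..<k} = \<phi>0 ` {..<k}" and inj: "inj_on \<phi> {..<k}"
      using that by (auto simp: image_graph_def embeddings_def)
    have "bij_betw \<phi> {..<k} (\<phi>0 ` {..<k})" using inj im by (simp add: bij_betw_def)
    then show "bij_betw (\<sigma> \<phi>) {..<k} {..<k}"
      unfolding \<sigma>_def using bij_betw_trans bij_betw_inv_into[OF inj_on_imp_bij_betw[OF inj0]] by blast
    fix i assume "i < k"
    then have "\<phi> i \<in> \<phi>0 ` {..<k}" using im by blast
    then show "\<phi>0 (\<sigma> \<phi> i) = \<phi> i" by (simp add: \<sigma>_def f_inv_into_f)
  qed
  have \<sigma>k: "\<sigma> \<phi> i < k" if "\<phi> \<in> ?F \<phi>0" "i < k" for \<phi> i
    using bij[OF that(1)] that(2) by (auto simp: bij_betw_def)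
  \<comment> \<open>An injection of the finite set of oriented edges into itself is onto, so it is
    enough that \<open>\<sigma> \<phi>\<close> preserves edges.\<close>
  have aut: "map_prod (\<sigma> \<phi>) (\<sigma> \<phi>) ` set es = set es" if \<phi>: "\<phi> \<in> ?F \<phi>0" for \<phi>
  proof (rule endo_inj_surj)
    show "map_prod (\<sigma> \<phi>) (\<sigma> \<phi>) ` set es \<subseteq> set es"
    proof (rule image_subsetI)
      fix x assume x: "x \<in> set es"
      obtain i j where ij: "x = (i, j)" by force
      have lt: "i < k" "j < k" using es_less x ij by auto
      have inj: "inj_on \<phi> {..<k}" and eq: "image_graph k es \<phi> = image_graph k es \<phi>0"
        using \<phi> by (auto simp: embeddings_def)
      have "{\<phi> i, \<phi> j} \<in> edges (image_graph k es \<phi>0)"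
        using image_graph_edge[OF inj lt] x ij unfolding eq by simp
      then have "{\<phi>0 (\<sigma> \<phi> i), \<phi>0 (\<sigma> \<phi> j)} \<in> edges (image_graph k es \<phi>0)" using \<phi>0\<sigma>[OF \<phi>] lt by simp
      then show "map_prod (\<sigma> \<phi>) (\<sigma> \<phi>) x \<in> set es"
        using image_graph_edge[OF inj0] \<sigma>k[OF \<phi>] lt by (simp add: ij)
    qed
    show "inj_on (map_prod (\<sigma> \<phi>) (\<sigma> \<phi>)) (set es)"
    proof (rule inj_on_subset)
      have "inj_on (\<sigma> \<phi>) {..<k}" using bij[OF \<phi>] by (simp add: bij_betw_def)
      then show "inj_on (map_prod (\<sigma> \<phi>) (\<sigma> \<phi>)) ({..<k} \<times> {..<k})" by (intro map_prod_inj_on)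
      show "set es \<subseteq> {..<k} \<times> {..<k}" using es_less by auto
    qed
  qed simp
  have T: "T \<phi> \<in> ?F \<phi>1" if \<phi>: "\<phi> \<in> ?F \<phi>0" for \<phi>
  proof -
    have Ti: "T \<phi> i = \<phi>1 (\<sigma> \<phi> i)" if "i < k" for i using that by (simp add: T_def)
    have "inj_on (T \<phi>) {..<k}"
      using bij[OF \<phi>] inj1 unfolding T_def inj_on_restrict_eq by (intro comp_inj_on) (auto simp: bij_betw_def)
    moreover have "(\<sigma> \<phi> i, \<sigma> \<phi> j) \<in> set es" if "(i, j) \<in> set es" for i j
      using aut[OF \<phi>] that by force
    then have "{T \<phi> i, T \<phi> j} \<in> edges G" if "(i, j) \<in> set es" for i j
      using E1 es_less[OF that] that by (simp add: Ti)
    moreover have "T \<phi> \<in> extensional {..<k}" by (simp add: T_def)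
    ultimately have "T \<phi> \<in> embeddings G" unfolding embeddings_def by blast
    moreover have "T \<phi> ` {..<k} = \<phi>1 ` {..<k}"
    proof -
      have "T \<phi> ` {..<k} = \<phi>1 ` \<sigma> \<phi> ` {..<k}" by (simp add: T_def image_comp)
      then show ?thesis using bij[OF \<phi>] by (simp add: bij_betw_def)
    qed
    moreover have "(\<lambda>(i, j). {T \<phi> i, T \<phi> j}) ` set es = (\<lambda>(i, j). {\<phi>1 i, \<phi>1 j}) ` set es"
    proof -
      have "(\<lambda>(i, j). {T \<phi> i, T \<phi> j}) ` set es = (\<lambda>(i, j). {\<phi>1 i, \<phi>1 j}) ` map_prod (\<sigma> \<phi>) (\<sigma> \<phi>) ` set es"
        unfolding image_image using es_less by (intro image_cong refl) (auto simp: Ti)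
      then show ?thesis by (simp only: aut[OF \<phi>])
    qed
    ultimately show ?thesis by (simp add: image_graph_def)
  qed
  have "inj_on T (?F \<phi>0)"
  proof (rule inj_onI)
    fix \<phi> \<phi>' assume a: "\<phi> \<in> ?F \<phi>0" "\<phi>' \<in> ?F \<phi>0" "T \<phi> = T \<phi>'"
    have "\<phi> i = \<phi>' i" if "i < k" for i
    proof -
      have "\<phi>1 (\<sigma> \<phi> i) = \<phi>1 (\<sigma> \<phi>' i)" using fun_cong[OF a(3), of i] that by (simp add: T_def)
      then have "\<sigma> \<phi> i = \<sigma> \<phi>' i" using inj1 \<sigma>k a that by (auto simp: inj_on_eq_iff)
      then show ?thesis using \<phi>0\<sigma> a that by metis
    qed
    then show "\<phi> = \<phi>'" using a by (intro extensionalityI[of _ "{..<k}"]) (auto simp: embeddings_def)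
  qed
  moreover have "T ` ?F \<phi>0 \<subseteq> ?F \<phi>1" using T by blast
  moreover have "finite (?F \<phi>1)" using fin by (rule finite_subset[rotated]) blast
  ultimately show ?thesis by (rule card_inj_on_le)
qed

end

text \<open>Here the program meets the combinatorics: besides fitting in a word, all that a plan has
  to provide is well-formedness and \<open>unique\<close>.\<close>

locale sampler = pattern P k vx es + enumeration w s k es p
  for P :: "'p ugraph" and k vx es w s p +
  fixes G :: "nat ugraph"
  assumes G: "simple_graph G" and data: "indexed (arcs G) s" "within_bounds s" and wf: "wf_plan k {} p"
    and unique: "\<And>\<psi>. \<psi> \<in> embeddings G \<Longrightarrow> multiplicity (arcs G) s p \<psi> = 1"
begin

lemma embeds_iff: "embeds s k es \<phi> \<longleftrightarrow> restrict \<phi> {..<k} \<in> embeddings G"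
proof -
  have "tab s 2 (u, v) = 1 \<longleftrightarrow> {u, v} \<in> edges G" for u v
    using data(1) by (simp add: indexed_def tables_def arcs_def)
  moreover have "(\<forall>(i, j)\<in>set es. {restrict \<phi> {..<k} i, restrict \<phi> {..<k} j} \<in> edges G) \<longleftrightarrow>
      (\<forall>(i, j)\<in>set es. {\<phi> i, \<phi> j} \<in> edges G)"
    using es_less by (intro ball_cong refl) (auto simp: split_beta)
  ultimately show ?thesis by (simp add: embeds_def embeddings_def inj_on_restrict_eq)
qed

text \<open>By \<open>card_plan\<close> an embedding is decoded from as many candidates as its
  multiplicity, which is 1.\<close>

lemma bij_embeddings: "bij_betw (\<lambda>x. restrict (embedding x) {..<k}) A (embeddings G)"
proof -
  let ?g = "\<lambda>x. restrict (embedding x) {..<k}"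
  have A: "x \<in> A \<longleftrightarrow> x < N \<and> legals s p x (\<lambda>_. 0) \<and> ?g x \<in> embeddings G" for x
    by (auto simp: A_def good_def embeds_iff embedding_def)
  have fibre: "\<exists>x. {x \<in> A. ?g x = \<psi>} = {x}" if \<psi>: "\<psi> \<in> embeddings G" for \<psi>
  proof -
    have "\<psi> \<in> extensional {..<k}" using \<psi> by (simp add: embeddings_def)
    then have eq: "?g x = \<psi> \<longleftrightarrow> (\<forall>i<k. embedding x i = \<psi> i)" for x
      by (auto simp: fun_eq_iff extensional_def)
    have "x \<in> A \<and> ?g x = \<psi> \<longleftrightarrow> x < plan_size s p \<and> legals s p x (\<lambda>_. 0) \<and> (\<forall>i<k. fill s p x (\<lambda>_. 0) i = \<psi> i)" for x
      using A[of x] \<psi> eq[of x] unfolding N_def embedding_def by metis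
    then have "{x \<in> A. ?g x = \<psi>} = {x. x < plan_size s p \<and> legals s p x (\<lambda>_. 0) \<and> (\<forall>i<k. fill s p x (\<lambda>_. 0) i = \<psi> i)}"
      by blast
    then have "card {x \<in> A. ?g x = \<psi>} = 1"
      using card_plan[OF data wf, of "\<lambda>_. 0" \<psi>] unique[OF \<psi>] by simp
    then show ?thesis by (simp add: card_1_singleton_iff)
  qed
  show ?thesis
    unfolding bij_betw_def
  proof
    show "inj_on ?g A"
    proof (rule inj_onI)
      fix x y assume xy: "x \<in> A" "y \<in> A" "?g x = ?g y"
      obtain z where "{x \<in> A. ?g x = ?g y} = {z}" using fibre[of "?g y"] A xy(2) by blast
      then show "x = y" using xy by (metis (mono_tags, lifting) mem_Collect_eq singletonD)
    qed
    show "?g ` A = embeddings G"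
    proof
      show "?g ` A \<subseteq> embeddings G" using A by blast
      show "embeddings G \<subseteq> ?g ` A"
      proof
        fix \<psi> assume "\<psi> \<in> embeddings G"
        then obtain x where "{x \<in> A. ?g x = \<psi>} = {x}" using fibre by blast
        then have "x \<in> A \<and> ?g x = \<psi>" by (metis (mono_tags, lifting) mem_Collect_eq singletonI)
        then show "\<psi> \<in> ?g ` A" by blast
      qed
    qed
  qed
qed

lemma image_embedding: "image_graph k es (embedding x) = image_graph k es (restrict (embedding x) {..<k})"
  by (intro embeds_cong) auto

lemma occurrences_image: "occurrences P G = (\<lambda>x. image_graph k es (embedding x)) ` A"
proof -
  have "occurrences P G = image_graph k es ` (\<lambda>x. restrict (embedding x) {..<k}) ` A"
    using occurrences_eq[OF G] bij_embeddings by (simp add: bij_betw_def)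
  then show ?thesis unfolding image_image using image_embedding by simp
qed

lemma finite_accepted: "finite A" using A_subset finite_subset by blast

text \<open>Several accepted candidates may yield the same occurrence, which only shortens the
  search: N / card A is at most N / OUT.\<close>

lemma OUT_le: "OUT P G \<le> card A"
  unfolding occurrences_image using finite_accepted by (rule card_image_le)

text \<open>A uniform accepted candidate is a uniform embedding, and the map from embeddings to
  occurrences has fibres of equal size by \<open>fibre_le\<close> in both directions.\<close>

lemma answer_pmf_eq: "answer_pmf = sampling_outcome P G"
proof (cases "A = {}")
  case True
  then show ?thesis by (simp add: answer_pmf_def sampling_outcome_def occurrences_image)
next
  case False
  let ?g = "\<lambda>x. image_graph k es (embedding x)"
  have finE: "finite (embeddings G)" using bij_embeddings finite_accepted bij_betw_finite by blast
  have fib: "card {x \<in> A. ?g x = H} = card {\<phi> \<in> embeddings G. image_graph k es \<phi> = H}" for H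
  proof (rule bij_betw_same_card)
    show "bij_betw (\<lambda>x. restrict (embedding x) {..<k}) {x \<in> A. ?g x = H} {\<phi> \<in> embeddings G. image_graph k es \<phi> = H}"
    proof (rule bij_betw_subset[OF bij_embeddings])
      have "(\<lambda>x. restrict (embedding x) {..<k}) ` A = embeddings G" using bij_embeddings by (simp add: bij_betw_def)
      then show "(\<lambda>x. restrict (embedding x) {..<k}) ` {x \<in> A. ?g x = H} = {\<phi> \<in> embeddings G. image_graph k es \<phi> = H}"
        using image_embedding by auto
    qed auto
  qed
  have eq: "card {x \<in> A. ?g x = H} = card {x \<in> A. ?g x = H'}" if H: "H \<in> ?g ` A" "H' \<in> ?g ` A" for H H'
  proof -
    obtain \<phi>0 where 0: "\<phi>0 \<in> embeddings G" "H = image_graph k es \<phi>0"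
      using occurrence_image_graph[of H G] H(1) unfolding occurrences_image by blast
    obtain \<phi>1 where 1: "\<phi>1 \<in> embeddings G" "H' = image_graph k es \<phi>1"
      using occurrence_image_graph[of H' G] H(2) unfolding occurrences_image by blast
    show ?thesis unfolding fib 0(2) 1(2)
      using fibre_le[OF finE 0(1) 1(1)] fibre_le[OF finE 1(1) 0(1)] by (rule antisym)
  qed
  obtain x0 where x0: "x0 \<in> A" using False by blast
  have "map_pmf ?g (pmf_of_set A) = pmf_of_set (?g ` A)"
  proof (rule map_pmf_of_set_equal_fibres[OF finite_accepted False])
    fix H assume "H \<in> ?g ` A"
    then show "card {x \<in> A. ?g x = H} = card {x \<in> A. ?g x = ?g x0}" by (rule eq) (use x0 in blast)
  qed
  moreover have "map_pmf (\<lambda>x. Some (?g x)) (pmf_of_set A) = map_pmf Some (map_pmf ?g (pmf_of_set A))"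
    by (simp add: pmf.map_comp o_def)
  ultimately have "map_pmf (\<lambda>x. Some (?g x)) (pmf_of_set A) = map_pmf Some (pmf_of_set (occurrences P G))"
    by (simp only: occurrences_image)
  then show ?thesis using False by (simp add: answer_pmf_def sampling_outcome_def occurrences_image)
qed

lemma sampler_answers:
  "answers w (sample k es p) (same_data s) (sampling_outcome P G)
    ((cost (prepare p) + 2 * (1 + cost (attempt k es p)) + 3) * (plan_size s p / max 1 (OUT P G)))"
proof -
  have "answers w (sample k es p) (same_data s) (sampling_outcome P G) ((cost (prepare p) + 2 * c + 3) * (N / max 1 (card A)))"
    using sample_answers answer_pmf_eq by simp
  moreover have "(cost (prepare p) + 2 * c + 3) * (N / max 1 (card A)) \<le> (cost (prepare p) + 2 * c + 3) * (N / max 1 (OUT P G))"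
    using OUT_le by (intro mult_left_mono divide_left_mono) (auto simp: max_def)
  ultimately have "answers w (sample k es p) (same_data s) (sampling_outcome P G) ((cost (prepare p) + 2 * c + 3) * (N / max 1 (OUT P G)))"
    unfolding answers_def by (meson ennreal_leI order_trans)
  then show ?thesis by (simp add: c_def N_def)
qed

end

section \<open>Plans for trees, stars and odd cycles\<close>

text \<open>For a path with an even number of vertices these are its alternate edges, a perfect
  matching of the path.\<close>

fun arc_draws :: "nat list \<Rightarrow> plan \<Rightarrow> plan" where
  "arc_draws (a # b # xs) p = Draw (Arc a b) (arc_draws xs p)"
| "arc_draws _ p = p"

lemma wf_arc_draws:
  assumes "even (length xs)" "distinct xs" "set xs \<inter> V = {}" "wf_plan k (V \<union> set xs) p"
  shows "wf_plan k V (arc_draws xs p)"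
  using assms
proof (induction xs p arbitrary: V rule: arc_draws.induct)
  case (1 a b xs p)
  have "V \<union> set (a # b # xs) = V \<union> {a, b} \<union> set xs" by auto
  then have "wf_plan k (V \<union> {a, b} \<union> set xs) p" using 1(5) by (simp only:)
  then have "wf_plan k (V \<union> {a, b}) (arc_draws xs p)"
    using "1.prems" by (intro "1.IH") auto
  then show ?case using "1.prems" by simp
qed auto

lemma plan_size_arc_draws:
  "plan_size s (arc_draws xs p) = (2 * reg s 0) ^ (length xs div 2) * plan_size s p"
  by (induction xs p rule: arc_draws.induct) auto

primrec nbr_draws :: "nat \<Rightarrow> nat list \<Rightarrow> plan \<Rightarrow> plan" where
  "nbr_draws c [] p = p"
| "nbr_draws c (y # ys) p = Draw (Nbr c y) (nbr_draws c ys p)"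

lemma wf_nbr_draws:
  assumes "distinct ys" "set ys \<inter> V = {}" "c \<in> V" "wf_plan k (V \<union> set ys) p"
  shows "wf_plan k V (nbr_draws c ys p)"
  using assms
proof (induction ys arbitrary: V)
  case (Cons y ys)
  have "V \<union> set (y # ys) = V \<union> {y} \<union> set ys" by auto
  then have "wf_plan k (V \<union> {y} \<union> set ys) p" using Cons.prems(4) by (simp only:)
  then have "wf_plan k (V \<union> {y}) (nbr_draws c ys p)"
    using Cons.prems by (intro Cons.IH) auto
  then show ?case using Cons.prems by simp
qed simp

lemma plan_size_nbr_draws: "plan_size s (nbr_draws c ys p) = reg s 1 ^ length ys * plan_size s p"
  by (induction ys) auto

text \<open>The exponent depends on the plan alone. It enters the word size constant
  \<open>d\<close>, which must be fixed before the data graph is known.\<close>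

lemma plan_size_polynomial:
  "\<exists>e. \<forall>s. 1 \<le> reg s 0 \<longrightarrow> reg s 1 \<le> reg s 0 \<longrightarrow> reg s 2 \<le> reg s 0 \<longrightarrow> plan_size s p \<le> (reg s 0 + 1) ^ e"
proof (induction p)
  case Done
  show ?case by (intro exI[of _ 0]) simp
next
  case (Draw r p)
  then obtain e where e: "\<And>s. 1 \<le> reg s 0 \<Longrightarrow> reg s 1 \<le> reg s 0 \<Longrightarrow> reg s 2 \<le> reg s 0 \<Longrightarrow> plan_size s p \<le> (reg s 0 + 1) ^ e" by blast
  have "plan_size s (Draw r p) \<le> (reg s 0 + 1) ^ (2 + e)" if s: "1 \<le> reg s 0" "reg s 1 \<le> reg s 0" "reg s 2 \<le> reg s 0" for s
  proof -
    have "radix s r \<le> 2 * reg s 0" using s by (cases r) auto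
    also have "\<dots> \<le> (reg s 0 + 1) ^ 2" by (simp add: power2_eq_square)
    finally have "radix s r \<le> (reg s 0 + 1) ^ 2" .
    from mult_le_mono[OF this e[OF s]] show ?thesis by (simp only: plan_size.simps power_add)
  qed
  then show ?case by blast
next
  case (Alt p q)
  then obtain e1 e2 where e: "\<And>s. 1 \<le> reg s 0 \<Longrightarrow> reg s 1 \<le> reg s 0 \<Longrightarrow> reg s 2 \<le> reg s 0 \<Longrightarrow> plan_size s p \<le> (reg s 0 + 1) ^ e1"
    "\<And>s. 1 \<le> reg s 0 \<Longrightarrow> reg s 1 \<le> reg s 0 \<Longrightarrow> reg s 2 \<le> reg s 0 \<Longrightarrow> plan_size s q \<le> (reg s 0 + 1) ^ e2" by blast
  have "plan_size s (Alt p q) \<le> (reg s 0 + 1) ^ (1 + (e1 + e2))" if s: "1 \<le> reg s 0" "reg s 1 \<le> reg s 0" "reg s 2 \<le> reg s 0" for s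
  proof -
    have "plan_size s p \<le> (reg s 0 + 1) ^ (e1 + e2)" "plan_size s q \<le> (reg s 0 + 1) ^ (e1 + e2)"
      using e[OF s] power_increasing[of e1 "e1 + e2" "reg s 0 + 1"] power_increasing[of e2 "e1 + e2" "reg s 0 + 1"] by auto
    then have "plan_size s (Alt p q) \<le> 2 * (reg s 0 + 1) ^ (e1 + e2)" by simp
    also have "\<dots> \<le> (reg s 0 + 1) ^ (1 + (e1 + e2))" using s(1) by simp
    finally show ?thesis .
  qed
  then show ?case by blast
qed

context pattern
begin

lemma embedding_arc: "\<psi> \<in> embeddings G \<Longrightarrow> (i, j) \<in> set es \<Longrightarrow> (\<psi> i, \<psi> j) \<in> arcs G"
  by (auto simp: embeddings_def arcs_def)

lemma multiplicity_arc_draws: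
  assumes "\<psi> \<in> embeddings G" "successively (\<lambda>i j. (i, j) \<in> set es) xs"
  shows "multiplicity (arcs G) s (arc_draws xs p) \<psi> = multiplicity (arcs G) s p \<psi>"
  using assms(2) by (induction xs p rule: arc_draws.induct) (auto simp: successively_Cons embedding_arc[OF assms(1)])

lemma multiplicity_nbr_draws:
  assumes "\<psi> \<in> embeddings G" "\<And>y. y \<in> set ys \<Longrightarrow> (c, y) \<in> set es"
  shows "multiplicity (arcs G) s (nbr_draws c ys p) \<psi> = multiplicity (arcs G) s p \<psi>"
  using assms(2) by (induction ys) (auto simp: embedding_arc[OF assms(1)])

text \<open>\<open>W\<close> is the vertex set of a component and \<open>F\<close> the factor it
  contributes. A component acts on the plan \<open>p\<close> for the vertices after it, since an
  \<open>Alt\<close> inside a cycle needs that plan at the end of both branches.\<close>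

definition coverable :: "nat set \<Rightarrow> (state \<Rightarrow> nat) \<Rightarrow> bool" where
  "coverable W F \<longleftrightarrow> (\<forall>V p. V \<inter> W = {} \<longrightarrow> wf_plan k (V \<union> W) p \<longrightarrow> (\<exists>p'. wf_plan k V p' \<and>
     (\<forall>s. plan_size s p' = F s * plan_size s p) \<and>
     (\<forall>G s \<psi>. \<psi> \<in> embeddings G \<longrightarrow> multiplicity (arcs G) s p' \<psi> = multiplicity (arcs G) s p \<psi>)))"

definition indices :: "'p ugraph \<Rightarrow> nat set" where
  "indices H = {i. i < k \<and> vx i \<in> verts H}"

lemma card_indices:
  assumes "verts H \<subseteq> verts P"
  shows "card (indices H) = card (verts H)"
proof -
  have "vx ` indices H = verts H"
    using vx assms by (auto simp: indices_def bij_betw_def)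
  moreover have "inj_on vx (indices H)" using vx_eq by (auto simp: indices_def inj_on_def)
  ultimately show ?thesis by (metis card_image)
qed

text \<open>An arc places the centre and one leaf; every other leaf is drawn as a neighbour of the
  centre.\<close>

lemma star_coverable:
  assumes "subgraph H P" "star_graph H"
  shows "coverable (indices H) (\<lambda>s. 2 * reg s 0 * reg s 1 ^ (card (verts H) - 2))"
proof -
  have sub: "verts H \<subseteq> verts P" "edges H \<subseteq> edges P" using assms(1) by (auto simp: subgraph_def)
  obtain c where c: "c \<in> verts H" "\<And>v. v \<in> verts H - {c} \<Longrightarrow> {c, v} \<in> edges H"
    using assms(2) by (auto simp: star_graph_def)
  obtain i where i: "i < k" "c = vx i" using c(1) sub vx_obtain by blast
  have fin: "finite (indices H)" by (simp add: indices_def)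
  obtain xs where xs: "set xs = indices H - {i}" "distinct xs" using fin finite_distinct_list by (metis finite_Diff)
  have iH: "i \<in> indices H" using i c by (simp add: indices_def)
  have "length xs = card (verts H) - 1"
    using xs iH fin card_indices[OF sub(1)] by (metis card_Diff_singleton distinct_card)
  moreover have "2 \<le> card (verts H)" using assms(2) by (simp add: star_graph_def)
  ultimately obtain y ys where ys: "xs = y # ys" "length ys = card (verts H) - 2" by (cases xs) auto
  have edge: "(i, j) \<in> set es" if "j \<in> set xs" for j
  proof -
    have j: "j < k" "vx j \<in> verts H" "j \<noteq> i" using that xs by (auto simp: indices_def)
    then have "vx j \<in> verts H - {c}" using vx_eq i by auto
    then have "{vx i, vx j} \<in> edges P" using c(2) sub(2) i(2) by auto
    then show ?thesis using es_edge i(1) j(1) by simp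
  qed
  show ?thesis unfolding coverable_def
  proof (intro allI impI)
    fix V p assume V: "V \<inter> indices H = {}" "wf_plan k (V \<union> indices H) p"
    let ?p = "Draw (Arc i y) (nbr_draws i ys p)"
    have iy: "indices H = {i, y} \<union> set ys" using xs(1) ys(1) iH by auto
    have "V \<union> indices H = V \<union> {i, y} \<union> set ys" unfolding iy by auto
    then have "wf_plan k (V \<union> {i, y} \<union> set ys) p" using V(2) by (simp only:)
    then have "wf_plan k (V \<union> {i, y}) (nbr_draws i ys p)"
      using xs ys V(1) iy by (intro wf_nbr_draws) auto
    moreover have "i \<noteq> y" "i \<notin> V" "y \<notin> V" using xs ys V(1) iy by auto
    ultimately have "wf_plan k V ?p" by simp
    moreover have "\<forall>s. plan_size s ?p = 2 * reg s 0 * reg s 1 ^ (card (verts H) - 2) * plan_size s p"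
      by (simp add: plan_size_nbr_draws ys(2))
    moreover have "\<forall>G s \<psi>. \<psi> \<in> embeddings G \<longrightarrow> multiplicity (arcs G) s ?p \<psi> = multiplicity (arcs G) s p \<psi>"
      using edge ys(1) by (simp add: multiplicity_nbr_draws embedding_arc)
    ultimately show "\<exists>p'. wf_plan k V p' \<and>
        (\<forall>s. plan_size s p' = 2 * reg s 0 * reg s 1 ^ (card (verts H) - 2) * plan_size s p) \<and>
        (\<forall>G s \<psi>. \<psi> \<in> embeddings G \<longrightarrow> multiplicity (arcs G) s p' \<psi> = multiplicity (arcs G) s p \<psi>)"
      by blast
  qed
qed

text \<open>The cycle is listed as z followed by \<open>ys\<close> of even length. If the image of z
  is light, a matching covers z and all of \<open>ys\<close> but the last vertex, which is drawn as
  a neighbour of z; if it is heavy, z comes from the heavy list and a matching covers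
  \<open>ys\<close>. The alternatives have S and 2 S times the same power of 2 m candidates, hence
  the factor 3.\<close>

lemma cycle_coverable:
  assumes "subgraph H P" "odd_cycle_graph H"
  shows "coverable (indices H) (\<lambda>s. 3 * reg s 2 * (2 * reg s 0) ^ (card (verts H) div 2))"
proof -
  have sub: "verts H \<subseteq> verts P" "edges H \<subseteq> edges P" using assms(1) by (auto simp: subgraph_def)
  obtain vs where vs: "distinct vs" "3 \<le> length vs" "odd (length vs)" "verts H = set vs"
    "edges H = {{vs ! i, vs ! (Suc i mod length vs)} | i. i < length vs}"
    using assms(2) by (auto simp: odd_cycle_graph_def)
  define f where "f = inv_into {..<k} vx"
  have f: "f v < k" "vx (f v) = v" if "v \<in> verts P" for v
    using bij_betw_inv_into_right[OF vx that] bij_betw_inv_into[OF vx] that by (auto simp: f_def bij_betw_def)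
  define xs where "xs = map f vs"
  have vsP: "vs ! i \<in> verts P" if "i < length vs" for i using that vs(4) sub(1) by auto
  have setxs: "set xs = indices H"
  proof
    show "set xs \<subseteq> indices H" using f vs(4) sub(1) by (auto simp: xs_def indices_def)
    show "indices H \<subseteq> set xs"
    proof
      fix i assume "i \<in> indices H"
      then have i: "i < k" "vx i \<in> set vs" using vs(4) by (auto simp: indices_def)
      then have "f (vx i) = i" using bij_betw_inv_into_left[OF vx] by (simp add: f_def)
      then show "i \<in> set xs" using i(2) by (force simp: xs_def)
    qed
  qed
  have dist: "distinct xs"
    unfolding xs_def distinct_map
  proof
    show "distinct vs" by fact
    show "inj_on f (set vs)" using f(2) vs(4) sub(1) by (metis inj_on_inverseI subsetD)
  qed
  have len: "length xs = length vs" "card (verts H) = length xs" using vs(1,4) by (auto simp: xs_def distinct_card)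
  have edge: "(xs ! i, xs ! (Suc i mod length xs)) \<in> set es" if "i < length xs" for i
  proof -
    have "0 < length vs" using vs(2) by linarith
    then have lt: "i < length vs" "Suc i mod length vs < length vs" using that len by simp_all
    have "{vs ! i, vs ! (Suc i mod length vs)} \<in> edges P" using vs(5) sub(2) lt(1) by blast
    then have "{vx (xs ! i), vx (xs ! (Suc i mod length vs))} \<in> edges P"
      using lt f(2) vsP by (simp add: xs_def)
    moreover have "xs ! i < k" "xs ! (Suc i mod length vs) < k" using lt f(1) vsP by (simp_all add: xs_def)
    ultimately show ?thesis using es_edge len(1) by simp
  qed
  obtain z ys where zy: "xs = z # ys" using vs(2) len by (cases xs) auto
  have l: "length vs = Suc (length ys)" using len zy by simp
  have ys: "even (length ys)" "ys \<noteq> []" "2 \<le> length ys" using vs(2,3) unfolding l by auto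
  have succ: "successively (\<lambda>i j. (i, j) \<in> set es) xs"
    unfolding successively_conv_nth using edge by (metis Suc_lessD mod_less)
  then have succ_ys: "successively (\<lambda>i j. (i, j) \<in> set es) ys"
    using ys(2) unfolding zy successively_Cons by blast
  have ysb: "ys = butlast ys @ [last ys]" using ys(2) by simp
  have "successively (\<lambda>i j. (i, j) \<in> set es) ((z # butlast ys) @ [last ys])" using succ zy ysb by simp
  then have succ_b: "successively (\<lambda>i j. (i, j) \<in> set es) (z # butlast ys)"
    unfolding successively_append_iff by blast
  \<comment> \<open>The edge that closes the cycle: the successor of the last position is taken
    modulo the length and is the position of z.\<close>
  have last: "(z, last ys) \<in> set es"
    using edge[of "length ys"] ys(2) by (simp add: zy last_conv_nth es_sym nth_Cons')
  have hlen: "card (verts H) div 2 = length ys div 2" using ys(1) unfolding len l by simp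
  show ?thesis unfolding coverable_def
  proof (intro allI impI)
    fix V p assume V: "V \<inter> indices H = {}" "wf_plan k (V \<union> indices H) p"
    let ?light = "arc_draws (z # butlast ys) (Draw (Light z (last ys)) p)"
    let ?heavy = "Draw (Heavy z) (arc_draws ys p)"
    have W: "indices H = set (z # butlast ys) \<union> {last ys}" using setxs zy arg_cong[OF ysb, of set] by auto
    have disj: "last ys \<notin> set (z # butlast ys)" "distinct (z # butlast ys)"
      using dist zy ysb by (metis distinct.simps(2) distinct_append disjoint_insert(1) list.set(2) append_Cons Int_commute)+
    have wl: "wf_plan k V ?light"
    proof (rule wf_arc_draws)
      show "even (length (z # butlast ys))" using ys by simp
      show "distinct (z # butlast ys)" by (rule disj)
      show "set (z # butlast ys) \<inter> V = {}" using V(1) W by auto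
      have "V \<union> indices H = V \<union> set (z # butlast ys) \<union> {last ys}" unfolding W by auto
      then have "wf_plan k (V \<union> set (z # butlast ys) \<union> {last ys}) p" using V(2) by (simp only:)
      moreover have "last ys \<notin> V" using V(1) W by auto
      ultimately show "wf_plan k (V \<union> set (z # butlast ys)) (Draw (Light z (last ys)) p)" using disj(1) by simp
    qed
    have wh: "wf_plan k V ?heavy"
    proof -
      have "V \<union> indices H = V \<union> {z} \<union> set ys" using setxs zy by auto
      then have "wf_plan k (V \<union> {z} \<union> set ys) p" using V(2) by (simp only:)
      then have "wf_plan k (V \<union> {z}) (arc_draws ys p)"
        using ys dist zy V(1) setxs by (intro wf_arc_draws) auto
      then show ?thesis using V(1) setxs zy by auto
    qed
    have "plan_size s (Alt ?light ?heavy) = 3 * reg s 2 * (2 * reg s 0) ^ (card (verts H) div 2) * plan_size s p" for s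
    proof -
      have "length (z # butlast ys) = length ys" using ys by simp
      then show ?thesis unfolding hlen by (simp add: plan_size_arc_draws del: length_Cons)
    qed
    \<comment> \<open>The degree of the image of z selects exactly one of the two
      alternatives.\<close>
    moreover have "multiplicity (arcs G) s (Alt ?light ?heavy) \<psi> = multiplicity (arcs G) s p \<psi>"
      if "\<psi> \<in> embeddings G" for G s \<psi>
      using embedding_arc[OF that last]
      by (simp add: multiplicity_arc_draws[OF that succ_b] multiplicity_arc_draws[OF that succ_ys] not_le[symmetric])
    ultimately show "\<exists>p'. wf_plan k V p' \<and>
        (\<forall>s. plan_size s p' = 3 * reg s 2 * (2 * reg s 0) ^ (card (verts H) div 2) * plan_size s p) \<and>
        (\<forall>G s \<psi>. \<psi> \<in> embeddings G \<longrightarrow> multiplicity (arcs G) s p' \<psi> = multiplicity (arcs G) s p \<psi>)"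
      using wl wh by (intro exI[of _ "Alt ?light ?heavy"]) simp
  qed
qed

text \<open>The plan is built backwards: first one for the remaining components, starting from
  \<open>V \<union> W\<close>, and then the component \<open>W\<close> is put in front of
  it.\<close>

lemma coverable_list:
  assumes "\<And>W F. (W, F) \<in> set Ws \<Longrightarrow> coverable W F"
    and "\<And>i j. i < j \<Longrightarrow> j < length Ws \<Longrightarrow> fst (Ws ! i) \<inter> fst (Ws ! j) = {}"
    and "V \<inter> (\<Union>x\<in>set Ws. fst x) = {}" "V \<union> (\<Union>x\<in>set Ws. fst x) = {..<k}"
  shows "\<exists>p. wf_plan k V p \<and> (\<forall>s. plan_size s p = (\<Prod>x\<leftarrow>Ws. snd x s)) \<and>
    (\<forall>G s \<psi>. \<psi> \<in> embeddings G \<longrightarrow> multiplicity (arcs G) s p \<psi> = 1)"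
  using assms
proof (induction Ws arbitrary: V)
  case Nil
  then show ?case by (intro exI[of _ Done]) simp
next
  case (Cons x Ws)
  obtain W F where x: "x = (W, F)" by force
  have disj: "W \<inter> fst y = {}" if "y \<in> set Ws" for y
  proof -
    obtain j where j: "j < length Ws" "y = Ws ! j" using \<open>y \<in> set Ws\<close> by (metis in_set_conv_nth)
    then show ?thesis using Cons.prems(2)[of 0 "Suc j"] by (simp add: x)
  qed
  have "\<exists>p. wf_plan k (V \<union> W) p \<and> (\<forall>s. plan_size s p = (\<Prod>x\<leftarrow>Ws. snd x s)) \<and>
    (\<forall>G s \<psi>. \<psi> \<in> embeddings G \<longrightarrow> multiplicity (arcs G) s p \<psi> = 1)"
  proof (rule Cons.IH)
    show "coverable W' F'" if "(W', F') \<in> set Ws" for W' F' using Cons.prems(1) that by simp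
    show "fst (Ws ! i) \<inter> fst (Ws ! j) = {}" if "i < j" "j < length Ws" for i j
      using Cons.prems(2)[of "Suc i" "Suc j"] that by simp
    show "(V \<union> W) \<inter> (\<Union>x\<in>set Ws. fst x) = {}" using Cons.prems(3) disj by (auto simp: x)
    show "V \<union> W \<union> (\<Union>x\<in>set Ws. fst x) = {..<k}" using Cons.prems(4) by (simp add: x Un_assoc)
  qed
  then obtain p where p: "wf_plan k (V \<union> W) p" "\<forall>s. plan_size s p = (\<Prod>x\<leftarrow>Ws. snd x s)"
    "\<forall>G s \<psi>. \<psi> \<in> embeddings G \<longrightarrow> multiplicity (arcs G) s p \<psi> = 1" by blast
  have "coverable W F" using Cons.prems(1) by (simp add: x)
  moreover have "V \<inter> W = {}" using Cons.prems(3) by (auto simp: x)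
  ultimately obtain p' where "wf_plan k V p'" "\<forall>s. plan_size s p' = F s * plan_size s p"
    "\<forall>G s \<psi>. \<psi> \<in> embeddings G \<longrightarrow> multiplicity (arcs G) s p' \<psi> = multiplicity (arcs G) s p \<psi>"
    using p(1) unfolding coverable_def by blast
  then show ?case using p by (intro exI[of _ p']) (simp add: x)
qed

text \<open>Otherwise everything reachable from a vertex of \<open>V\<close> would stay in
  \<open>V\<close>, contradicting connectedness.\<close>

lemma crossing_edge:
  assumes "V \<subseteq> {..<k}" "V \<noteq> {}" "V \<noteq> {..<k}"
  shows "\<exists>i j. (i, j) \<in> set es \<and> i \<in> V \<and> j \<notin> V"
proof (rule ccontr)
  assume no: "\<not> ?thesis"
  obtain a b where ab: "a \<in> V" "b < k" "b \<notin> V" using assms by blast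
  have "y \<in> vx ` V" if "(vx a, y) \<in> {(x, y). {x, y} \<in> edges P}\<^sup>*" for y
    using that
  proof (induction rule: rtrancl_induct)
    case base
    then show ?case using ab(1) by blast
  next
    case (step y z)
    then obtain i where i: "i \<in> V" "y = vx i" by blast
    have "z \<in> verts P" using step(2) P(1) by (fastforce simp: simple_graph_def doubleton_eq_iff)
    then obtain j where j: "j < k" "z = vx j" by (rule vx_obtain)
    have "(i, j) \<in> set es" using step(2) i j assms(1) es_edge by auto
    then show ?case using no i j by blast
  qed
  moreover have "(vx a, vx b) \<in> {(x, y). {x, y} \<in> edges P}\<^sup>*"
    using P(2) vx_vert ab assms(1) by (auto simp: connected_graph_def)
  ultimately obtain i where "i \<in> V" "vx b = vx i" by blast
  then show False using vx_eq[of b i] ab assms(1) by auto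
qed

text \<open>Repeatedly taking a crossing edge follows a spanning tree without constructing one
  beforehand.\<close>

lemma tree_plan_from:
  assumes "V \<subseteq> {..<k}" "V \<noteq> {}"
  shows "\<exists>p. wf_plan k V p \<and> (\<forall>s. plan_size s p = reg s 1 ^ (k - card V)) \<and>
    (\<forall>G s \<psi>. \<psi> \<in> embeddings G \<longrightarrow> multiplicity (arcs G) s p \<psi> = 1)"
  using assms
proof (induction "k - card V" arbitrary: V rule: less_induct)
  case less
  show ?case
  proof (cases "V = {..<k}")
    case True
    then show ?thesis by (intro exI[of _ Done]) simp
  next
    case False
    obtain i j where ij: "(i, j) \<in> set es" "i \<in> V" "j \<notin> V" using crossing_edge less.prems False by blast
    have fin: "finite V" using less.prems(1) finite_subset by blast
    have sub: "insert j V \<subseteq> {..<k}" using less.prems(1) es_less[OF ij(1)] by simp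
    have "card (insert j V) \<le> k" using card_mono[OF _ sub] by simp
    then have c: "k - card V = Suc (k - card (insert j V))" using fin ij(3) by simp
    obtain p where p: "wf_plan k (insert j V) p" "\<forall>s. plan_size s p = reg s 1 ^ (k - card (insert j V))"
      "\<forall>G s \<psi>. \<psi> \<in> embeddings G \<longrightarrow> multiplicity (arcs G) s p \<psi> = 1"
      using less.hyps[of "insert j V"] sub c by auto
    have "wf_plan k V (Draw (Nbr i j) p)" using p(1) ij by simp
    moreover have "\<forall>s. plan_size s (Draw (Nbr i j) p) = reg s 1 ^ (k - card V)" using p(2) by (simp add: c)
    moreover have "\<forall>G s \<psi>. \<psi> \<in> embeddings G \<longrightarrow> multiplicity (arcs G) s (Draw (Nbr i j) p) \<psi> = 1"
      using p(3) embedding_arc ij(1) by simp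
    ultimately show ?thesis by blast
  qed
qed

lemma tree_plan:
  "\<exists>p. wf_plan k {} p \<and> (\<forall>s. plan_size s p = 2 * reg s 0 * reg s 1 ^ (k - 2)) \<and>
    (\<forall>G s \<psi>. \<psi> \<in> embeddings G \<longrightarrow> multiplicity (arcs G) s p \<psi> = 1)"
proof -
  obtain j where j: "(0, j) \<in> set es" using es_neighbour[of 0] k by auto
  have ne: "0 \<noteq> j" using es_irrefl[OF j] .
  obtain p where p: "wf_plan k {0, j} p" "\<forall>s. plan_size s p = reg s 1 ^ (k - card {0, j})"
    "\<forall>G s \<psi>. \<psi> \<in> embeddings G \<longrightarrow> multiplicity (arcs G) s p \<psi> = 1"
    using tree_plan_from[of "{0, j}"] es_less[OF j] by auto
  have "wf_plan k {} (Draw (Arc 0 j) p)" using p(1) ne by simp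
  moreover have c: "card {0, j} = 2" using ne by simp
  have "\<forall>s. plan_size s (Draw (Arc 0 j) p) = 2 * reg s 0 * reg s 1 ^ (k - 2)"
    using p(2) unfolding c by simp
  moreover have "\<forall>G s \<psi>. \<psi> \<in> embeddings G \<longrightarrow> multiplicity (arcs G) s (Draw (Arc 0 j) p) \<psi> = 1"
    using p(3) embedding_arc j by simp
  ultimately show ?thesis by blast
qed

lemma decomposition_plan:
  assumes "fec_decomposition P Cs Ss"
  shows "\<exists>p. wf_plan k {} p \<and>
    (\<forall>s. plan_size s p = (\<Prod>C\<leftarrow>Cs. 3 * reg s 2 * (2 * reg s 0) ^ (card (verts C) div 2)) *
      (\<Prod>S\<leftarrow>Ss. 2 * reg s 0 * reg s 1 ^ (card (verts S) - 2))) \<and>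
    (\<forall>G s \<psi>. \<psi> \<in> embeddings G \<longrightarrow> multiplicity (arcs G) s p \<psi> = 1)"
proof -
  define Fc where "Fc C s = 3 * reg s 2 * (2 * reg s 0) ^ (card (verts C) div 2)" for C :: "'p ugraph" and s :: state
  define Fs where "Fs S s = 2 * reg s 0 * reg s 1 ^ (card (verts S) - 2)" for S :: "'p ugraph" and s :: state
  define Ws where "Ws = map (\<lambda>C. (indices C, Fc C)) Cs @ map (\<lambda>S. (indices S, Fs S)) Ss"
  have sub: "\<And>H. H \<in> set (Cs @ Ss) \<Longrightarrow> subgraph H P"
    and disj: "\<And>i j. i < j \<Longrightarrow> j < length (Cs @ Ss) \<Longrightarrow> verts ((Cs @ Ss) ! i) \<inter> verts ((Cs @ Ss) ! j) = {}"
    and un: "(\<Union>H\<in>set (Cs @ Ss). verts H) = verts P"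
    and C: "\<And>C. C \<in> set Cs \<Longrightarrow> odd_cycle_graph C" and S: "\<And>S. S \<in> set Ss \<Longrightarrow> star_graph S"
    using assms unfolding fec_decomposition_def by blast+
  have fst_Ws: "fst (Ws ! i) = indices ((Cs @ Ss) ! i)" if "i < length (Cs @ Ss)" for i
    using that by (auto simp: Ws_def nth_append)
  have "\<exists>p. wf_plan k {} p \<and> (\<forall>s. plan_size s p = (\<Prod>x\<leftarrow>Ws. snd x s)) \<and>
    (\<forall>G s \<psi>. \<psi> \<in> embeddings G \<longrightarrow> multiplicity (arcs G) s p \<psi> = 1)"
  proof (rule coverable_list)
    show "coverable W F" if "(W, F) \<in> set Ws" for W F
    proof -
      have "(\<exists>C\<in>set Cs. W = indices C \<and> F = Fc C) \<or> (\<exists>S\<in>set Ss. W = indices S \<and> F = Fs S)"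
        using that by (auto simp: Ws_def)
      then show ?thesis
      proof (elim disjE bexE conjE)
        fix H assume H: "H \<in> set Cs" "W = indices H" "F = Fc H"
        then show ?thesis using cycle_coverable[OF sub C, of H] by (simp add: Fc_def[abs_def])
      next
        fix H assume H: "H \<in> set Ss" "W = indices H" "F = Fs H"
        then show ?thesis using star_coverable[OF sub S, of H] by (simp add: Fs_def[abs_def])
      qed
    qed
    show "fst (Ws ! i) \<inter> fst (Ws ! j) = {}" if "i < j" "j < length Ws" for i j
    proof -
      have "j < length (Cs @ Ss)" using that by (simp add: Ws_def)
      then show ?thesis using disj[of i j] that fst_Ws[of i] fst_Ws[of j] by (auto simp: indices_def)
    qed
    have "(\<Union>x\<in>set Ws. fst x) = (\<Union>H\<in>set (Cs @ Ss). indices H)" by (auto simp: Ws_def)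
    also have "\<dots> = {i. i < k \<and> vx i \<in> (\<Union>H\<in>set (Cs @ Ss). verts H)}" by (auto simp: indices_def)
    also have "\<dots> = {..<k}" unfolding un using vx_vert by auto
    finally show "{} \<union> (\<Union>x\<in>set Ws. fst x) = {..<k}" by simp
  qed simp
  moreover have "(\<Prod>x\<leftarrow>Ws. snd x s) = (\<Prod>C\<leftarrow>Cs. Fc C s) * (\<Prod>S\<leftarrow>Ss. Fs S s)" for s
    by (simp add: Ws_def o_def)
  ultimately show ?thesis by (simp add: Fc_def Fs_def)
qed

end

section \<open>Running time\<close>

lemma within_bounds_arcs:
  assumes G: "simple_graph G" "\<And>v. v \<in> verts G \<Longrightarrow> vdegree G v \<le> reg s 1"
    and s: "indexed (arcs G) s" "reg s 0 \<le> reg s 2 * reg s 2"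
  shows "within_bounds s"
proof -
  have "edges G \<subseteq> Pow (verts G)" using G(1) by (auto simp: simple_graph_def)
  then have fin_edges: "finite (edges G)" using G(1) by (auto simp: simple_graph_def intro: finite_subset)
  have bij: "bij_betw (\<lambda>d. (mem s d, mem s (flip d))) {..<2 * reg s 0} (arcs G)" using s(1) by (simp add: indexed_def)
  then have fin: "finite (arcs G)" and card: "card (arcs G) = 2 * reg s 0"
    using bij_betw_finite bij_betw_same_card by fastforce+
  have deg: "tab s 0 (u, 0) = card (arcs G `` {u})" for u
    using s(1) bij_betw_same_card[of _ "{..<tab s 0 (u, 0)}"] by (fastforce simp: indexed_def tables_def)
  have "tab s 0 (u, 0) \<le> reg s 1" for u
  proof (cases "u \<in> verts G")
    case True
    have "card ((\<lambda>v. {u, v}) ` (arcs G `` {u})) \<le> vdegree G u"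
      unfolding vdegree_def using fin_edges by (intro card_mono) (auto simp: arcs_def)
    moreover have "inj_on (\<lambda>v. {u, v}) (arcs G `` {u})" by (auto simp: inj_on_def doubleton_eq_iff)
    ultimately show ?thesis using G(2)[OF True] by (simp add: deg card_image)
  next
    case False
    then have "arcs G `` {u} = {}" using G(1) by (fastforce simp: arcs_def simple_graph_def doubleton_eq_iff)
    then show ?thesis by (simp add: deg)
  qed
  moreover have "reg s 3 \<le> 2 * reg s 2"
  proof -
    define B where "B = {u. reg s 2 < tab s 0 (u, 0)}"
    have B: "reg s 3 = card B"
      using s(1) bij_betw_same_card[of _ "{..<reg s 3}"] by (fastforce simp: indexed_def tables_def B_def)
    have "B \<subseteq> fst ` arcs G"
    proof
      fix u assume "u \<in> B"
      then have "arcs G `` {u} \<noteq> {}" using deg[of u] by (metis B_def card.empty mem_Collect_eq not_less0)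
      then show "u \<in> fst ` arcs G" by force
    qed
    then have finB: "finite B" using fin finite_surj by blast
    \<comment> \<open>Double counting: each heavy vertex has at least S + 1 arcs, and there are 2 m
      \<le> 2 S^2 \<le> 2 S (S + 1) arcs in all. Cancelling S + 1 leaves 2 S.\<close>
    have "card B * (reg s 2 + 1) \<le> (\<Sum>u\<in>B. card (arcs G `` {u}))"
      using sum_bounded_below[of B "reg s 2 + 1" "\<lambda>u. card (arcs G `` {u})"] by (fastforce simp: B_def deg)
    also have "\<dots> = card (Sigma B (\<lambda>u. arcs G `` {u}))"
      using finB fin by (simp add: finite_Image)
    also have "\<dots> \<le> card (arcs G)" using fin by (intro card_mono) auto
    also have "\<dots> \<le> 2 * (reg s 2 * reg s 2)" using s(2) card by simp
    also have "\<dots> \<le> (2 * reg s 2) * (reg s 2 + 1)" by simp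
    finally show ?thesis unfolding B by (rule mult_right_le_imp_le) simp
  qed
  ultimately show ?thesis by (simp add: within_bounds_def)
qed

lemma card_odd_cycle: "odd_cycle_graph C \<Longrightarrow> odd (card (verts C))"
  by (auto simp: odd_cycle_graph_def distinct_card)

text \<open>S - 1 is below sqrt m and 1 is at most sqrt m, so S is at most 2 sqrt m. For n = 2 r + 1
  this gives 3 S (2 m)^r \<le> 6 * 2^r * m^(n / 2), and r is at most \<open>k\<close>.\<close>

lemma cycles_bound:
  fixes m S k :: nat
  assumes "1 \<le> m" "(S - 1) * (S - 1) < m"
    and "\<And>C. C \<in> set Cs \<Longrightarrow> odd (card (verts C)) \<and> card (verts C) \<le> k"
  shows "real (\<Prod>C\<leftarrow>Cs. 3 * S * (2 * m) ^ (card (verts C) div 2)) \<le>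
    (6 * 2 ^ k) ^ length Cs * real m powr (real (total_verts Cs) / 2)"
  using assms(3)
proof (induction Cs)
  case Nil
  then show ?case using assms(1) by (simp add: total_verts_def)
next
  case (Cons C Cs)
  define n where "n = card (verts C)"
  define r where "r = n div 2"
  have n: "n = 2 * r + 1" "n \<le> k" using Cons.prems[of C] by (auto simp: n_def r_def)
  have "real (S - 1) \<le> sqrt m"
    using assms(2) by (intro real_le_rsqrt) (metis less_imp_le of_nat_le_iff of_nat_mult power2_eq_square)
  moreover have "1 \<le> sqrt m" using assms(1) by simp
  ultimately have "real S \<le> 2 * sqrt m" by linarith
  then have "real (3 * S * (2 * m) ^ r) \<le> 3 * (2 * sqrt m) * (2 * m) ^ r"
    by (simp add: mult_right_mono)
  also have "\<dots> = 6 * 2 ^ r * (m powr (1 / 2) * m powr r)"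
    using assms(1) by (simp add: powr_half_sqrt powr_realpow power_mult_distrib)
  also have "\<dots> = 6 * 2 ^ r * m powr (n / 2)"
    by (simp add: powr_add[symmetric] n(1) add_divide_distrib add.commute)
  also have "\<dots> \<le> 6 * 2 ^ k * m powr (n / 2)"
    using n by (intro mult_right_mono mult_left_mono power_increasing) auto
  finally have "real (3 * S * (2 * m) ^ r) * real (\<Prod>C\<leftarrow>Cs. 3 * S * (2 * m) ^ (card (verts C) div 2)) \<le>
      (6 * 2 ^ k * m powr (n / 2)) * ((6 * 2 ^ k) ^ length Cs * real m powr (real (total_verts Cs) / 2))"
    using Cons by (intro mult_mono) auto
  also have "\<dots> = (6 * 2 ^ k) ^ length (C # Cs) * (m powr (n / 2) * real m powr (real (total_verts Cs) / 2))"
    by simp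
  also have "m powr (n / 2) * real m powr (real (total_verts Cs) / 2) = m powr (real (total_verts (C # Cs)) / 2)"
    by (simp add: powr_add[symmetric] total_verts_def n_def add_divide_distrib)
  finally show ?case by (simp only: list.map prod_list.Cons of_nat_mult n_def r_def)
qed

lemma stars_bound:
  fixes m l :: nat
  assumes "1 \<le> m" "1 \<le> l" and "\<And>S. S \<in> set Ss \<Longrightarrow> 2 \<le> card (verts S)"
  shows "real (\<Prod>S\<leftarrow>Ss. 2 * m * l ^ (card (verts S) - 2)) =
    2 ^ length Ss * (real m powr length Ss * real l powr (real (total_verts Ss) - 2 * length Ss))"
  using assms(3)
proof (induction Ss)
  case Nil
  then show ?case using assms(1,2) by (simp add: total_verts_def)
next
  case (Cons S Ss)
  define n where "n = card (verts S)"
  have "2 \<le> n" using Cons.prems[of S] by (simp add: n_def)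
  then have "real (2 * m * l ^ (n - 2)) = 2 * (m powr 1 * l powr (real n - 2))"
    using assms(1,2) by (simp add: powr_realpow[symmetric] of_nat_diff)
  then have "real (\<Prod>S\<leftarrow>S # Ss. 2 * m * l ^ (card (verts S) - 2)) =
      2 * (m powr 1 * l powr (real n - 2)) *
      (2 ^ length Ss * (real m powr length Ss * real l powr (real (total_verts Ss) - 2 * length Ss)))"
    using Cons by (simp only: list.map prod_list.Cons of_nat_mult n_def) simp
  also have "\<dots> = 2 ^ length (S # Ss) * ((m powr 1 * real m powr length Ss) *
      (l powr (real n - 2) * real l powr (real (total_verts Ss) - 2 * length Ss)))" by simp
  also have "\<dots> = 2 ^ length (S # Ss) * (real m powr length (S # Ss) * real l powr (real (total_verts (S # Ss)) - 2 * length (S # Ss)))"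
    by (simp only: powr_add[symmetric]) (simp add: total_verts_def n_def algebra_simps)
  finally show ?case .
qed

text \<open>The guard has the same value in all states of \<open>D\<close>, so every operation takes
  the same branch.\<close>

lemma answers_If:
  assumes "\<And>s. D s \<Longrightarrow> bval w b (s\<lparr>out := []\<rparr>) = v" "answers w (if v then c1 else c2) D p B" "0 \<le> B"
  shows "answers w (If b c1 c2) D p (1 + B)"
  unfolding answers_def
proof (intro allI impI)
  fix s assume s: "D s"
  obtain M where M: "exec w (if v then c1 else c2) (s\<lparr>out := []\<rparr>) = spmf_of_pmf M"
    "\<forall>r\<in>set_pmf M. D (fst r)" "map_pmf (\<lambda>r. decode (out (fst r))) M = p"
    "(\<integral>\<^sup>+r. of_nat (snd r) \<partial>measure_pmf M) \<le> ennreal B"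
    using assms(2) s unfolding answers_def by blast
  define R where "R = map_pmf (\<lambda>r. (fst r, 1 + snd r)) M"
  have "exec w (If b c1 c2) (s\<lparr>out := []\<rparr>) = bind_spmf (exec w (if v then c1 else c2) (s\<lparr>out := []\<rparr>))
      (\<lambda>(s1, t1). return_spmf (s1, 1 + t1))"
    using assms(1)[OF s] by simp
  also have "\<dots> = spmf_of_pmf R"
    unfolding M(1) by (simp add: R_def case_prod_unfold map_pmf_def spmf_of_pmf_bind)
  finally have "exec w (If b c1 c2) (s\<lparr>out := []\<rparr>) = spmf_of_pmf R" .
  moreover have "\<forall>r\<in>set_pmf R. D (fst r)" using M(2) by (auto simp: R_def)
  moreover have "map_pmf (\<lambda>r. decode (out (fst r))) R = p" using M(3) by (simp add: R_def pmf.map_comp o_def)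
  moreover have "(\<integral>\<^sup>+r. of_nat (snd r) \<partial>measure_pmf R) \<le> ennreal (1 + B)"
    using M(4) assms(3) by (simp add: R_def nn_integral_add ennreal_plus add_left_mono)
  ultimately show "\<exists>M. exec w (If b c1 c2) (s\<lparr>out := []\<rparr>) = spmf_of_pmf M \<and> (\<forall>r\<in>set_pmf M. D (fst r)) \<and>
      map_pmf (\<lambda>r. decode (out (fst r))) M = p \<and> (\<integral>\<^sup>+r. of_nat (snd r) \<partial>measure_pmf M) \<le> ennreal (1 + B)"
    by blast
qed

lemma answers_mono: "answers w c D p B \<Longrightarrow> B \<le> B' \<Longrightarrow> answers w c D p B'"
  unfolding answers_def by (meson ennreal_leI order_trans)

lemma (in sampler) max_OUT_le: "max 1 (OUT P G) \<le> plan_size s p"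
  using OUT_le card_mono[OF _ A_subset] N_pos by (simp add: N_def)

definition sample_cost :: "nat \<Rightarrow> (nat \<times> nat) list \<Rightarrow> plan \<Rightarrow> nat" where
  "sample_cost k es p = cost (prepare p) + 2 * (1 + cost (attempt k es p)) + 3"

text \<open>\<open>q\<close> stands for the polymatroid bound and \<open>a\<close> for the constant
  by which the plan may exceed it. The unit spent on the guard is absorbed because the plan has at
  least max 1 OUT candidates.\<close>

lemma (in sampler) answers_If_sample:
  assumes "\<And>s'. same_data s s' \<Longrightarrow> bval w b (s'\<lparr>out := []\<rparr>) = v"
    and "(if v then c1 else c2) = sample k es p"
    and "real (plan_size s p) \<le> a * q" "real (Suc (sample_cost k es p)) * a \<le> K" "0 \<le> q"
  shows "answers w (If b c1 c2) (same_data s) (sampling_outcome P G) (K * (q / max 1 (OUT P G)))"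
proof -
  let ?o = "real (max 1 (OUT P G))"
  have o: "0 < ?o" by simp
  have "answers w (If b c1 c2) (same_data s) (sampling_outcome P G) (1 + sample_cost k es p * (plan_size s p / ?o))"
    using sampler_answers assms(1,2) by (intro answers_If[where v = v]) (auto simp: sample_cost_def)
  moreover have "1 + sample_cost k es p * (plan_size s p / ?o) \<le> K * (q / ?o)"
  proof -
    define x where "x = plan_size s p / ?o"
    have "1 \<le> x" unfolding x_def le_divide_eq_1_pos[OF o] using max_OUT_le by (simp only: of_nat_le_iff)
    then have "1 + sample_cost k es p * x \<le> Suc (sample_cost k es p) * x"
      by (simp add: distrib_right)
    then have "1 + sample_cost k es p * (plan_size s p / ?o) \<le> Suc (sample_cost k es p) * (plan_size s p / ?o)"
      unfolding x_def .
    also have "\<dots> \<le> Suc (sample_cost k es p) * (a * q / ?o)"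
      using assms(3) by (intro mult_left_mono divide_right_mono) auto
    also have "\<dots> = (Suc (sample_cost k es p) * a) * (q / ?o)" by simp
    also have "\<dots> \<le> K * (q / ?o)"
      using assms(4,5) by (intro mult_right_mono) auto
    finally show ?thesis .
  qed
  ultimately show ?thesis by (rule answers_mono)
qed

lemma (in pattern) samplerI:
  assumes "simple_graph G" "indexed (arcs G) s" "within_bounds s" "valid w s" "plan_size s p < 2 ^ w" "k < 2 ^ w"
    and "wf_plan k {} p" "\<And>\<psi>. \<psi> \<in> embeddings G \<Longrightarrow> multiplicity (arcs G) s p \<psi> = 1"
  shows "sampler P k vx es w s p G"
proof (unfold_locales)
  show "legals s p x \<phi> = legals s p x (\<lambda>_. 0)" for x \<phi>
    \<comment> \<open>The plan starts with no vertex placed, so any two initial assignments agree on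
      the empty set.\<close>
    using fill_cong[OF assms(7), of \<phi> "\<lambda>_. 0"] by blast
  show "fill s p x \<phi> i = fill s p x (\<lambda>_. 0) i" if "i < k" for x \<phi> i
    using fill_cong[OF assms(7), of \<phi> "\<lambda>_. 0"] that by blast
qed (use assms es_less in auto)

theorem theorem5p2:
  fixes P :: "'p ugraph" and Cs Ss :: "'p ugraph list"
  assumes "simple_graph P" and "connected_graph P" and "card (verts P) \<ge> 2"
    and "fec_decomposition P Cs Ss"
  shows "\<exists>(build :: com) (query :: com) (d :: nat) (K :: real).
    \<forall>(G :: nat ugraph) (l :: nat) (es :: (nat \<times> nat) list) (w :: nat).
      simple_graph G \<and> card (edges G) \<ge> 1 \<and> 1 \<le> l \<and> l \<le> card (edges G) \<and>
      (\<forall>v\<in>verts G. vdegree G v \<le> l) \<and> edge_list G es \<and> word_fits d w G \<longrightarrow>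
      sampling_structure P G w build query (input_state es l)
        (K * real (card (edges G)))
        (K * (polymat_undir (card (edges G)) l P Cs Ss / real (max 1 (OUT P G))))"
proof -
  define k where "k = card (verts P)"
  have finP: "finite (verts P)" using assms(1) by (simp add: simple_graph_def)
  obtain vx where vx: "bij_betw vx {..<k} (verts P)"
    using ex_bij_betw_nat_finite[OF finP] unfolding k_def lessThan_atLeast0 by blast
  have "finite {(i, j). i < k \<and> j < k \<and> {vx i, vx j} \<in> edges P}"
    by (rule finite_subset[of _ "{..<k} \<times> {..<k}"]) auto
  then obtain pes where pes: "set pes = {(i, j). i < k \<and> j < k \<and> {vx i, vx j} \<in> edges P}"
    using finite_list by blast
  interpret pattern P k vx pes
    using assms vx pes by unfold_locales (auto simp: k_def)
  obtain pA where pA: "wf_plan k {} pA" "\<And>s. plan_size s pA = 2 * reg s 0 * reg s 1 ^ (k - 2)"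
    "\<And>G s \<psi>. \<psi> \<in> embeddings G \<Longrightarrow> multiplicity (arcs G) s pA \<psi> = 1"
    using tree_plan by blast
  obtain pB where pB: "wf_plan k {} pB"
    "\<And>s. plan_size s pB = (\<Prod>C\<leftarrow>Cs. 3 * reg s 2 * (2 * reg s 0) ^ (card (verts C) div 2)) *
      (\<Prod>S\<leftarrow>Ss. 2 * reg s 0 * reg s 1 ^ (card (verts S) - 2))"
    "\<And>G s \<psi>. \<psi> \<in> embeddings G \<Longrightarrow> multiplicity (arcs G) s pB \<psi> = 1"
    using decomposition_plan[OF assms(4)] by blast
  obtain eA where eA: "\<And>s. 1 \<le> reg s 0 \<Longrightarrow> reg s 1 \<le> reg s 0 \<Longrightarrow> reg s 2 \<le> reg s 0 \<Longrightarrow> plan_size s pA \<le> (reg s 0 + 1) ^ eA"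
    using plan_size_polynomial by blast
  obtain eB where eB: "\<And>s. 1 \<le> reg s 0 \<Longrightarrow> reg s 1 \<le> reg s 0 \<Longrightarrow> reg s 2 \<le> reg s 0 \<Longrightarrow> plan_size s pB \<le> (reg s 0 + 1) ^ eB"
    using plan_size_polynomial by blast
  have Cs: "odd (card (verts C)) \<and> card (verts C) \<le> k" if "C \<in> set Cs" for C
  proof -
    have "verts C \<subseteq> verts P" "odd_cycle_graph C" using assms(4) that by (auto simp: fec_decomposition_def subgraph_def)
    then show ?thesis using card_odd_cycle card_mono[OF finP] by (simp add: k_def)
  qed
  have Ss: "2 \<le> card (verts S)" if "S \<in> set Ss" for S
    using assms(4) that by (auto simp: fec_decomposition_def star_graph_def)
  \<comment> \<open>The test \<lambda> > sqrt m in integer arithmetic. It is made by the query,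
    since the program is fixed before m and \<lambda> are known.\<close>
  define b where "b = Less (Reg 0) (Mul (Reg 1) (Reg 1))"
  define query where "query = If b (sample k pes pB) (sample k pes pA)"
  \<comment> \<open>\<open>eA\<close> and \<open>eB\<close> make the candidate numbers fit in a
    word, \<open>k\<close> the number of pattern vertices, and 3 makes (m + 1)^2 fit. Exponents must
    stay strictly below \<open>d\<close>, which itself yields only a weak inequality.\<close>
  define d where "d = eA + eB + k + 3"
  define cB :: real where "cB = (6 * 2 ^ k) ^ length Cs * 2 ^ length Ss"
  \<comment> \<open>The summands pay for building, for the tree plan, whose factor 2 counts the
    orientations of its first edge, and for the decomposition plan.\<close>
  define K where "K = real (6 + 2 * cost insert_arc) + real (Suc (sample_cost k pes pA)) * 2 + real (Suc (sample_cost k pes pB)) * cB"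
  have cB: "0 \<le> cB" by (simp add: cB_def)
  have "sampling_structure P G w preprocess query (input_state es l) (K * real (card (edges G)))
      (K * (polymat_undir (card (edges G)) l P Cs Ss / real (max 1 (OUT P G))))"
    if asm: "simple_graph G" "card (edges G) \<ge> 1" "1 \<le> l" "l \<le> card (edges G)"
      "\<forall>v\<in>verts G. vdegree G v \<le> l" "edge_list G es" "word_fits d w G" for G l es w
  proof -
    define m where "m = card (edges G)"
    have m: "1 \<le> m" "l \<le> m" using asm by (auto simp: m_def)
    have W: "(m + 1) ^ d \<le> 2 ^ w" using asm(7) by (simp add: word_fits_def m_def)
    have pow: "(m + 1) ^ e < 2 ^ w" if "e < d" for e
      using power_strict_increasing[OF that, of "m + 1"] m(1) W by linarith
    have "k < 2 ^ k" by simp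
    also have "\<dots> \<le> (m + 1) ^ k" using m(1) by (intro power_mono) auto
    also have "\<dots> < 2 ^ w" by (rule pow) (simp add: d_def)
    finally have kw: "k < 2 ^ w" .
    have m2: "(m + 1) ^ 2 < 2 ^ w" by (rule pow) (simp add: d_def)
    have "(m + 1) ^ 2 = m * m + 2 * m + 1" by (simp add: power2_eq_square)
    moreover have "4 * m \<le> m * m + 2 * m + 1"
    proof -
      obtain n where "m = Suc n" using m(1) by (cases m) auto
      then show ?thesis by simp
    qed
    ultimately have w: "4 * m \<le> 2 ^ w" "m * m < 2 ^ w" using m2 by linarith+
    obtain s t where pre: "exec w preprocess (input_state es l) = return_spmf (s, t)"
      "t \<le> (6 + 2 * cost insert_arc) * m" and data: "indexed (arcs G) s"
      and s: "reg s 0 = m" "reg s 1 = l" "m \<le> reg s 2 * reg s 2" "(reg s 2 - 1) * (reg s 2 - 1) < m" "1 \<le> reg s 2" "reg s 2 \<le> m"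
      using preprocess[OF asm(1,6) m_def m(1) w] by blast
    have bd: "within_bounds s" using within_bounds_arcs[OF asm(1) _ data] asm(5) s by simp
    have v: "valid w s" using s m asm(3) w by (simp add: valid_def)
    have "plan_size s pA \<le> (m + 1) ^ eA" "plan_size s pB \<le> (m + 1) ^ eB" using eA[of s] eB[of s] s m by auto
    moreover have "(m + 1) ^ eA < 2 ^ w" "(m + 1) ^ eB < 2 ^ w" by (rule pow, simp add: d_def)+
    ultimately have sz: "plan_size s pA < 2 ^ w" "plan_size s pB < 2 ^ w" by linarith+
    interpret A: sampler P k vx pes w s pA G
      using samplerI[OF asm(1) data bd v sz(1) kw pA(1) pA(3)] .
    interpret B: sampler P k vx pes w s pB G
      using samplerI[OF asm(1) data bd v sz(2) kw pB(1) pB(3)] .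
    \<comment> \<open>The guard of the query squares the degree bound, which must not wrap.\<close>
    have "l * l < 2 ^ w" using mult_le_mono[OF m(2) m(2)] w(2) by simp
    then have bv: "bval w b (s'\<lparr>out := []\<rparr>) = (m < l * l)" if "same_data s s'" for s'
      using that s(1,2) by (simp add: b_def same_data_def)
    have cond: "real l \<le> sqrt (real m) \<longleftrightarrow> \<not> m < l * l"
    proof -
      have "real l \<le> sqrt (real m) \<longleftrightarrow> (real l)\<^sup>2 \<le> real m" using real_sqrt_le_iff[of "(real l)\<^sup>2" "real m"] by simp
      also have "(real l)\<^sup>2 \<le> real m \<longleftrightarrow> l * l \<le> m" by (metis of_nat_le_iff of_nat_mult power2_eq_square)
      finally show ?thesis by (simp add: not_less)
    qed
    have "answers w query (same_data s) (sampling_outcome P G) (K * (polymat_undir m l P Cs Ss / real (max 1 (OUT P G))))"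
    proof (cases "m < l * l")
      case True
      have "real (plan_size s pB) \<le> ((6 * 2 ^ k) ^ length Cs * real m powr (real (total_verts Cs) / 2)) *
          (2 ^ length Ss * (real m powr length Ss * real l powr (real (total_verts Ss) - 2 * length Ss)))"
        unfolding pB(2) s of_nat_mult
        using cycles_bound[OF m(1) s(4), of Cs k] Cs stars_bound[OF m(1) asm(3), of Ss] Ss
        by (intro mult_mono) auto
      also have "\<dots> = cB * polymat_undir m l P Cs Ss"
        using True cond by (simp add: cB_def polymat_undir_def Let_def powr_add)
      finally show ?thesis unfolding query_def
        using True cB by (intro B.answers_If_sample[OF bv]) (auto simp: K_def polymat_undir_def Let_def)
    next
      case False
      have "real (plan_size s pA) \<le> 2 * polymat_undir m l P Cs Ss"
        unfolding pA(2) s using False cond by (simp add: polymat_undir_def Let_def k_def)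
      then show ?thesis unfolding query_def
        using False cB by (intro A.answers_If_sample[OF bv]) (auto simp: K_def polymat_undir_def Let_def)
    qed
    moreover have "real t \<le> K * real m"
    proof -
      have "real t \<le> real ((6 + 2 * cost insert_arc) * m)" using pre(2) by (simp only: of_nat_le_iff)
      also have "\<dots> \<le> K * real m" unfolding of_nat_mult using cB by (intro mult_right_mono) (auto simp: K_def)
      finally show ?thesis .
    qed
    ultimately show ?thesis unfolding m_def[symmetric] by (intro sampling_structureI[OF pre(1)]) auto
  qed
  then show ?thesis by blast
qed

end
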